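(* Let $\Sigma$ be a disk with $n$ punctures, and let $\Sigma'$ be a disk with a subset of those $n$ punctures, so that $\Sigma\subset\Sigma'$. Let $L\subset\Sigma\times I\subset\Sigma'\times I$ be a link. Then there is a spectral sequence with $E_1$ page isomorphic to $\mathrm{MKh}(L\subset\Sigma\times I)$ that converges to $\mathrm{MKh}(L\subset\Sigma'\times I)$ (with flattened gradings, both homologies being graded by $\epsilon\circ g^\Sigma$).
   Context: Setting. All links are oriented and considered up to ambient isotopy. $I=[0,1]$ and $\Sigma=\mathbb D^2\setminus\{p_1,\dots,p_n\}$ is an oriented disk with $n$ punctures. A diagram $D\subset\Sigma$ of a link $L\subset\Sigma\times I$ is a generic projection of $L$ to $\Sigma$ with crossing data; it is also a diagram in $\Sigma'$ and in $\mathbb R^2$ via the inclusions. Khovanov complex over $\mathbb Q$. Order the crossings $c_1,\dots,c_N$ of $D$. The $0$-resolution (resp. $1$-resolution) of a crossing joins the two regions swept out when the overstrand is rotated counterclockwise (resp. clockwise) until it meets the understrand. For $S\in\{0,1\}^N$, $D(S)$ is the collection of circles obtained by replacing each $c_i$ by its $S_i$-resolution. Let $V=\mathbb Q\langle v_+,v_-\rangle$, with quantum degrees $+1,-1$. If $D(S)$ has $k$ circles put $\mathrm{CKh}(D(S))=V^{\otimes k}$; its generators are enhanced states $\{(C_i,s_i)\}_i$, labelings of the circles $C_i$ by signs $s_i\in\{+,-\}$. With $n_\pm$ the numbers of positive/negative crossings, $\mathrm{wr}(D)=n_+-n_-$, $|S|=\sum_iS_i$, $$\mathrm{CKh}(D)=\bigoplus_{S}\mathrm{CKh}(D(S))[|S|-n_-]\{|S|-n_-+\mathrm{wr}(D)\},$$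 where $[\cdot]$ and $\{\cdot\}$ are shifts of the homological and quantum gradings, $M[i]_m=M_{m-i}$, $M\{i\}_m=M_{m-i}$. If $S'$ is obtained from $S$ by changing one $0$ (in position $j$) to $1$, then $\partial_{S,S'}$ is the merge map ($v_+\otimes v_+\mapsto v_+$, $v_+\otimes v_-,\,v_-\otimes v_+\mapsto v_-$, $v_-\otimes v_-\mapsto 0$) or the split map ($v_+\mapsto v_+\otimes v_-+v_-\otimes v_+$, $v_-\mapsto v_-\otimes v_-$) on the affected factors and the identity on the others; $\partial=\sum(-1)^{\sum_{i<j}S_i}\partial_{S,S'}$. For a filtration $\mathcal F$ of a complex $C$ by a poset, $\mathrm{gr}(C)=\bigoplus_a\mathcal F_aC/\sum_{b<a}\mathcal F_bC$ with the induced differential. $\mathrm{MKh}$. For an enhanced state $x=\{(C_i,s_i)\}_i$ set $g^\Sigma(x)=\sum_is_i[C_i]\in H_1(\Sigma;\mathbb Z)$, circles oriented counterclockwise. Identify $H_1(\Sigma;\mathbb Z)\cong\mathbb Z^n$ via the basis of positively oriented loops around the punctures, with the product partial order. $\mathcal F^\Sigma_a$ is the span of generators $x$ with $g^\Sigma(x)\le a$ (it is preserved by $\partial$), and $\mathrm{MKh}(L\subset\Sigma\times I)=H^*(\mathrm{gr}(\mathrm{CKh}(D),\partial,\mathcal F^\Sigma))$. The same definitions apply to $\Sigma'$. Flattened gradings. $\epsilon:\mathbb Z^n\to\mathbb Z$ is the sum of coordinates. $\mathrm{MKh}(L\subset\Sigma\times I)$ is regarded as $\mathbb Z$-graded by $\epsilon\circ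 g^\Sigma$. The $\mathbb Z$-grading $\epsilon\circ g^\Sigma$ on generators of $\mathrm{CKh}(D)$ induces a $\mathbb Z$-filtration on $\mathrm{CKh}(D)$, hence one on $\mathrm{gr}(\mathrm{CKh}(D),\partial,\mathcal F^{\Sigma'})$ and on its homology $\mathrm{MKh}(L\subset\Sigma'\times I)$; convergence means that the $E_\infty$ page is isomorphic to the associated graded of $\mathrm{MKh}(L\subset\Sigma'\times I)$ for this filtration. *)

theory Defs
  imports "HOL-Complex_Analysis.Winding_Numbers" "HOL-Library.Function_Algebras"
begin

section \<open>Subquotients of rational vector spaces\<close>

definition qscale :: "rat \<Rightarrow> ('x \<Rightarrow> rat) \<Rightarrow> 'x \<Rightarrow> rat" where
  "qscale c f = (\<lambda>x. c * f x)"

interpretation qv: vector_space qscale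
  by unfold_locales (auto simp: qscale_def fun_eq_iff algebra_simps)

text \<open>A pair \<open>(Z, B)\<close> of subspaces \<open>B \<subseteq> Z\<close> of \<open>'x \<Rightarrow> rat\<close> stands for the quotient space \<open>Z / B\<close>.
  A linear map \<open>Z / B \<rightarrow> Z' / B'\<close> is represented by a linear map of the ambient spaces which sends
  \<open>Z\<close> to \<open>Z'\<close> and \<open>B\<close> to \<open>B'\<close>; over a field every linear map between the quotients arises so.\<close>

type_synonym 'x subquot = "('x \<Rightarrow> rat) set \<times> ('x \<Rightarrow> rat) set"

definition is_subquot :: "'x subquot \<Rightarrow> bool" where
  "is_subquot X \<longleftrightarrow> qv.subspace (fst X) \<and> qv.subspace (snd X) \<and> snd X \<subseteq> fst X"

definition subquot_map :: "(('x \<Rightarrow> rat) \<Rightarrow> 'y \<Rightarrow> rat) \<Rightarrow> 'x subquot \<Rightarrow> 'y subquot \<Rightarrow> bool" where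
  "subquot_map f X Y \<longleftrightarrow>
     Vector_Spaces.linear qscale qscale f \<and> f ` fst X \<subseteq> fst Y \<and> f ` snd X \<subseteq> snd Y"

definition subquot_iso :: "'x subquot \<Rightarrow> 'y subquot \<Rightarrow> bool" (infix "\<cong>\<^sub>q" 50) where
  "X \<cong>\<^sub>q Y \<longleftrightarrow> (\<exists>f. subquot_map f X Y
      \<and> (\<forall>x\<in>fst X. f x \<in> snd Y \<longrightarrow> x \<in> snd X)
      \<and> (\<forall>y\<in>fst Y. \<exists>x\<in>fst X. y - f x \<in> snd Y))"

text \<open>Homology at \<open>Y\<close> of \<open>X \<rightarrow> Y \<rightarrow> W\<close>: for \<open>Y = (Z, B)\<close> it is a subquotient of \<open>Z / B\<close>, hence
  again a subquotient of the ambient space of \<open>Y\<close>.\<close>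

definition cycles :: "(('x \<Rightarrow> rat) \<Rightarrow> 'y \<Rightarrow> rat) \<Rightarrow> 'x subquot \<Rightarrow> 'y subquot \<Rightarrow> ('x \<Rightarrow> rat) set" where
  "cycles d Y W = {y \<in> fst Y. d y \<in> snd W}"

definition boundaries :: "(('x \<Rightarrow> rat) \<Rightarrow> 'y \<Rightarrow> rat) \<Rightarrow> 'x subquot \<Rightarrow> 'y subquot \<Rightarrow> ('y \<Rightarrow> rat) set" where
  "boundaries d X Y = {d x + b | x b. x \<in> fst X \<and> b \<in> snd Y}"

definition homology :: "(('x \<Rightarrow> rat) \<Rightarrow> 'y \<Rightarrow> rat) \<Rightarrow> (('y \<Rightarrow> rat) \<Rightarrow> 'z \<Rightarrow> rat) \<Rightarrow>
    'x subquot \<Rightarrow> 'y subquot \<Rightarrow> 'z subquot \<Rightarrow> 'y subquot" where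
  "homology d d' X Y W = (cycles d' Y W, boundaries d X Y)"

definition assoc_gr :: "'a::order set \<Rightarrow> ('a \<Rightarrow> ('x \<Rightarrow> rat) set) \<Rightarrow> 'a \<Rightarrow> 'x subquot" where
  "assoc_gr I F a = (F a, qv.span (\<Union>b\<in>{b \<in> I. b < a}. F b))"

definition direct_sum_space :: "'i set \<Rightarrow> ('i \<Rightarrow> ('x \<Rightarrow> rat) set) \<Rightarrow> ('i \<times> 'x \<Rightarrow> rat) set" where
  "direct_sum_space I V = {f. (\<forall>i\<in>I. (\<lambda>x. f (i, x)) \<in> V i) \<and> (\<forall>i. i \<notin> I \<longrightarrow> (\<forall>x. f (i, x) = 0))
      \<and> finite {i. \<exists>x. f (i, x) \<noteq> 0}}"

definition direct_sum :: "'i set \<Rightarrow> ('i \<Rightarrow> 'x subquot) \<Rightarrow> ('i \<times> 'x) subquot" where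
  "direct_sum I X = (direct_sum_space I (\<lambda>i. fst (X i)), direct_sum_space I (\<lambda>i. snd (X i)))"

definition componentwise :: "(('x \<Rightarrow> rat) \<Rightarrow> 'y \<Rightarrow> rat) \<Rightarrow> ('i \<times> 'x \<Rightarrow> rat) \<Rightarrow> 'i \<times> 'y \<Rightarrow> rat" where
  "componentwise d f = (\<lambda>(i, y). d (\<lambda>x. f (i, x)) y)"


section \<open>Spectral sequences\<close>

text \<open>The pages \<open>E r k h q\<close>, \<open>r \<ge> 1\<close>, are graded by a filtration degree \<open>k\<close>, a homological degree \<open>h\<close>
  and a quantum degree \<open>q\<close>. Filtrations are increasing and the differentials lower the filtration:
  \<open>d r\<close> has degree \<open>(-r, 1, 0)\<close>.\<close>

type_synonym 'x pages = "nat \<Rightarrow> int \<Rightarrow> int \<Rightarrow> int \<Rightarrow> 'x subquot"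
type_synonym 'x page_diffs = "nat \<Rightarrow> int \<Rightarrow> int \<Rightarrow> int \<Rightarrow> ('x \<Rightarrow> rat) \<Rightarrow> 'x \<Rightarrow> rat"

definition spectral_sequence :: "'x pages \<Rightarrow> 'x page_diffs \<Rightarrow> bool" where
  "spectral_sequence E d \<longleftrightarrow> (\<forall>r\<ge>1. \<forall>k h q.
      is_subquot (E r k h q)
    \<and> subquot_map (d r k h q) (E r k h q) (E r (k - int r) (h + 1) q)
    \<and> (\<forall>x\<in>fst (E r k h q).
         d r (k - int r) (h + 1) q (d r k h q x) \<in> snd (E r (k - int r - int r) (h + 1 + 1) q))
    \<and> E (Suc r) k h q \<cong>\<^sub>q
        homology (d r (k + int r) (h - 1) q) (d r k h q)
          (E r (k + int r) (h - 1) q) (E r k h q) (E r (k - int r) (h + 1) q))"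

text \<open>In every degree the differentials into and out of \<open>E r k h q\<close> vanish for all large \<open>r\<close>, and the
  resulting stable value \<open>E\<^sub>\<infinity>\<close> is the prescribed one.\<close>

definition E_infinity_iso :: "'x pages \<Rightarrow> 'x page_diffs \<Rightarrow> (int \<Rightarrow> int \<Rightarrow> int \<Rightarrow> 'y subquot) \<Rightarrow> bool" where
  "E_infinity_iso E d A \<longleftrightarrow> (\<forall>k h q. \<exists>R\<ge>1.
      (\<forall>r\<ge>R. d r k h q ` fst (E r k h q) \<subseteq> snd (E r (k - int r) (h + 1) q)
            \<and> d r (k + int r) (h - 1) q ` fst (E r (k + int r) (h - 1) q) \<subseteq> snd (E r k h q))
    \<and> E R k h q \<cong>\<^sub>q A k h q)"


section \<open>Links in a thickened punctured disk and their diagrams\<close>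

text \<open>Each component of an oriented link is a 1-periodic parametrisation, the orientation being that of
  the parameter. The disk is the closed unit disk of \<open>\<complex>\<close>, punctured at the points of \<open>P\<close>.\<close>

type_synonym link = "(real \<Rightarrow> complex \<times> real) list"

definition punctured_disk :: "complex set \<Rightarrow> complex set" where
  "punctured_disk P = cball 0 1 - P"

definition is_link :: "complex set \<Rightarrow> link \<Rightarrow> bool" where
  "is_link P L \<longleftrightarrow>
     (\<forall>\<gamma>\<in>set L. (\<forall>t. \<gamma> (t + 1) = \<gamma> t) \<and> \<gamma> C1_differentiable_on UNIV
        \<and> (\<forall>t. vector_derivative \<gamma> (at t) \<noteq> 0) \<and> range \<gamma> \<subseteq> punctured_disk P \<times> {0..1})
   \<and> (\<forall>i<length L. \<forall>j<length L. \<forall>s\<in>{0..<1}. \<forall>t\<in>{0..<1}.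
        (L ! i) s = (L ! j) t \<longrightarrow> i = j \<and> s = t)"

text \<open>A strand point \<open>(i, t)\<close> is the parameter \<open>t\<close> on the component \<open>i\<close>.\<close>

definition proj :: "link \<Rightarrow> nat \<Rightarrow> real \<Rightarrow> complex" where
  "proj L i t = fst ((L ! i) t)"

fun pos :: "link \<Rightarrow> nat \<times> real \<Rightarrow> complex" where
  "pos L (i, t) = proj L i t"

fun height :: "link \<Rightarrow> nat \<times> real \<Rightarrow> real" where
  "height L (i, t) = snd ((L ! i) t)"

fun tangent :: "link \<Rightarrow> nat \<times> real \<Rightarrow> complex" where
  "tangent L (i, t) = vector_derivative (proj L i) (at t)"

definition strand_points :: "link \<Rightarrow> complex \<Rightarrow> (nat \<times> real) set" where
  "strand_points L x = {(i, t). i < length L \<and> 0 \<le> t \<and> t < 1 \<and> proj L i t = x}"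

definition crossings :: "link \<Rightarrow> complex set" where
  "crossings L = {x. \<exists>v\<in>strand_points L x. \<exists>w\<in>strand_points L x. v \<noteq> w}"

text \<open>\<open>Im (cnj u * v)\<close> is the determinant of \<open>(u, v)\<close>: it is positive iff \<open>v\<close> is reached from \<open>u\<close> by a
  counterclockwise rotation by an angle in \<open>(0, \<pi>)\<close>.\<close>

definition det2 :: "complex \<Rightarrow> complex \<Rightarrow> real" where
  "det2 u v = Im (cnj u * v)"

definition generic_projection :: "link \<Rightarrow> bool" where
  "generic_projection L \<longleftrightarrow>
     (\<forall>i<length L. \<forall>t. tangent L (i, t) \<noteq> 0)
   \<and> finite (crossings L)
   \<and> (\<forall>x\<in>crossings L. card (strand_points L x) = 2
        \<and> (\<forall>v\<in>strand_points L x. \<forall>w\<in>strand_points L x.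
             v \<noteq> w \<longrightarrow> det2 (tangent L v) (tangent L w) \<noteq> 0))"

definition crossings_of_sign :: "real \<Rightarrow> link \<Rightarrow> complex set" where
  "crossings_of_sign \<epsilon> L = {x \<in> crossings L. \<exists>v\<in>strand_points L x. \<exists>w\<in>strand_points L x.
      height L w < height L v \<and> sgn (det2 (tangent L v) (tangent L w)) = \<epsilon>}"

definition n_plus :: "link \<Rightarrow> int" where
  "n_plus L = int (card (crossings_of_sign 1 L))"

definition n_minus :: "link \<Rightarrow> int" where
  "n_minus L = int (card (crossings_of_sign (-1) L))"

definition writhe :: "link \<Rightarrow> int" where
  "writhe L = n_plus L - n_minus L"


section \<open>Resolutions\<close>

text \<open>The crossings cut the diagram into arcs. The arc \<open>(i, a, b)\<close> is the image of \<open>{a..b}\<close> on the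
  component \<open>i\<close>; it begins and ends at crossings, \<open>b\<close> being allowed to exceed 1. A component
  without crossings is a single closed arc \<open>(i, 0, 1)\<close>.\<close>

type_synonym diagram_arc = "nat \<times> real \<times> real"

definition crossing_params :: "link \<Rightarrow> nat \<Rightarrow> real set" where
  "crossing_params L i = {t. proj L i t \<in> crossings L}"

definition arcs :: "link \<Rightarrow> diagram_arc set" where
  "arcs L = {(i, a, b). i < length L \<and> 0 \<le> a \<and> a < 1 \<and> a < b
        \<and> a \<in> crossing_params L i \<and> b \<in> crossing_params L i \<and> {a<..<b} \<inter> crossing_params L i = {}}
     \<union> {(i, 0, 1) | i. i < length L \<and> crossing_params L i = {}}"

text \<open>\<open>(A, True)\<close> and \<open>(A, False)\<close> are the initial and the final end of the arc \<open>A\<close>; the direction of an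
  end points from its crossing into the arc.\<close>

type_synonym arc_end = "diagram_arc \<times> bool"

fun end_point :: "arc_end \<Rightarrow> nat \<times> real" where
  "end_point ((i, a, b), e) = (i, if e then a else b)"

fun end_sign :: "arc_end \<Rightarrow> int" where
  "end_sign (A, e) = (if e then 1 else -1)"

definition end_dir :: "link \<Rightarrow> arc_end \<Rightarrow> complex" where
  "end_dir L u = of_int (end_sign u) * tangent L (end_point u)"

text \<open>States \<open>S \<in> {0,1}\<^sup>N\<close> are encoded as the set of the 1-resolved crossings. Let \<open>u\<close> be an end of the
  overstrand and \<open>v\<close> an end of the understrand at a crossing. If \<open>det2 > 0\<close>, the sector between them is
  swept out by rotating the overstrand counterclockwise. The 0-resolution opens this sector to the
  opposite one and so separates \<open>u\<close> from \<open>v\<close>, while the 1-resolution, which joins the other two sectors,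
  connects \<open>u\<close> to \<open>v\<close>. If \<open>det2 < 0\<close> it is the other way round.\<close>

definition joined :: "link \<Rightarrow> complex set \<Rightarrow> arc_end \<Rightarrow> arc_end \<Rightarrow> bool" where
  "joined L S u v \<longleftrightarrow> fst u \<in> arcs L \<and> fst v \<in> arcs L
     \<and> pos L (end_point u) = pos L (end_point v)
     \<and> height L (end_point v) < height L (end_point u)
     \<and> (if pos L (end_point u) \<in> S then det2 (end_dir L u) (end_dir L v) > 0
        else det2 (end_dir L u) (end_dir L v) < 0)"

text \<open>A circle of the resolution is recorded as the set of the arcs it consists of.\<close>

type_synonym circle = "diagram_arc set"

definition circles :: "link \<Rightarrow> complex set \<Rightarrow> circle set" where
  "circles L S = arcs L // {(A, B). A \<in> arcs L \<and> B \<in> arcs L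
      \<and> equivclp (\<lambda>A B. \<exists>e e'. joined L S (A, e) (B, e')) A B}"

text \<open>An orientation of a circle assigns to each of its arcs the sign relating it to the orientation of the
  link. Where two ends are joined, one is traversed towards and the other away from the crossing.\<close>

definition circle_orientation ::
    "link \<Rightarrow> complex set \<Rightarrow> circle \<Rightarrow> (diagram_arc \<Rightarrow> int) \<Rightarrow> bool" where
  "circle_orientation L S C ori \<longleftrightarrow> (\<forall>A\<in>C. ori A \<in> {1, -1})
     \<and> (\<forall>A\<in>C. \<forall>B\<in>C. \<forall>e e'. joined L S (A, e) (B, e') \<longrightarrow>
          ori A * end_sign (A, e) = - (ori B * end_sign (B, e')))"

fun arc_path :: "link \<Rightarrow> diagram_arc \<Rightarrow> real \<Rightarrow> complex" where
  "arc_path L (i, a, b) = subpath a b (proj L i)"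

text \<open>Winding number about \<open>p\<close> of the closed path made up of the arcs of \<open>C\<close>, by additivity of
  \<open>winding_number\<close> (which is not an integer for a single arc) under concatenation. This closed path is
  homotopic, in the complement of the punctures, to the smoothed circle.\<close>

definition circle_winding :: "link \<Rightarrow> circle \<Rightarrow> (diagram_arc \<Rightarrow> int) \<Rightarrow> complex \<Rightarrow> complex" where
  "circle_winding L C ori p = (\<Sum>A\<in>C. of_int (ori A) * winding_number (arc_path L A) p)"

text \<open>The class in \<open>H\<^sub>1\<close> of the punctured disk, as a vector in \<open>\<int>\<^sup>P\<close>. The coordinate at \<open>p\<close> in the basis of
  positively oriented loops around the punctures is the winding number about \<open>p\<close>. Reversing the
  orientation of a circle changes the sign of all its winding numbers, and those of a simple closed curve
  oriented counterclockwise are nonnegative, which selects the sign below. Vectors in \<open>\<int>\<^sup>P\<close> are extended by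
  zero outside \<open>P\<close>, so that the order of functions restricts to the product order.\<close>

definition circle_class :: "complex set \<Rightarrow> link \<Rightarrow> complex set \<Rightarrow> circle \<Rightarrow> complex \<Rightarrow> int" where
  "circle_class P L S C = (\<lambda>p. if p \<in> P
      then (THE k. 0 \<le> k \<and> (\<exists>ori. circle_orientation L S C ori \<and> of_int k = circle_winding L C ori p))
      else 0)"

definition lattice :: "complex set \<Rightarrow> (complex \<Rightarrow> int) set" where
  "lattice P = {a. \<forall>p. p \<notin> P \<longrightarrow> a p = 0}"

definition coord_sum :: "complex set \<Rightarrow> (complex \<Rightarrow> int) \<Rightarrow> int" where
  "coord_sum P a = (\<Sum>p\<in>P. a p)"


section \<open>The Khovanov complex\<close>

text \<open>An enhanced state is a pair of a state and the set of those circles of its resolution that carry the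
  label \<open>+\<close>.\<close>

type_synonym enhanced_state = "complex set \<times> circle set"

definition enhanced_states :: "link \<Rightarrow> enhanced_state set" where
  "enhanced_states L = {(S, X). S \<subseteq> crossings L \<and> X \<subseteq> circles L S}"

fun label_sign :: "enhanced_state \<Rightarrow> circle \<Rightarrow> int" where
  "label_sign (S, X) C = (if C \<in> X then 1 else -1)"

definition hdeg :: "link \<Rightarrow> enhanced_state \<Rightarrow> int" where
  "hdeg L x = int (card (fst x)) - n_minus L"

definition qdeg :: "link \<Rightarrow> enhanced_state \<Rightarrow> int" where
  "qdeg L x = (\<Sum>C\<in>circles L (fst x). label_sign x C) + int (card (fst x)) - n_minus L + writhe L"

definition state_class :: "complex set \<Rightarrow> link \<Rightarrow> enhanced_state \<Rightarrow> complex \<Rightarrow> int" where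
  "state_class P L x =
     (\<lambda>p. \<Sum>C\<in>circles L (fst x). label_sign x C * circle_class P L (fst x) C p)"

text \<open>Matrix entry of the merge or split map from \<open>(S, X)\<close> to \<open>(S', X')\<close>, where \<open>S'\<close> changes one crossing
  of \<open>S\<close> from 0 to 1. A circle belonging to only one of the two resolutions is affected by this change;
  the basis elements of the tensor product on the affected circles are given by the number of factors
  \<open>v\<^sub>+\<close>, up to permutation of the factors.\<close>

fun edge_entry :: "link \<Rightarrow> enhanced_state \<Rightarrow> enhanced_state \<Rightarrow> rat" where
  "edge_entry L (S, X) (S', X') =
    (let old = circles L S - circles L S'; new = circles L S' - circles L S;
         unaffected = circles L S \<inter> circles L S';
         p = card (X \<inter> old); p' = card (X' \<inter> new)
     in if X \<inter> unaffected = X' \<inter> unaffected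
           \<and> (card old = 2 \<and> card new = 1 \<and> (p = 2 \<and> p' = 1 \<or> p = 1 \<and> p' = 0)
             \<or> card old = 1 \<and> card new = 2 \<and> (p = 1 \<and> p' = 1 \<or> p = 0 \<and> p' = 0))
        then 1 else 0)"

text \<open>\<open>cs\<close> is the chosen order of the crossings.\<close>

definition diff_entry :: "complex list \<Rightarrow> link \<Rightarrow> enhanced_state \<Rightarrow> enhanced_state \<Rightarrow> rat" where
  "diff_entry cs L x y = (\<Sum>j<length cs. if cs ! j \<notin> fst x \<and> fst y = insert (cs ! j) (fst x)
      then (-1) ^ card {i. i < j \<and> cs ! i \<in> fst x} * edge_entry L x y else 0)"

definition CKh :: "link \<Rightarrow> int \<Rightarrow> int \<Rightarrow> (enhanced_state \<Rightarrow> rat) set" where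
  "CKh L h q = {f. \<forall>x. f x \<noteq> 0 \<longrightarrow> x \<in> enhanced_states L \<and> hdeg L x = h \<and> qdeg L x = q}"

definition CKh_diff ::
    "complex list \<Rightarrow> link \<Rightarrow> (enhanced_state \<Rightarrow> rat) \<Rightarrow> enhanced_state \<Rightarrow> rat" where
  "CKh_diff cs L f = (\<lambda>y. if y \<in> enhanced_states L
      then \<Sum>x\<in>enhanced_states L. f x * diff_entry cs L x y else 0)"


section \<open>Multi-punctured Khovanov homology\<close>

definition puncture_filtration ::
    "complex set \<Rightarrow> link \<Rightarrow> int \<Rightarrow> int \<Rightarrow> (complex \<Rightarrow> int) \<Rightarrow> (enhanced_state \<Rightarrow> rat) set" where
  "puncture_filtration P L h q a = {f \<in> CKh L h q. \<forall>x. f x \<noteq> 0 \<longrightarrow> state_class P L x \<le> a}"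

text \<open>The summand of \<open>gr(CKh)\<close> with grading in \<open>I \<subseteq> \<int>\<^sup>P\<close>.\<close>

definition gr_CKh :: "complex set \<Rightarrow> (complex \<Rightarrow> int) set \<Rightarrow> link \<Rightarrow> int \<Rightarrow> int \<Rightarrow>
    ((complex \<Rightarrow> int) \<times> enhanced_state) subquot" where
  "gr_CKh P I L h q = direct_sum I (assoc_gr (lattice P) (puncture_filtration P L h q))"

definition gr_diff :: "complex list \<Rightarrow> link \<Rightarrow> ((complex \<Rightarrow> int) \<times> enhanced_state \<Rightarrow> rat) \<Rightarrow>
    (complex \<Rightarrow> int) \<times> enhanced_state \<Rightarrow> rat" where
  "gr_diff cs L = componentwise (CKh_diff cs L)"

definition MKh_on :: "complex set \<Rightarrow> (complex \<Rightarrow> int) set \<Rightarrow> complex list \<Rightarrow> link \<Rightarrow> int \<Rightarrow> int \<Rightarrow>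
    ((complex \<Rightarrow> int) \<times> enhanced_state) subquot" where
  "MKh_on P I cs L h q = homology (gr_diff cs L) (gr_diff cs L)
      (gr_CKh P I L (h - 1) q) (gr_CKh P I L h q) (gr_CKh P I L (h + 1) q)"

definition MKh :: "complex set \<Rightarrow> complex list \<Rightarrow> link \<Rightarrow> int \<Rightarrow> int \<Rightarrow>
    ((complex \<Rightarrow> int) \<times> enhanced_state) subquot" where
  "MKh P = MKh_on P (lattice P)"

text \<open>The part of flattened degree \<open>k\<close>.\<close>

definition flat_MKh :: "complex set \<Rightarrow> complex list \<Rightarrow> link \<Rightarrow> int \<Rightarrow> int \<Rightarrow> int \<Rightarrow>
    ((complex \<Rightarrow> int) \<times> enhanced_state) subquot" where
  "flat_MKh P cs L k = MKh_on P {a \<in> lattice P. coord_sum P a = k} cs L"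

text \<open>The filtration of \<open>MKh P'\<close> induced by the flattened grading of the generators with respect to \<open>P\<close>:
  level \<open>k\<close> consists of the homology classes of \<open>gr(CKh)\<close> that have a representative supported on
  generators of degree at most \<open>k\<close>. It is given as a subspace containing the boundaries.\<close>

definition MKh_filtration :: "complex set \<Rightarrow> complex set \<Rightarrow> complex list \<Rightarrow> link \<Rightarrow> int \<Rightarrow> int \<Rightarrow> int \<Rightarrow>
    ((complex \<Rightarrow> int) \<times> enhanced_state \<Rightarrow> rat) set" where
  "MKh_filtration P P' cs L h q k =
     {z + b | z b. z \<in> fst (MKh P' cs L h q) \<and> b \<in> snd (MKh P' cs L h q)
        \<and> (\<forall>a x. z (a, x) \<noteq> 0 \<longrightarrow> coord_sum P (state_class P L x) \<le> k)}"

definition gr_MKh :: "complex set \<Rightarrow> complex set \<Rightarrow> complex list \<Rightarrow> link \<Rightarrow> int \<Rightarrow> int \<Rightarrow> int \<Rightarrow>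
    ((complex \<Rightarrow> int) \<times> enhanced_state) subquot" where
  "gr_MKh P P' cs L k h q = assoc_gr UNIV (MKh_filtration P P' cs L h q) k"

end

theory Submission
  imports Defs "HOL-Library.Multiset"
begin


text \<open>\<open>MKh\<close> for \<open>P'\<close> is the homology of \<open>gr(CKh)\<close> for \<open>P'\<close>, on which the differential does not increase the
  degree \<open>\<epsilon> \<circ> g\<close> of \<open>P\<close>. The spectral sequence is that of this filtration. Since the differential does not
  increase any coordinate of \<open>g\<close>, its part preserving the sum of the coordinates preserves \<open>g\<close>, so the first page
  is \<open>MKh\<close> for \<open>P\<close>.

  That \<open>CKh\<close> is a filtered complex rests on the planarity of the diagram. The winding numbers of the link
  on the two sides of an arc differ by one, so their parities give a source-sink orientation of the
  arcs, and a resolution is a permutation of the arcs. Changing the resolution of one crossing composes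
  this permutation with a transposition, which merges two orbits or splits one. The signed class of a
  circle is then additive under merging, and the filtration property is the triangle inequality.\<close>

section \<open>Plane curves and the diagram\<close>

text \<open>Circles are given only as sets of arcs, so there is no embedded curve to which the
  Jordan curve theorem could be applied. Absolute values take its place: in the common orientation
  of the arcs every circle has an integral winding number about each puncture, and its
  counterclockwise class is the absolute value of that number. Whether circles are nested never
  enters. That the Khovanov differential squares to zero rests on the commutation of the faces of
  the cube. With the tensor powers of \<open>V\<close> written as quotients of polynomial rings, a
  merge is the identity on monomials and a split is multiplication by \<open>x_a + x_b\<close>. Such
  operators commute formally, apart from two kinds of faces, which are settled by locating the four
  arcs on the circles. The graded complex consists of quotients, while the pages have to be
  subquotients of one function space. Each generator is therefore kept only in its own degree; these
  normal forms carry an honest differential, and the identity map then represents the passage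
  between pages and the limit.\<close>

declare tangent.simps [simp del] height.simps [simp del]

text \<open>The mean value inequality for \<open>\<alpha> s - s * \<alpha>' a\<close>, whose
  derivative is small near \<open>a\<close>. Both parameters are free, as local injectivity
  requires.\<close>

lemma C1_curve_estimate:
  fixes \<alpha> \<alpha>' :: "real \<Rightarrow> complex"
  assumes der: "\<And>t. (\<alpha> has_vector_derivative \<alpha>' t) (at t)" and cont: "isCont \<alpha>' a" and "\<epsilon> > 0"
  obtains \<delta> where "\<delta> > 0"
    "\<And>s t. \<bar>s - a\<bar> < \<delta> \<Longrightarrow> \<bar>t - a\<bar> < \<delta> \<Longrightarrow> norm (\<alpha> s - \<alpha> t - of_real (s - t) * \<alpha>' a) \<le> \<epsilon> * \<bar>s - t\<bar>"
proof -
  obtain \<delta> where \<delta>: "\<delta> > 0" "\<And>t. dist t a < \<delta> \<Longrightarrow> dist (\<alpha>' t) (\<alpha>' a) < \<epsilon>"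
    using cont \<open>\<epsilon> > 0\<close> unfolding continuous_at_eps_delta by blast
  show ?thesis
  proof (rule that[OF \<delta>(1)])
    fix s t assume st: "\<bar>s - a\<bar> < \<delta>" "\<bar>t - a\<bar> < \<delta>"
    have "norm ((\<alpha> s - of_real s * \<alpha>' a) - (\<alpha> t - of_real t * \<alpha>' a)) \<le> \<epsilon> * norm (s - t)"
    proof (rule differentiable_bound[where S = "ball a \<delta>" and f' = "\<lambda>x h. h *\<^sub>R (\<alpha>' x - \<alpha>' a)"])
      fix x assume x: "x \<in> ball a \<delta>"
      have "((\<lambda>s. \<alpha> s - s *\<^sub>R \<alpha>' a) has_vector_derivative \<alpha>' x - 1 *\<^sub>R \<alpha>' a) (at x within ball a \<delta>)"
        by (intro derivative_intros has_vector_derivative_at_within[OF der])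
          (auto intro!: derivative_eq_intros)
      then show "((\<lambda>s. \<alpha> s - of_real s * \<alpha>' a) has_derivative (\<lambda>h. h *\<^sub>R (\<alpha>' x - \<alpha>' a))) (at x within ball a \<delta>)"
        by (simp add: has_vector_derivative_def scaleR_conv_of_real)
      have "norm (\<alpha>' x - \<alpha>' a) \<le> \<epsilon>"
        using \<delta>(2)[of x] x by (auto simp: dist_norm norm_minus_commute abs_minus_commute less_imp_le)
      then show "onorm (\<lambda>h. h *\<^sub>R (\<alpha>' x - \<alpha>' a)) \<le> \<epsilon>"
        by (intro onorm_le) (auto simp: mult.commute[of \<epsilon>] intro: mult_left_mono)
    qed (use st in \<open>auto simp: dist_norm abs_minus_commute\<close>)
    then show "norm (\<alpha> s - \<alpha> t - of_real (s - t) * \<alpha>' a) \<le> \<epsilon> * \<bar>s - t\<bar>"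
      by (simp add: algebra_simps)
  qed
qed

text \<open>Cramer's rule: the determinant of the combination with \<open>v\<close> or
  \<open>u\<close> recovers one coefficient times \<open>det2 u v\<close>. This makes linear
  independence quantitative.\<close>

lemma det2_linear_bound:
  fixes a b :: real
  shows "(\<bar>a\<bar> + \<bar>b\<bar>) * \<bar>det2 u v\<bar> \<le> norm (of_real a * u + of_real b * v) * (norm u + norm v)"
proof -
  let ?w = "of_real a * u + of_real b * v"
  have bound: "\<bar>det2 x y\<bar> \<le> norm x * norm y" for x y
    unfolding det2_def by (metis abs_Im_le_cmod complex_mod_cnj norm_mult)
  have "a * det2 u v = det2 ?w v" "b * det2 u v = det2 u ?w"
    by (auto simp: det2_def algebra_simps)
  then have "\<bar>a\<bar> * \<bar>det2 u v\<bar> \<le> norm ?w * norm v" "\<bar>b\<bar> * \<bar>det2 u v\<bar> \<le> norm u * norm ?w"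
    by (metis abs_mult bound)+
  then show ?thesis by (simp add: algebra_simps)
qed

text \<open>An inverse function theorem by hand: the linear part of
  \<open>\<alpha> s + \<beta> t\<close> expands by a definite factor, which the errors of the two
  curves cannot compensate. The curve \<open>\<beta>\<close> will be a second strand or a straight
  normal.\<close>

lemma transversal_sum_inj:
  fixes \<alpha> \<beta> \<alpha>' \<beta>' :: "real \<Rightarrow> complex"
  assumes "\<And>t. (\<alpha> has_vector_derivative \<alpha>' t) (at t)" "isCont \<alpha>' a"
    and "\<And>t. (\<beta> has_vector_derivative \<beta>' t) (at t)" "isCont \<beta>' b"
    and det: "det2 (\<alpha>' a) (\<beta>' b) \<noteq> 0"
  obtains \<delta> where "\<delta> > 0"
    "\<And>s t s' t'. \<bar>s - a\<bar> < \<delta> \<Longrightarrow> \<bar>t - b\<bar> < \<delta> \<Longrightarrow> \<bar>s' - a\<bar> < \<delta> \<Longrightarrow> \<bar>t' - b\<bar> < \<delta> \<Longrightarrow>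
       \<alpha> s + \<beta> t = \<alpha> s' + \<beta> t' \<Longrightarrow> s = s' \<and> t = t'"
proof -
  define M where "M = norm (\<alpha>' a) + norm (\<beta>' b)"
  have "\<alpha>' a \<noteq> 0" using det by (auto simp: det2_def)
  then have M: "M > 0" unfolding M_def by (simp add: add_pos_nonneg)
  \<comment> \<open>Half the expansion factor from \<open>det2_linear_bound\<close>, so that the
    errors use up at most half of it.\<close>
  define \<epsilon> where "\<epsilon> = \<bar>det2 (\<alpha>' a) (\<beta>' b)\<bar> / (2 * M)"
  have "\<epsilon> > 0" using M det by (simp add: \<epsilon>_def)
  obtain \<delta>1 where d1: "\<delta>1 > 0" "\<And>s t. \<bar>s - a\<bar> < \<delta>1 \<Longrightarrow> \<bar>t - a\<bar> < \<delta>1 \<Longrightarrow> norm (\<alpha> s - \<alpha> t - of_real (s - t) * \<alpha>' a) \<le> \<epsilon> * \<bar>s - t\<bar>"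
    using C1_curve_estimate[OF assms(1,2) \<open>\<epsilon> > 0\<close>] by blast
  obtain \<delta>2 where d2: "\<delta>2 > 0" "\<And>s t. \<bar>s - b\<bar> < \<delta>2 \<Longrightarrow> \<bar>t - b\<bar> < \<delta>2 \<Longrightarrow> norm (\<beta> s - \<beta> t - of_real (s - t) * \<beta>' b) \<le> \<epsilon> * \<bar>s - t\<bar>"
    using C1_curve_estimate[OF assms(3,4) \<open>\<epsilon> > 0\<close>] by blast
  show ?thesis
  proof (rule that[of "min \<delta>1 \<delta>2"])
    fix s t s' t' assume h: "\<bar>s - a\<bar> < min \<delta>1 \<delta>2" "\<bar>t - b\<bar> < min \<delta>1 \<delta>2" "\<bar>s' - a\<bar> < min \<delta>1 \<delta>2" "\<bar>t' - b\<bar> < min \<delta>1 \<delta>2"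
       "\<alpha> s + \<beta> t = \<alpha> s' + \<beta> t'"
    let ?w = "of_real (s - s') * \<alpha>' a + of_real (t - t') * \<beta>' b"
    have "?w = - ((\<alpha> s - \<alpha> s' - of_real (s - s') * \<alpha>' a) + (\<beta> t - \<beta> t' - of_real (t - t') * \<beta>' b))"
      using h(5) by (simp add: algebra_simps)
    also have "norm \<dots> \<le> norm (\<alpha> s - \<alpha> s' - of_real (s - s') * \<alpha>' a) + norm (\<beta> t - \<beta> t' - of_real (t - t') * \<beta>' b)"
      by (metis norm_minus_cancel norm_triangle_ineq)
    also have "\<dots> \<le> \<epsilon> * \<bar>s - s'\<bar> + \<epsilon> * \<bar>t - t'\<bar>"
      using d1(2)[of s s'] d2(2)[of t t'] h by auto
    finally have "norm ?w \<le> \<epsilon> * (\<bar>s - s'\<bar> + \<bar>t - t'\<bar>)" by (simp add: algebra_simps)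
    then have "norm ?w * M \<le> \<epsilon> * (\<bar>s - s'\<bar> + \<bar>t - t'\<bar>) * M" using M by (simp add: mult_right_mono)
    with det2_linear_bound[of "s - s'" "t - t'" "\<alpha>' a" "\<beta>' b"]
    have "(\<bar>s - s'\<bar> + \<bar>t - t'\<bar>) * \<bar>det2 (\<alpha>' a) (\<beta>' b)\<bar> \<le> \<epsilon> * (\<bar>s - s'\<bar> + \<bar>t - t'\<bar>) * M"
      unfolding M_def by linarith
    also have "\<dots> = (\<bar>s - s'\<bar> + \<bar>t - t'\<bar>) * \<bar>det2 (\<alpha>' a) (\<beta>' b)\<bar> / 2"
      using M by (simp add: \<epsilon>_def)
    finally have "(\<bar>s - s'\<bar> + \<bar>t - t'\<bar>) * \<bar>det2 (\<alpha>' a) (\<beta>' b)\<bar> \<le> 0" by linarith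
    then have "\<bar>s - s'\<bar> + \<bar>t - t'\<bar> \<le> 0" using det
      by (simp add: mult_le_0_iff)
    then show "s = s' \<and> t = t'" by linarith
  qed (use d1 d2 in auto)
qed

text \<open>A sector around the normal direction, on the side given by \<sigma>, in coordinates
  scaled by the tangent \<open>d\<close>. It is convex because the norm is.\<close>

lemma open_cone_connected:
  fixes y d :: complex and \<sigma> :: real
  assumes "\<epsilon> > 0"
  shows "connected ((\<lambda>q. y + d * q) ` {q. norm q < r \<and> \<sigma> * Im q > \<epsilon> * norm q})"
proof (intro connected_continuous_image convex_connected)
  show "convex {q :: complex. norm q < r \<and> \<sigma> * Im q > \<epsilon> * norm q}"
  proof (rule convexI)
    fix x y :: complex and u v :: real
    assume h: "x \<in> {q. norm q < r \<and> \<sigma> * Im q > \<epsilon> * norm q}" "y \<in> {q. norm q < r \<and> \<sigma> * Im q > \<epsilon> * norm q}"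
      "0 \<le> u" "0 \<le> v" "u + v = 1"
    have n: "norm (u *\<^sub>R x + v *\<^sub>R y) \<le> u * norm x + v * norm y"
      using h(3,4) by (metis abs_of_nonneg norm_scaleR norm_triangle_ineq)
    have "u * norm x + v * norm y < r"
      using h convex_bound_lt[of "norm x" r "norm y" u v] by auto
    moreover have "\<epsilon> * (u * norm x + v * norm y) < \<sigma> * Im (u *\<^sub>R x + v *\<^sub>R y)"
    proof -
      have "u * (\<sigma> * Im x - \<epsilon> * norm x) + v * (\<sigma> * Im y - \<epsilon> * norm y) > 0"
      proof (cases "u = 0")
        case True then show ?thesis using h by simp
      next
        case False then show ?thesis using h by (intro add_pos_nonneg mult_pos_pos mult_nonneg_nonneg) auto
      qed
      then show ?thesis by (simp add: algebra_simps)
    qed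
    moreover have "\<epsilon> * norm (u *\<^sub>R x + v *\<^sub>R y) \<le> \<epsilon> * (u * norm x + v * norm y)"
      using n assms by (simp add: mult_left_mono)
    ultimately show "u *\<^sub>R x + v *\<^sub>R y \<in> {q. norm q < r \<and> \<sigma> * Im q > \<epsilon> * norm q}"
      using n by auto
  qed
qed (intro continuous_intros)

lemma eventually_at_right_reflect:
  fixes f :: "real \<Rightarrow> 'a" and s \<sigma> :: real
  assumes "\<forall>\<^sub>F u in at s. Q u" "\<sigma> = 1 \<or> \<sigma> = -1"
  shows "\<forall>\<^sub>F h in at_right 0. Q (s + \<sigma> * h)"
proof -
  obtain \<delta> where "\<delta> > 0" "\<And>u. u \<noteq> s \<Longrightarrow> dist u s < \<delta> \<Longrightarrow> Q u"
    using assms(1) by (auto simp: eventually_at)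
  then show ?thesis
    using assms(2) by (intro eventually_at_rightI[of 0 \<delta>]) (auto simp: dist_real_def)
qed

section \<open>The projection near a point of the diagram\<close>

locale link_diagram =
  fixes P :: "complex set" and L :: link
  assumes link: "is_link P L" and generic: "generic_projection L"
begin

lemma proj_deriv:
  assumes "i < length L" shows "(proj L i has_vector_derivative tangent L (i, t)) (at t)"
    and "continuous_on UNIV (\<lambda>t. tangent L (i, t))"
proof -
  have "(L ! i) C1_differentiable_on UNIV" using link assms unfolding is_link_def by auto
  then obtain D where D: "\<And>t. ((L ! i) has_vector_derivative D t) (at t)" "continuous_on UNIV D"
    unfolding C1_differentiable_on_def by blast
  have 1: "(proj L i has_vector_derivative fst (D t)) (at t)" for t
    using bounded_linear.has_vector_derivative[OF bounded_linear_fst D(1)] by (simp add: proj_def[abs_def])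
  have 2: "tangent L (i, t) = fst (D t)" for t
    using vector_derivative_at[OF 1] by (simp add: tangent.simps)
  show "(proj L i has_vector_derivative tangent L (i, t)) (at t)" using 1 2 by simp
  show "continuous_on UNIV (\<lambda>t. tangent L (i, t))"
    using D(2) by (simp add: 2 continuous_on_fst del: tangent.simps)
qed

lemma tangent_nonzero: "i < length L \<Longrightarrow> tangent L (i, t) \<noteq> 0"
  using generic unfolding generic_projection_def by auto

lemma isCont_tangent: "i < length L \<Longrightarrow> isCont (\<lambda>t. tangent L (i, t)) t"
  using proj_deriv(2) continuous_on_eq_continuous_at by blast

lemma isCont_proj: "i < length L \<Longrightarrow> isCont (proj L i) t"
  using proj_deriv(1) has_vector_derivative_continuous by blast

lemma continuous_proj: "i < length L \<Longrightarrow> continuous_on S (proj L i)"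
  using isCont_proj continuous_at_imp_continuous_on by blast

lemma component_periodic:
  assumes "i < length L" shows "(L ! i) (t + of_int k) = (L ! i) t"
proof -
  have per: "(L ! i) (t + 1) = (L ! i) t" for t using link assms unfolding is_link_def by auto
  show ?thesis
  proof (induction k rule: int_induct[where k = 0])
    case (step1 k) then show ?case using per[of "t + of_int k"] by (simp add: algebra_simps)
  next
    case (step2 k) then show ?case using per[of "t + of_int (k - 1)"] by (simp add: algebra_simps)
  qed simp
qed

lemma proj_periodic: "i < length L \<Longrightarrow> proj L i (t + of_int k) = proj L i t"
  by (simp add: proj_def component_periodic)

lemma tangent_periodic:
  assumes "i < length L" shows "tangent L (i, t + of_int k) = tangent L (i, t)"
proof -
  have "((\<lambda>s. proj L i (s + of_int k)) has_vector_derivative 1 *\<^sub>R tangent L (i, t + of_int k)) (at t)"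
    by (rule vector_diff_chain_at[of "\<lambda>s. s + of_int k" 1 t "proj L i", unfolded o_def])
      (auto intro!: derivative_eq_intros proj_deriv(1)[OF assms])
  then have "(proj L i has_vector_derivative tangent L (i, t + of_int k)) (at t)"
    using proj_periodic[OF assms] by simp
  then show ?thesis using vector_derivative_at by (fastforce simp: tangent.simps)
qed

lemma height_periodic: "i < length L \<Longrightarrow> height L (i, t + of_int k) = height L (i, t)"
  by (simp add: height.simps component_periodic)

definition diagram :: "complex set" where "diagram = (\<Union>i<length L. range (proj L i))"

lemma proj_frac: "i < length L \<Longrightarrow> proj L i (frac t) = proj L i t"
  using proj_periodic[of i "frac t" "\<lfloor>t\<rfloor>"] by (simp add: frac_def)

text \<open>Compactness: the parameters at distance at least \<delta> from those over
  \<open>x\<close> have images bounded away from \<open>x\<close>. Hence near \<open>x\<close> the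
  diagram consists of short pieces of the strands through \<open>x\<close>.\<close>

lemma diagram_near:
  assumes "\<delta> > 0"
  obtains r where "r > 0"
    "\<And>z. z \<in> diagram \<Longrightarrow> dist z x < r \<Longrightarrow> \<exists>(i, s)\<in>strand_points L x. \<exists>t. \<bar>t - s\<bar> < \<delta> \<and> z = proj L i t"
proof -
  define K where "K i = {0..1} - (\<Union>s\<in>{s. proj L i s = x}. ball s \<delta>)" for i
  have 1: "\<exists>r>0. \<forall>t. dist (proj L i t) x < r \<longrightarrow> (\<exists>s\<in>{0..<1}. \<exists>t'. proj L i s = x \<and> \<bar>t' - s\<bar> < \<delta> \<and> proj L i t = proj L i t')"
    if i: "i < length L" for i
  proof -
    have "compact (K i)" unfolding K_def by (intro compact_diff) auto
    then have c: "compact (proj L i ` K i)"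
      by (intro compact_continuous_image continuous_proj i)
    have "x \<notin> proj L i ` K i" using assms unfolding K_def by force
    then obtain r where r: "r > 0" "\<And>y. y \<in> proj L i ` K i \<Longrightarrow> r \<le> dist x y"
      using separate_point_closed[OF compact_imp_closed[OF c]] by blast
    have "\<exists>s\<in>{0..<1}. \<exists>t'. proj L i s = x \<and> \<bar>t' - s\<bar> < \<delta> \<and> proj L i t = proj L i t'"
      if "dist (proj L i t) x < r" for t
    proof -
      have "frac t \<notin> K i" using r(2)[OF imageI, of "frac t"] that i by (auto simp: proj_frac dist_commute)
      moreover have "frac t \<in> {0..1}" using frac_ge_0[of t] frac_lt_1[of t] by auto
      ultimately obtain s where s: "proj L i s = x" "dist s (frac t) < \<delta>" unfolding K_def by auto
      \<comment> \<open>The preimage \<open>s\<close> may lie outside \<open>[0, 1)\<close>. Both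
        parameters are shifted by its floor, after which the one of the nearby point may leave the
        period.\<close>
      show ?thesis
      proof (intro bexI exI conjI)
        show "frac s \<in> {0..<1}" by (simp add: frac_lt_1)
        show "proj L i (frac s) = x" using s proj_frac i by simp
        show "\<bar>(frac t - of_int \<lfloor>s\<rfloor>) - frac s\<bar> < \<delta>" using s(2) by (simp add: frac_def dist_real_def abs_minus_commute algebra_simps)
        show "proj L i t = proj L i (frac t - of_int \<lfloor>s\<rfloor>)"
          using proj_periodic[OF i, of "frac t" "- \<lfloor>s\<rfloor>"] proj_frac[OF i] by simp
      qed
    qed
    then show ?thesis using r(1) by blast
  qed
  then obtain r where r: "\<And>i. i < length L \<Longrightarrow> r i > 0 \<and> (\<forall>t. dist (proj L i t) x < r i \<longrightarrow> (\<exists>s\<in>{0..<1}. \<exists>t'. proj L i s = x \<and> \<bar>t' - s\<bar> < \<delta> \<and> proj L i t = proj L i t'))"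
    by metis
  show ?thesis
  proof (rule that[of "Min (insert 1 (r ` {..<length L}))"])
    show "Min (insert 1 (r ` {..<length L})) > 0" using r by auto
    fix z assume z: "z \<in> diagram" "dist z x < Min (insert 1 (r ` {..<length L}))"
    then obtain i t where it: "i < length L" "z = proj L i t" unfolding diagram_def by auto
    have "dist z x < r i" using z(2) it(1) by auto
    then obtain s t' where "s \<in> {0..<1}" "proj L i s = x" "\<bar>t' - s\<bar> < \<delta>" "proj L i t = proj L i t'"
      using r it by metis
    then show "\<exists>(i, s)\<in>strand_points L x. \<exists>t. \<bar>t - s\<bar> < \<delta> \<and> z = proj L i t"
      using it unfolding strand_points_def by (auto intro!: bexI[of _ "(i, s)"])
  qed
qed

end


section \<open>Winding numbers of the diagram\<close>

text \<open>The principal logarithms of \<open>z\<close> and \<open>- z\<close> differ by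
  \<open>\<i> * pi\<close> up to a sign given by the half-plane of \<open>z\<close>; for
  \<open>z = \<i> * q\<close> this is the sign of \<open>Re q\<close>.\<close>

lemma Ln_ii_jump:
  "Re q > 0 \<Longrightarrow> Ln (\<i> * q) - Ln (- (\<i> * q)) = \<i> * pi"
  "Re q < 0 \<Longrightarrow> Ln (\<i> * q) - Ln (- (\<i> * q)) = - (\<i> * pi)"
  using Ln_minus[of "- (\<i> * q)"] Ln_minus[of "\<i> * q"] by (cases "q = 0"; force)+

text \<open>The point is the zero of \<open>e * ((w - y) / d) + t\<close>, so this logarithm is a
  primitive of the winding integrand. The cases \<open>e = \<i>\<close> and
  \<open>e = - \<i>\<close> give the points \<open>y + t * \<i> * d\<close> and
  \<open>y - t * \<i> * d\<close> on the two sides of a curve with tangent \<open>d\<close> at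
  \<open>y\<close>.\<close>

lemma subpath_winding_Ln:
  fixes g :: "real \<Rightarrow> complex" and e :: complex
  assumes g: "valid_path (subpath u v g)" and d: "d \<noteq> 0" "e \<noteq> 0"
    and slit: "\<And>w. w \<in> path_image (subpath u v g) \<Longrightarrow> e * ((w - y) / d) + t \<notin> \<real>\<^sub>\<le>\<^sub>0"
  shows "winding_number (subpath u v g) (y - t * d / e) =
     (Ln (e * ((g v - y) / d) + t) - Ln (e * ((g u - y) / d) + t)) / (2 * pi * \<i>)"
proof -
  let ?p = "subpath u v g" and ?z = "y - t * d / e"
  let ?f = "\<lambda>w. Ln (e * ((w - y) / d) + t)"
  have id: "e * ((w - y) / d) + t = (e / d) * (w - ?z)" for w
    using d by (simp add: field_simps)
  have off: "?z \<notin> path_image ?p"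
    using slit[of ?z] unfolding id by auto
  have "((\<lambda>w. 1 / (w - ?z)) has_contour_integral (?f (pathfinish ?p) - ?f (pathstart ?p))) ?p"
  proof (rule contour_integral_primitive[where S = "path_image ?p"])
    fix w assume w: "w \<in> path_image ?p"
    have "w \<noteq> ?z" using off w by auto
    then have eq: "(e / d) / (e * ((w - y) / d) + t) = 1 / (w - ?z)"
      unfolding id using d by simp
    have "(?f has_field_derivative (e / d) / (e * ((w - y) / d) + t)) (at w)"
      using slit[OF w] d by (auto intro!: derivative_eq_intros simp: divide_inverse)
    then show "(?f has_field_derivative 1 / (w - ?z)) (at w within path_image ?p)"
      unfolding eq by (rule has_field_derivative_at_within)
  qed (use g in auto)
  then have "contour_integral ?p (\<lambda>w. 1 / (w - ?z)) = ?f (g v) - ?f (g u)"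
    by (simp add: contour_integral_unique)
  then show ?thesis
    using winding_number_valid_path[OF g off] by (simp add: field_simps)
qed

text \<open>Only a short piece around the parameter \<open>1/2\<close> contributes to the jump, and there the winding
  numbers about the two points are given by two branches of the logarithm.\<close>

lemma winding_number_jump_half:
  fixes g g' :: "real \<Rightarrow> complex"
  assumes der: "\<And>t. (g has_vector_derivative g' t) (at t)" and cont: "continuous_on UNIV g'"
    and d: "d = g' (1/2)" "d \<noteq> 0" and y: "y = g (1/2)"
    and simple: "\<And>t. t \<in> {0..1} \<Longrightarrow> g t = y \<Longrightarrow> t = 1/2"
    and off: "\<forall>\<^sub>F t in at_right 0. y + of_real t * (\<i> * d) \<notin> path_image g"
      "\<forall>\<^sub>F t in at_right 0. y - of_real t * (\<i> * d) \<notin> path_image g"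
  shows "((\<lambda>t. winding_number g (y + of_real t * (\<i> * d)) - winding_number g (y - of_real t * (\<i> * d)))
    \<longlongrightarrow> 1) (at_right 0)"
proof -
  have "isCont g' (1/2)" using cont continuous_on_eq_continuous_at by blast
  then obtain \<delta>0 where d0: "\<delta>0 > 0" and
    est: "\<And>s t. \<bar>s - 1/2\<bar> < \<delta>0 \<Longrightarrow> \<bar>t - 1/2\<bar> < \<delta>0 \<Longrightarrow> norm (g s - g t - of_real (s - t) * d) \<le> (norm d / 2) * \<bar>s - t\<bar>"
    using C1_curve_estimate[OF der, of "1/2" "norm d / 2"] d by auto
  define \<delta> where "\<delta> = min (\<delta>0 / 2) (1/4)"
  have \<delta>: "0 < \<delta>" "\<delta> < \<delta>0" "\<delta> < 1/2" using d0 by (auto simp: \<delta>_def)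
  \<comment> \<open>Coordinates in which the curve leaves \<open>y\<close> with velocity 1, so that
    \<open>Re (q s)\<close> has the sign of \<open>s - 1/2\<close>.\<close>
  define q where "q s = (g s - y) / d" for s
  have q: "\<bar>Im (q s)\<bar> \<le> \<bar>s - 1/2\<bar> / 2" "\<bar>Re (q s) - (s - 1/2)\<bar> \<le> \<bar>s - 1/2\<bar> / 2" if "\<bar>s - 1/2\<bar> \<le> \<delta>" for s
  proof -
    have "norm (g s - y - of_real (s - 1/2) * d) \<le> norm d / 2 * \<bar>s - 1/2\<bar>"
      using est[of s "1/2"] that \<delta> d0 y by auto
    also have "g s - y - of_real (s - 1/2) * d = d * (q s - of_real (s - 1/2))"
      using d(2) unfolding q_def right_diff_distrib by simp
    finally have "norm (q s - of_real (s - 1/2)) \<le> \<bar>s - 1/2\<bar> / 2"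
      using d(2) by (simp add: norm_mult)
    then show "\<bar>Im (q s)\<bar> \<le> \<bar>s - 1/2\<bar> / 2" "\<bar>Re (q s) - (s - 1/2)\<bar> \<le> \<bar>s - 1/2\<bar> / 2"
      using abs_Im_le_cmod[of "q s - of_real (s - 1/2)"] abs_Re_le_cmod[of "q s - of_real (s - 1/2)"] by auto
  qed
  define p where "p = subpath (1/2 - \<delta>) (1/2 + \<delta>) g"
  have C1: "g C1_differentiable_on S" for S
    unfolding C1_differentiable_on_def using der cont continuous_on_subset by blast
  then have vg: "valid_path g" by (simp add: C1_differentiable_imp_piecewise valid_path_def)
  then have pathg: "path g" by (rule valid_path_imp_path)
  have vp: "valid_path p" unfolding p_def using vg \<delta> by (intro valid_path_subpath) auto
  \<comment> \<open>The value can be real only if \<open>Re (q s) = 0\<close>, which forces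
    \<open>w = y\<close>, and there it equals \<open>t > 0\<close>.\<close>
  have slit: "\<i> * ((w - y) / d) + of_real t \<notin> \<real>\<^sub>\<le>\<^sub>0" "- \<i> * ((w - y) / d) + of_real t \<notin> \<real>\<^sub>\<le>\<^sub>0"
    if w: "w \<in> path_image p" and t: "t > 0" for w t
  proof -
    obtain s where s': "s \<in> {1/2 - \<delta>..1/2 + \<delta>}" and s2: "w = g s"
      using w \<delta> unfolding p_def path_image_subpath by (auto split: if_splits)
    from s' have "\<bar>s - 1/2\<bar> \<le> \<delta>" by (auto simp: abs_le_iff)
    note s = this s2
    have "Re (q s) \<noteq> 0 \<or> q s = 0"
    proof (cases "s = 1/2")
      case True then show ?thesis using q[OF s(1)] by (auto simp: complex_eq_iff)
    next
      case False then show ?thesis using q(2)[OF s(1)] by (auto simp: abs_if split: if_splits)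
    qed
    then show "\<i> * ((w - y) / d) + of_real t \<notin> \<real>\<^sub>\<le>\<^sub>0" "- \<i> * ((w - y) / d) + of_real t \<notin> \<real>\<^sub>\<le>\<^sub>0"
      using t unfolding s(2) q_def[symmetric] by (auto simp: complex_nonpos_Reals_iff)
  qed
  define a b where "a = q (1/2 - \<delta>)" and "b = q (1/2 + \<delta>)"
  have ab: "Re a < 0" "Re b > 0" using q(2)[of "1/2 - \<delta>"] q(2)[of "1/2 + \<delta>"] \<delta> by (auto simp: a_def b_def abs_if split: if_splits)
  have wp: "winding_number p (y + of_real t * (\<i> * d)) = (Ln (\<i> * b + t) - Ln (\<i> * a + t)) / (2 * pi * \<i>)"
    "winding_number p (y - of_real t * (\<i> * d)) = (Ln (- \<i> * b + t) - Ln (- \<i> * a + t)) / (2 * pi * \<i>)"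
    if t: "t > 0" for t :: real
    using subpath_winding_Ln[of "1/2 - \<delta>" "1/2 + \<delta>" g d "\<i>" y t] subpath_winding_Ln[of "1/2 - \<delta>" "1/2 + \<delta>" g d "- \<i>" y t]
      vp slit[OF _ t] d(2) unfolding p_def a_def b_def q_def by (simp_all add: mult_ac)
  have lim: "((\<lambda>t. Ln (e * x + complex_of_real t)) \<longlongrightarrow> Ln (e * x)) (at_right 0)" if "Re x \<noteq> 0" "e = \<i> \<or> e = - \<i>" for e x
  proof -
    have "((\<lambda>t. e * x + complex_of_real t) \<longlongrightarrow> e * x + of_real 0) (at_right 0)"
      by (intro tendsto_intros)
    then show ?thesis
      using that by (intro tendsto_Ln) (auto simp: complex_nonpos_Reals_iff)
  qed
  \<comment> \<open>As \<open>t\<close> tends to 0 the logarithms pair up into the jumps at the two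
    ends, \<open>\<i> * pi\<close> at \<open>b\<close> and \<open>- (\<i> * pi)\<close> at
    \<open>a\<close>, whose difference is one full turn.\<close>
  have "((\<lambda>t. (Ln (\<i> * b + t) - Ln (\<i> * a + t)) / (2 * pi * \<i>) - (Ln (- \<i> * b + t) - Ln (- \<i> * a + t)) / (2 * pi * \<i>))
     \<longlongrightarrow> (Ln (\<i> * b) - Ln (\<i> * a)) / (2 * pi * \<i>) - (Ln (- \<i> * b) - Ln (- \<i> * a)) / (2 * pi * \<i>)) (at_right 0)"
    using ab by (intro tendsto_intros lim) auto
  moreover have "(Ln (\<i> * b) - Ln (\<i> * a)) / (2 * pi * \<i>) - (Ln (- \<i> * b) - Ln (- \<i> * a)) / (2 * pi * \<i>)
     = ((Ln (\<i> * b) - Ln (- (\<i> * b))) - (Ln (\<i> * a) - Ln (- (\<i> * a)))) / (2 * pi * \<i>)"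
    by (simp add: diff_divide_distrib)
  moreover have "\<dots> = 1" unfolding Ln_ii_jump(1)[OF ab(2)] Ln_ii_jump(2)[OF ab(1)] by simp
  ultimately have mid0: "((\<lambda>t. (Ln (\<i> * b + t) - Ln (\<i> * a + t)) / (2 * pi * \<i>) - (Ln (- \<i> * b + t) - Ln (- \<i> * a + t)) / (2 * pi * \<i>))
     \<longlongrightarrow> 1) (at_right 0)" by (simp only:)
  have mid: "((\<lambda>t. winding_number p (y + of_real t * (\<i> * d)) - winding_number p (y - of_real t * (\<i> * d))) \<longlongrightarrow> 1) (at_right 0)"
    by (rule Lim_transform_eventually[OF mid0]) (use eventually_at_right_less[of "0 :: real"] in eventually_elim, simp only: wp)
  have rest: "((\<lambda>t. winding_number (subpath u v g) (y + of_real t * (\<i> * d)) - winding_number (subpath u v g) (y - of_real t * (\<i> * d))) \<longlongrightarrow> 0) (at_right 0)"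
    if uv: "u \<le> v" "{u..v} \<subseteq> {0..1}" "1/2 \<notin> {u..v}" for u v
  proof -
    have "g t \<noteq> y" if "t \<in> {u..v}" for t
      using simple[of t] uv(2,3) that by blast
    then have "y \<notin> path_image (subpath u v g)"
      unfolding path_image_subpath using uv(1) by (metis imageE)
    then have "isCont (winding_number (subpath u v g)) y"
      using uv pathg by (intro continuous_at_winding_number path_subpath) auto
    moreover have "((\<lambda>t. y + of_real t * (\<i> * d)) \<longlongrightarrow> y + of_real 0 * (\<i> * d)) (at_right 0)"
       "((\<lambda>t. y - of_real t * (\<i> * d)) \<longlongrightarrow> y - of_real 0 * (\<i> * d)) (at_right 0)"
      by (intro tendsto_intros)+
    ultimately have "((\<lambda>t. winding_number (subpath u v g) (y + of_real t * (\<i> * d))) \<longlongrightarrow> winding_number (subpath u v g) y) (at_right 0)"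
      "((\<lambda>t. winding_number (subpath u v g) (y - of_real t * (\<i> * d))) \<longlongrightarrow> winding_number (subpath u v g) y) (at_right 0)"
      by (auto intro: isCont_tendsto_compose)
    from tendsto_diff[OF this] show ?thesis by simp
  qed
  have split: "winding_number g z = winding_number (subpath 0 (1/2 - \<delta>) g) z + winding_number p z + winding_number (subpath (1/2 + \<delta>) 1 g) z"
    if "z \<notin> path_image g" for z
    unfolding p_def using winding_number_subpath_combine[OF pathg that, of 0 "1/2 - \<delta>" "1/2 + \<delta>"]
      winding_number_subpath_combine[OF pathg that, of 0 "1/2 + \<delta>" 1] \<delta> by simp
  have "((\<lambda>t. (winding_number (subpath 0 (1/2 - \<delta>) g) (y + of_real t * (\<i> * d)) - winding_number (subpath 0 (1/2 - \<delta>) g) (y - of_real t * (\<i> * d)))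
    + (winding_number p (y + of_real t * (\<i> * d)) - winding_number p (y - of_real t * (\<i> * d)))
    + (winding_number (subpath (1/2 + \<delta>) 1 g) (y + of_real t * (\<i> * d)) - winding_number (subpath (1/2 + \<delta>) 1 g) (y - of_real t * (\<i> * d))))
    \<longlongrightarrow> 0 + 1 + 0) (at_right 0)"
    using \<delta> by (intro tendsto_add mid rest) auto
  then have "((\<lambda>t. winding_number g (y + of_real t * (\<i> * d)) - winding_number g (y - of_real t * (\<i> * d))) \<longlongrightarrow> 0 + 1 + 0) (at_right 0)"
    by (rule Lim_transform_eventually) (use off in eventually_elim, simp add: split)
  then show ?thesis by simp
qed

section \<open>The winding number of the link on the two sides of a strand\<close>

context link_diagram
begin

text \<open>On the complement of the diagram this is the Alexander numbering of the regions.\<close>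

definition W :: "complex \<Rightarrow> complex" where
  "W z = (\<Sum>i<length L. winding_number (proj L i) z)"

lemma path_proj: "i < length L \<Longrightarrow> path (proj L i)"
  unfolding path_def by (rule continuous_proj)

lemma proj_loop: "i < length L \<Longrightarrow> pathfinish (proj L i) = pathstart (proj L i)"
  using proj_periodic[of i 0 1] by (simp add: pathfinish_def pathstart_def)

lemma path_image_proj: "i < length L \<Longrightarrow> path_image (proj L i) \<subseteq> diagram"
  by (auto simp: diagram_def path_image_def)

lemma W_Ints: "z \<notin> diagram \<Longrightarrow> W z \<in> \<int>"
  unfolding W_def using path_proj proj_loop path_image_proj
  by (intro Ints_sum integer_winding_number) auto

lemma W_constant:
  assumes "connected S" "S \<inter> diagram = {}" "z \<in> S" "z' \<in> S"
  shows "W z = W z'"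
  unfolding W_def
proof (rule sum.cong[OF refl])
  fix i assume "i \<in> {..<length L}"
  then have "winding_number (proj L i) constant_on S"
    using assms path_image_proj by (intro winding_number_constant path_proj proj_loop) auto
  then show "winding_number (proj L i) z = winding_number (proj L i) z'"
    using assms by (auto simp: constant_on_def)
qed

lemma strand_point_frac: "i < length L \<Longrightarrow> (i, frac s) \<in> strand_points L (proj L i s)"
  by (simp add: strand_points_def frac_lt_1 proj_frac)

lemma regular_point:
  assumes "i < length L" "proj L i s \<notin> crossings L"
  shows "strand_points L (proj L i s) = {(i, frac s)}"
  using strand_point_frac[OF assms(1), of s] assms(2) unfolding crossings_def by blast

text \<open>Moves the base point, so that a chosen point of the loop acquires the parameter 1/2 of
  \<open>winding_number_jump_half\<close>.\<close>

lemma shift_winding_number: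
  assumes i: "i < length L" and z: "z \<notin> diagram"
  shows "winding_number (\<lambda>x. proj L i (a + x)) z = winding_number (proj L i) z"
proof -
  have "shiftpath (frac a) (proj L i) = (\<lambda>x. proj L i (a + x))"
  proof
    fix x
    have 1: "proj L i (frac a + x) = proj L i (a + x)"
      using proj_periodic[OF i, of "frac a + x" "\<lfloor>a\<rfloor>"] by (simp add: frac_def algebra_simps)
    moreover have "proj L i (frac a + x - 1) = proj L i (frac a + x)"
      using proj_periodic[OF i, of "frac a + x" "-1"] by simp
    ultimately show "shiftpath (frac a) (proj L i) x = proj L i (a + x)"
      by (simp add: shiftpath_def)
  qed
  moreover have "winding_number (shiftpath (frac a) (proj L i)) z = winding_number (proj L i) z"
    using path_image_proj[OF i] z by (intro winding_number_shiftpath path_proj proj_loop i) (auto simp: frac_lt_1 less_imp_le)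
  ultimately show ?thesis by simp
qed

text \<open>In the injective chart
  \<open>(s', t') \<mapsto> proj L i s' + (\<beta> t' - \<beta> b)\<close> the nearby diagram is
  contained in the coordinate axes. The flag \<open>B\<close> tells whether \<open>\<beta>\<close>
  is itself a strand, at a crossing, where both axes have to be avoided, or an auxiliary normal at a
  regular point.\<close>

lemma quadrant_region:
  fixes \<beta> \<beta>' :: "real \<Rightarrow> complex"
  assumes i: "i < length L" and x: "x = proj L i s"
    and \<beta>: "\<And>t. (\<beta> has_vector_derivative \<beta>' t) (at t)" "isCont \<beta>' b"
    and det: "det2 (tangent L (i, s)) (\<beta>' b) \<noteq> 0"
    and strands: "\<And>k u. (k, u) \<in> strand_points L x \<Longrightarrow>
        k = i \<and> u = frac s \<or> B \<and> \<beta> = proj L k \<and> u = frac b \<and> \<beta> b = x"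
  obtains \<delta> where "\<delta> > 0" "\<And>s' t'. \<bar>s' - s\<bar> < \<delta> \<Longrightarrow> \<bar>t' - b\<bar> < \<delta> \<Longrightarrow> t' \<noteq> b \<Longrightarrow> (B \<Longrightarrow> s' \<noteq> s) \<Longrightarrow>
      proj L i s' + (\<beta> t' - \<beta> b) \<notin> diagram"
proof -
  obtain \<delta>0 where \<delta>0: "\<delta>0 > 0" and inj:
    "\<And>s1 t1 s2 t2. \<bar>s1 - s\<bar> < \<delta>0 \<Longrightarrow> \<bar>t1 - b\<bar> < \<delta>0 \<Longrightarrow> \<bar>s2 - s\<bar> < \<delta>0 \<Longrightarrow> \<bar>t2 - b\<bar> < \<delta>0 \<Longrightarrow>
       proj L i s1 + \<beta> t1 = proj L i s2 + \<beta> t2 \<Longrightarrow> s1 = s2 \<and> t1 = t2"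
    using transversal_sum_inj[OF proj_deriv(1)[OF i] isCont_tangent[OF i] \<beta> det] by blast
  obtain r where r: "r > 0" "\<And>z. z \<in> diagram \<Longrightarrow> dist z x < r \<Longrightarrow> \<exists>(i, s)\<in>strand_points L x. \<exists>t. \<bar>t - s\<bar> < \<delta>0 \<and> z = proj L i t"
    using diagram_near[OF \<delta>0] by blast
  have c1: "isCont (proj L i) s" and c2: "isCont \<beta> b"
    using isCont_proj[OF i] \<beta>(1) has_vector_derivative_continuous by blast+
  obtain \<delta>1 where d1: "\<delta>1 > 0" "\<And>s'. dist s' s < \<delta>1 \<Longrightarrow> dist (proj L i s') x < r / 2"
    using c1 r(1) x unfolding continuous_at_eps_delta by (metis half_gt_zero)
  obtain \<delta>2 where d2: "\<delta>2 > 0" "\<And>t'. dist t' b < \<delta>2 \<Longrightarrow> dist (\<beta> t') (\<beta> b) < r / 2"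
    using c2 r(1) unfolding continuous_at_eps_delta by (metis half_gt_zero)
  show ?thesis
  proof (rule that[of "min \<delta>0 (min \<delta>1 \<delta>2)"])
    fix s' t' assume h: "\<bar>s' - s\<bar> < min \<delta>0 (min \<delta>1 \<delta>2)" "\<bar>t' - b\<bar> < min \<delta>0 (min \<delta>1 \<delta>2)" "t' \<noteq> b" "B \<Longrightarrow> s' \<noteq> s"
    show "proj L i s' + (\<beta> t' - \<beta> b) \<notin> diagram" (is "?z \<notin> _")
    proof
      assume z: "?z \<in> diagram"
      have "dist ?z x \<le> dist (proj L i s') x + dist (\<beta> t') (\<beta> b)"
        using norm_triangle_ineq[of "proj L i s' - x" "\<beta> t' - \<beta> b"] by (simp add: dist_norm algebra_simps)
      also have "\<dots> < r" using d1(2)[of s'] d2(2)[of t'] h by (simp add: dist_real_def)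
      finally obtain k u t where kut: "(k, u) \<in> strand_points L x" "\<bar>t - u\<bar> < \<delta>0" "?z = proj L k t"
        using r(2)[OF z] by blast
      from strands[OF kut(1)] show False
      proof
        assume ku: "k = i \<and> u = frac s"
        have "\<bar>(t + of_int \<lfloor>s\<rfloor>) - s\<bar> < \<delta>0" using kut(2) ku by (simp add: frac_def algebra_simps)
        moreover have "proj L i s' + \<beta> t' = proj L i (t + of_int \<lfloor>s\<rfloor>) + \<beta> b"
          using kut(3) ku proj_periodic[OF i] by (simp add: algebra_simps)
        ultimately have "t' = b" using inj[of s' t' "t + of_int \<lfloor>s\<rfloor>" b] h \<delta>0 by auto
        then show False using h by simp
      next
        assume ku: "B \<and> \<beta> = proj L k \<and> u = frac b \<and> \<beta> b = x"
        have k: "k < length L" using kut(1) by (auto simp: strand_points_def)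
        have "\<bar>(t + of_int \<lfloor>b\<rfloor>) - b\<bar> < \<delta>0" using kut(2) ku by (simp add: frac_def algebra_simps)
        moreover have "proj L i s' + \<beta> t' = proj L i s + \<beta> (t + of_int \<lfloor>b\<rfloor>)"
        proof -
          have "\<beta> (t + of_int \<lfloor>b\<rfloor>) = proj L k t" using ku proj_periodic[OF k] by simp
          moreover have "\<beta> b = proj L i s" using ku x by metis
          ultimately show ?thesis using kut(3) by (simp add: algebra_simps)
        qed
        moreover have "\<bar>s - s\<bar> < \<delta>0" using \<delta>0 by simp
        ultimately have "s' = s" using inj[of s' t' s "t + of_int \<lfloor>b\<rfloor>"] h \<delta>0 by auto
        then show False using h(4) ku by simp
      qed
    qed
  qed (use \<delta>0 d1 d2 in auto)
qed

text \<open>Only one short piece of strand is near a regular point, and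
  \<open>C1_curve_estimate\<close> confines it to a narrow double cone about the tangent.\<close>

lemma diagram_cone:
  assumes i: "i < length L" and reg: "proj L i s \<notin> crossings L" and \<epsilon>: "\<epsilon> > 0"
  obtains r where "r > 0" "\<And>q. norm q < r \<Longrightarrow> proj L i s + tangent L (i, s) * q \<in> diagram \<Longrightarrow> \<bar>Im q\<bar> \<le> \<epsilon> * norm q"
proof -
  let ?d = "tangent L (i, s)" and ?y = "proj L i s"
  have d: "norm ?d > 0" using tangent_nonzero i by simp
  \<comment> \<open>Solves \<open>\<epsilon> * (1 - \<eta>) = \<eta>\<close>. With \<open>h\<close>
    the difference of parameters, the piece satisfies
    \<open>\<bar>Im q\<bar> \<le> \<eta> * \<bar>h\<bar>\<close> and
    \<open>(1 - \<eta>) * \<bar>h\<bar> \<le> norm q\<close>.\<close>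
  define \<eta> where "\<eta> = \<epsilon> / (1 + \<epsilon>)"
  have \<eta>: "0 < \<eta>" "\<eta> < 1" "\<eta> * norm ?d > 0" using \<epsilon> d by (auto simp: \<eta>_def)
  obtain \<delta> where \<delta>: "\<delta> > 0" "\<And>a b. \<bar>a - s\<bar> < \<delta> \<Longrightarrow> \<bar>b - s\<bar> < \<delta> \<Longrightarrow>
      norm (proj L i a - proj L i b - of_real (a - b) * ?d) \<le> (\<eta> * norm ?d) * \<bar>a - b\<bar>"
    using C1_curve_estimate[OF proj_deriv(1)[OF i] isCont_tangent[OF i] \<eta>(3)] by blast
  obtain r where r: "r > 0" "\<And>z. z \<in> diagram \<Longrightarrow> dist z ?y < r \<Longrightarrow> \<exists>(i, s)\<in>strand_points L ?y. \<exists>t. \<bar>t - s\<bar> < \<delta> \<and> z = proj L i t"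
    using diagram_near[OF \<delta>(1)] by blast
  show ?thesis
  proof (rule that[of "r / norm ?d"])
    fix q assume q: "norm q < r / norm ?d" "?y + ?d * q \<in> diagram"
    have "dist (?y + ?d * q) ?y < r" using q(1) d by (simp add: dist_norm norm_mult field_simps)
    then obtain t where t: "\<bar>t - frac s\<bar> < \<delta>" "?y + ?d * q = proj L i t"
      using r(2)[OF q(2)] unfolding regular_point[OF i reg] by auto
    let ?h = "t + of_int \<lfloor>s\<rfloor> - s"
    have "\<bar>?h\<bar> < \<delta>" using t(1) by (simp add: frac_def algebra_simps)
    then have "norm (?d * q - of_real ?h * ?d) \<le> (\<eta> * norm ?d) * \<bar>?h\<bar>"
      using \<delta>(2)[of "t + of_int \<lfloor>s\<rfloor>" s, unfolded proj_periodic[OF i] t(2)[symmetric]] \<delta>(1) by simp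
    also have "?d * q - of_real ?h * ?d = ?d * (q - of_real ?h)" by (simp add: algebra_simps)
    finally have n: "norm (q - of_real ?h) \<le> \<eta> * \<bar>?h\<bar>" using d by (simp add: norm_mult)
    have 1: "\<bar>Im q\<bar> \<le> \<eta> * \<bar>?h\<bar>" using abs_Im_le_cmod[of "q - of_real ?h"] n by simp
    have "\<bar>?h\<bar> \<le> norm q + \<eta> * \<bar>?h\<bar>"
      using n norm_triangle_ineq2[of "of_real ?h" q] by (simp only: norm_minus_commute[of _ q] norm_of_real)
    then have "(1 - \<eta>) * \<bar>?h\<bar> \<le> norm q" by (simp add: algebra_simps)
    then have "\<epsilon> * ((1 - \<eta>) * \<bar>?h\<bar>) \<le> \<epsilon> * norm q" using \<epsilon> by (simp add: mult_left_mono)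
    moreover have "\<epsilon> * (1 - \<eta>) = \<eta>" using \<epsilon> by (simp add: \<eta>_def field_simps)
    ultimately show "\<bar>Im q\<bar> \<le> \<epsilon> * norm q" using 1 by (simp add: mult.assoc[symmetric])
  qed (use r d in simp)
qed


text \<open>Both curves eventually enter the same open half-cone around the normal, which is
  connected and, by \<open>diagram_cone\<close>, misses the diagram.\<close>

lemma side_germ_unique:
  assumes i: "i < length L" and reg: "proj L i s \<notin> crossings L" and \<sigma>: "\<sigma> = 1 \<or> \<sigma> = (-1::real)"
    and \<beta>: "\<beta> 0 = proj L i s" "(\<beta> has_vector_derivative e) (at 0)" "\<sigma> * det2 (tangent L (i, s)) e > 0"
    and \<beta>2: "\<beta>2 0 = proj L i s" "(\<beta>2 has_vector_derivative e2) (at 0)" "\<sigma> * det2 (tangent L (i, s)) e2 > 0"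
  shows "\<forall>\<^sub>F t in at_right 0. \<beta> t \<notin> diagram \<and> W (\<beta> t) = W (\<beta>2 t)"
proof -
  let ?d = "tangent L (i, s)" and ?y = "proj L i s"
  have d: "?d \<noteq> 0" using tangent_nonzero i by simp
  have Im: "\<sigma> * Im (e / ?d) > 0" if "\<sigma> * det2 ?d e > 0" for e
  proof -
    have "e / ?d = (cnj ?d * e) / of_real ((norm ?d)\<^sup>2)"
      using d by (simp add: complex_norm_square field_simps del: of_real_power)
    then have "Im (e / ?d) = det2 ?d e / (norm ?d)\<^sup>2" by (simp add: det2_def)
    then show ?thesis using that d by (simp add: zero_less_mult_iff zero_less_divide_iff)
  qed
  \<comment> \<open>Half the smaller of the two slopes against the strand, so that both directions
    lie strictly inside the cone.\<close>
  define \<epsilon> where "\<epsilon> = min (\<sigma> * Im (e / ?d) / (2 * norm (e / ?d))) (\<sigma> * Im (e2 / ?d) / (2 * norm (e2 / ?d)))"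
  have ne: "e / ?d \<noteq> 0" "e2 / ?d \<noteq> 0" using Im[OF \<beta>(3)] Im[OF \<beta>2(3)] by auto
  have \<epsilon>: "\<epsilon> > 0" using Im[OF \<beta>(3)] Im[OF \<beta>2(3)] ne by (auto simp: \<epsilon>_def)
  have \<epsilon>1: "\<epsilon> * norm (e / ?d) < \<sigma> * Im (e / ?d)"
  proof -
    have "\<epsilon> * norm (e / ?d) \<le> (\<sigma> * Im (e / ?d) / (2 * norm (e / ?d))) * norm (e / ?d)"
      unfolding \<epsilon>_def by (intro mult_right_mono) auto
    also have "\<dots> < \<sigma> * Im (e / ?d)" using Im[OF \<beta>(3)] ne by simp
    finally show ?thesis .
  qed
  have \<epsilon>2: "\<epsilon> * norm (e2 / ?d) < \<sigma> * Im (e2 / ?d)"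
  proof -
    have "\<epsilon> * norm (e2 / ?d) \<le> (\<sigma> * Im (e2 / ?d) / (2 * norm (e2 / ?d))) * norm (e2 / ?d)"
      unfolding \<epsilon>_def by (intro mult_right_mono) auto
    also have "\<dots> < \<sigma> * Im (e2 / ?d)" using Im[OF \<beta>2(3)] ne by simp
    finally show ?thesis .
  qed
  obtain r where r: "r > 0" "\<And>q. norm q < r \<Longrightarrow> ?y + ?d * q \<in> diagram \<Longrightarrow> \<bar>Im q\<bar> \<le> \<epsilon> * norm q"
    using diagram_cone[OF i reg \<epsilon>] by blast
  define K where "K = (\<lambda>q. ?y + ?d * q) ` {q. norm q < r \<and> \<sigma> * Im q > \<epsilon> * norm q}"
  have K: "connected K" unfolding K_def by (rule open_cone_connected[OF \<epsilon>])
  have Kd: "K \<inter> diagram = {}"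
  proof -
    have False if q: "norm q < r" "\<sigma> * Im q > \<epsilon> * norm q" "?y + ?d * q \<in> diagram" for q
      using r(2)[OF q(1,3)] q(2) \<sigma> by auto
    then show ?thesis unfolding K_def by blast
  qed
  \<comment> \<open>\<open>q t / t\<close> tends to \<open>f / ?d\<close>, and apart from the bound
    on the radius membership in the cone is open and invariant under scaling.\<close>
  have ev: "\<forall>\<^sub>F t in at_right 0. \<gamma> t \<in> K"
    if g: "\<gamma> 0 = ?y" "(\<gamma> has_vector_derivative f) (at 0)" "\<epsilon> * norm (f / ?d) < \<sigma> * Im (f / ?d)" for \<gamma> f
  proof -
    define q where "q t = (\<gamma> t - ?y) / ?d" for t
    have "((\<lambda>t. (\<gamma> t - \<gamma> 0 - (t - 0) *\<^sub>R f) /\<^sub>R norm (t - 0)) \<longlongrightarrow> 0) (at_right 0)"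
      using has_vector_derivative_at_within[OF g(2), of "{0<..}"]
      unfolding has_vector_derivative_def has_derivative_at_within by simp
    then have "((\<lambda>t. (\<gamma> t - \<gamma> 0 - (t - 0) *\<^sub>R f) /\<^sub>R norm (t - 0) / ?d + f / ?d) \<longlongrightarrow> 0 / ?d + f / ?d) (at_right 0)"
      using d by (intro tendsto_add tendsto_divide tendsto_const)
    then have "((\<lambda>t. q t /\<^sub>R t) \<longlongrightarrow> 0 / ?d + f / ?d) (at_right 0)"
    proof (rule Lim_transform_eventually)
      show "\<forall>\<^sub>F t in at_right 0. (\<gamma> t - \<gamma> 0 - (t - 0) *\<^sub>R f) /\<^sub>R norm (t - 0) / ?d + f / ?d = q t /\<^sub>R t"
        using eventually_at_right_less[of "0::real"]
        by eventually_elim (use d in \<open>simp add: q_def g(1) scaleR_conv_of_real field_simps\<close>)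
    qed
    then have lim: "((\<lambda>t. q t /\<^sub>R t) \<longlongrightarrow> f / ?d) (at_right 0)" by simp
    have "((\<lambda>t. \<sigma> * Im (q t /\<^sub>R t) - \<epsilon> * norm (q t /\<^sub>R t)) \<longlongrightarrow> \<sigma> * Im (f / ?d) - \<epsilon> * norm (f / ?d)) (at_right 0)"
      by (intro tendsto_intros lim)
    then have 1: "\<forall>\<^sub>F t in at_right 0. \<sigma> * Im (q t /\<^sub>R t) - \<epsilon> * norm (q t /\<^sub>R t) > 0"
      using g(3) by (intro order_tendstoD(1)[where a = 0]) auto
    have "isCont \<gamma> 0" using g(2) has_vector_derivative_continuous by blast
    then have "((\<lambda>t. norm (q t)) \<longlongrightarrow> norm ((\<gamma> 0 - ?y) / ?d)) (at_right 0)"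
      unfolding q_def isCont_def using d by (intro tendsto_intros) (auto simp: filterlim_at_split)
    then have 2: "\<forall>\<^sub>F t in at_right 0. norm (q t) < r"
      using r(1) g(1) by (intro order_tendstoD(2)) auto
    show ?thesis
      using 1 2 eventually_at_right_less[of 0]
    proof eventually_elim
      case (elim t)
      have "\<sigma> * Im (q t) > \<epsilon> * norm (q t)" using elim(1,3) by (simp add: field_simps)
      moreover have "\<gamma> t = ?y + ?d * q t" using d by (simp add: q_def)
      ultimately show ?case unfolding K_def using elim(2) by blast
    qed
  qed
  show ?thesis
    using ev[OF \<beta>(1,2) \<epsilon>1] ev[OF \<beta>2(1,2) \<epsilon>2]
  proof eventually_elim
    case (elim t)
    then show ?case using W_constant[OF K Kd elim] Kd by blast
  qed
qed

text \<open>The value of \<open>W\<close> immediately to the left of a strand; meaningful only off the crossings.\<close>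

definition lval :: "nat \<Rightarrow> real \<Rightarrow> complex" where
  "lval i s = (THE w. \<forall>\<^sub>F t in at_right 0. W (proj L i s + of_real t * (\<i> * tangent L (i, s))) = w)"

lemma normal_line:
  assumes "i < length L"
  shows "((\<lambda>t. proj L i s' + of_real t * (\<i> * tangent L (i, s))) has_vector_derivative \<i> * tangent L (i, s)) (at t)"
    and "det2 (tangent L (i, s)) (\<i> * tangent L (i, s)) > 0"
proof -
  show "((\<lambda>t. proj L i s' + of_real t * (\<i> * tangent L (i, s))) has_vector_derivative \<i> * tangent L (i, s)) (at t)"
    by (auto intro!: derivative_eq_intros)
  have "tangent L (i, s) \<noteq> 0" using tangent_nonzero assms by simp
  then show "det2 (tangent L (i, s)) (\<i> * tangent L (i, s)) > 0"
    by (auto simp: det2_def complex_eq_iff sum_power2_gt_zero_iff simp flip: power2_eq_square)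
qed

lemma normal_region:
  assumes i: "i < length L" and reg: "proj L i s \<notin> crossings L"
  obtains \<delta> where "\<delta> > 0" "\<And>s' t'. \<bar>s' - s\<bar> < \<delta> \<Longrightarrow> \<bar>t'\<bar> < \<delta> \<Longrightarrow> t' \<noteq> 0 \<Longrightarrow>
      proj L i s' + of_real t' * (\<i> * tangent L (i, s)) \<notin> diagram"
proof -
  let ?\<beta> = "\<lambda>t. of_real t * (\<i> * tangent L (i, s))"
  have 1: "(?\<beta> has_vector_derivative \<i> * tangent L (i, s)) (at t)" for t
    by (auto intro!: derivative_eq_intros)
  have 2: "det2 (tangent L (i, s)) (\<i> * tangent L (i, s)) \<noteq> 0"
    using normal_line(2)[OF i] by (metis less_irrefl)
  obtain \<delta> where \<delta>: "\<delta> > 0" "\<And>s' t'. \<bar>s' - s\<bar> < \<delta> \<Longrightarrow> \<bar>t' - 0\<bar> < \<delta> \<Longrightarrow> t' \<noteq> 0 \<Longrightarrow>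
      (False \<Longrightarrow> s' \<noteq> s) \<Longrightarrow> proj L i s' + (?\<beta> t' - ?\<beta> 0) \<notin> diagram"
    by (rule quadrant_region[OF i refl 1 _ 2, where b = 0 and B = False]) (simp_all add: regular_point[OF i reg])
  show ?thesis by (rule that[OF \<delta>(1)]) (use \<delta>(2) in simp)
qed

text \<open>Discharges the description in \<open>lval\<close>: a short piece of the normal avoids
  the diagram, hence \<open>W\<close> is constant on it.\<close>

lemma lval_germ:
  assumes i: "i < length L" and reg: "proj L i s \<notin> crossings L"
  shows "\<forall>\<^sub>F t in at_right 0. W (proj L i s + of_real t * (\<i> * tangent L (i, s))) = lval i s"
proof -
  let ?\<beta> = "\<lambda>t. proj L i s + complex_of_real t * (\<i> * tangent L (i, s))"
  obtain \<delta> where \<delta>: "\<delta> > 0" "\<And>s' t'. \<bar>s' - s\<bar> < \<delta> \<Longrightarrow> \<bar>t'\<bar> < \<delta> \<Longrightarrow> t' \<noteq> 0 \<Longrightarrow>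
      proj L i s' + of_real t' * (\<i> * tangent L (i, s)) \<notin> diagram"
    using normal_region[OF i reg] by blast
  have "connected (?\<beta> ` {0<..<\<delta>})"
    by (intro connected_continuous_image continuous_intros) auto
  then have "W (?\<beta> t) = W (?\<beta> (\<delta> / 2))" if "t \<in> {0<..<\<delta>}" for t
    by (rule W_constant[OF _ _ imageI imageI]) (use that \<delta> in auto)
  then have ev: "\<forall>\<^sub>F t in at_right 0. W (?\<beta> t) = W (?\<beta> (\<delta> / 2))"
    by (intro eventually_at_rightI[OF _ \<delta>(1)])
  have uniq: "w = W (?\<beta> (\<delta> / 2))" if "\<forall>\<^sub>F t in at_right 0. W (?\<beta> t) = w" for w
    using eventually_happens'[OF trivial_limit_at_right_real eventually_conj[OF that ev]] by auto
  have "lval i s = W (?\<beta> (\<delta> / 2))"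
    unfolding lval_def by (rule the_equality, rule ev, erule uniq)
  then show ?thesis using ev by simp
qed

lemma left_germ:
  assumes i: "i < length L" and reg: "proj L i s \<notin> crossings L"
    and \<beta>: "\<beta> 0 = proj L i s" "(\<beta> has_vector_derivative e) (at 0)" "det2 (tangent L (i, s)) e > 0"
  shows "\<forall>\<^sub>F t in at_right 0. W (\<beta> t) = lval i s"
proof -
  have "\<forall>\<^sub>F t in at_right 0. \<beta> t \<notin> diagram \<and> W (\<beta> t) = W (proj L i s + complex_of_real t * (\<i> * tangent L (i, s)))"
    by (rule side_germ_unique[OF i reg, of 1 _ e _ "\<i> * tangent L (i, s)"])
      (use \<beta> normal_line[OF i] in simp_all)
  with lval_germ[OF i reg] show ?thesis by eventually_elim simp
qed

lemma lval_Ints: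
  assumes i: "i < length L" and reg: "proj L i s \<notin> crossings L"
  shows "lval i s \<in> \<int>"
proof -
  let ?\<beta> = "\<lambda>t. proj L i s + complex_of_real t * (\<i> * tangent L (i, s))"
  have "\<forall>\<^sub>F t in at_right 0. ?\<beta> t \<notin> diagram \<and> W (?\<beta> t) = W (?\<beta> t)"
    by (rule side_germ_unique[OF i reg, of 1 _ "\<i> * tangent L (i, s)" _ "\<i> * tangent L (i, s)"])
      (use normal_line[OF i] in simp_all)
  then have "\<forall>\<^sub>F t in at_right 0. W (?\<beta> t) \<in> \<int> \<and> W (?\<beta> t) = lval i s"
    using lval_germ[OF i reg]
  proof eventually_elim
    case (elim t)
    then show ?case using W_Ints[of "?\<beta> t"] by simp
  qed
  then obtain t where "W (?\<beta> t) \<in> \<int> \<and> W (?\<beta> t) = lval i s"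
    using eventually_happens'[OF trivial_limit_at_right_real] by blast
  then show ?thesis by (metis (no_types))
qed

text \<open>The other components stay away from the point and contribute a continuous function; the
  component itself contributes the jump 1 in the limit. Off the diagram \<open>W\<close> is
  integral, so the limit of the differences is eventually attained.\<close>

lemma W_jump:
  assumes i: "i < length L" and reg: "proj L i s \<notin> crossings L"
  shows "\<forall>\<^sub>F t in at_right 0. W (proj L i s - of_real t * (\<i> * tangent L (i, s))) = lval i s - 1"
proof -
  let ?d = "tangent L (i, s)" and ?y = "proj L i s"
  let ?zp = "\<lambda>t. ?y + complex_of_real t * (\<i> * ?d)" and ?zm = "\<lambda>t. ?y - complex_of_real t * (\<i> * ?d)"
  obtain \<delta> where \<delta>: "\<delta> > 0" "\<And>s' t'. \<bar>s' - s\<bar> < \<delta> \<Longrightarrow> \<bar>t'\<bar> < \<delta> \<Longrightarrow> t' \<noteq> 0 \<Longrightarrow>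
      proj L i s' + of_real t' * (\<i> * tangent L (i, s)) \<notin> diagram"
    using normal_region[OF i reg] by blast
  have off: "\<forall>\<^sub>F t in at_right 0. ?zp t \<notin> diagram \<and> ?zm t \<notin> diagram"
  proof (rule eventually_at_rightI[OF _ \<delta>(1)])
    fix t assume "t \<in> {0<..<\<delta>}"
    then show "?zp t \<notin> diagram \<and> ?zm t \<notin> diagram"
      using \<delta>(2)[of s t] \<delta>(2)[of s "- t"] \<delta>(1) by simp
  qed
  have other: "((\<lambda>t. winding_number (proj L j) (?zp t) - winding_number (proj L j) (?zm t)) \<longlongrightarrow> 0) (at_right 0)"
    if j: "j < length L" "j \<noteq> i" for j
  proof -
    have "?y \<notin> path_image (proj L j)"
    proof
      assume "?y \<in> path_image (proj L j)"
      then obtain t where "proj L j t = ?y" by (auto simp: path_image_def)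
      then show False using strand_point_frac[OF j(1), of t] regular_point[OF i reg] j by auto
    qed
    then have c: "isCont (winding_number (proj L j)) ?y"
      by (intro continuous_at_winding_number path_proj j)
    have "(?zp \<longlongrightarrow> ?y + of_real 0 * (\<i> * ?d)) (at_right 0)" "(?zm \<longlongrightarrow> ?y - of_real 0 * (\<i> * ?d)) (at_right 0)"
      by (intro tendsto_intros)+
    then have "((\<lambda>t. winding_number (proj L j) (?zp t)) \<longlongrightarrow> winding_number (proj L j) ?y) (at_right 0)"
      "((\<lambda>t. winding_number (proj L j) (?zm t)) \<longlongrightarrow> winding_number (proj L j) ?y) (at_right 0)"
      by (auto intro: isCont_tendsto_compose[OF c])
    from tendsto_diff[OF this] show ?thesis by simp
  qed
  \<comment> \<open>Places \<open>s\<close> at the parameter 1/2 of the shifted loop. Parameters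
    over a regular point differ by integers, so within this period the point is met only
    there.\<close>
  define a where "a = s - 1/2"
  let ?g = "\<lambda>x. proj L i (a + x)"
  have pg: "path_image ?g \<subseteq> diagram" using i by (auto simp: path_image_def diagram_def)
  have "((\<lambda>t. winding_number ?g (?zp t) - winding_number ?g (?zm t)) \<longlongrightarrow> 1) (at_right 0)"
  proof (rule winding_number_jump_half[where g' = "\<lambda>x. tangent L (i, a + x)"])
    fix t
    have "((\<lambda>x. proj L i (a + x)) has_vector_derivative 1 *\<^sub>R tangent L (i, a + t)) (at t)"
      by (rule vector_diff_chain_at[of "\<lambda>x. a + x" 1 t "proj L i", unfolded o_def])
        (auto intro!: derivative_eq_intros proj_deriv(1)[OF i])
    then show "((\<lambda>x. proj L i (a + x)) has_vector_derivative tangent L (i, a + t)) (at t)" by simp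
  next
    show "continuous_on UNIV (\<lambda>x. tangent L (i, a + x))"
      by (rule continuous_on_compose2[OF proj_deriv(2)[OF i]]) (auto intro!: continuous_intros)
  next
    fix t :: real assume t: "t \<in> {0..1}" "proj L i (a + t) = ?y"
    then have "frac (a + t) = frac s" using strand_point_frac[OF i, of "a + t"] regular_point[OF i reg] by auto
    then have "a + t - s = of_int (\<lfloor>a + t\<rfloor> - \<lfloor>s\<rfloor>)" by (simp add: frac_def)
    then obtain n :: int where n: "t - 1/2 = of_int n" unfolding a_def by (metis add_diff_cancel_left' add_diff_eq diff_add_eq)
    then have "\<bar>real_of_int n\<bar> < 1" using t(1) by auto
    then have "n = 0" by linarith
    then show "t = 1/2" using n by simp
  next
    show "\<forall>\<^sub>F t in at_right 0. ?zp t \<notin> path_image ?g" "\<forall>\<^sub>F t in at_right 0. ?zm t \<notin> path_image ?g"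
      using off pg by (auto elim: eventually_mono)
  qed (use i tangent_nonzero in \<open>auto simp: a_def\<close>)
  then have self: "((\<lambda>t. winding_number (proj L i) (?zp t) - winding_number (proj L i) (?zm t)) \<longlongrightarrow> 1) (at_right 0)"
    by (rule Lim_transform_eventually) (use off in eventually_elim, simp add: shift_winding_number[OF i])
  have "((\<lambda>t. (\<Sum>j<length L. winding_number (proj L j) (?zp t) - winding_number (proj L j) (?zm t)))
      \<longlongrightarrow> (\<Sum>j<length L. if j = i then 1 else 0)) (at_right 0)"
    using other self by (intro tendsto_sum) auto
  then have lim: "((\<lambda>t. W (?zp t) - W (?zm t)) \<longlongrightarrow> 1) (at_right 0)"
    using i by (simp add: W_def sum_subtractf)
  have "\<forall>\<^sub>F t in at_right 0. dist (W (?zp t) - W (?zm t)) 1 < 1"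
    using lim by (rule tendstoD) simp
  then show ?thesis
    using lval_germ[OF i reg] off
  proof eventually_elim
    case (elim t)
    have "W (?zp t) - W (?zm t) - 1 \<in> \<int>" using elim(3) W_Ints by auto
    then obtain n where n: "W (?zp t) - W (?zm t) - 1 = of_int n" by (rule Ints_cases)
    then have "norm (of_int n :: complex) < 1" using elim(1) by (simp add: dist_norm)
    then have "n = 0" by simp
    then show ?case using n elim(2) by (simp add: algebra_simps)
  qed
qed

lemma right_germ:
  assumes i: "i < length L" and reg: "proj L i s \<notin> crossings L"
    and \<beta>: "\<beta> 0 = proj L i s" "(\<beta> has_vector_derivative e) (at 0)" "det2 (tangent L (i, s)) e < 0"
  shows "\<forall>\<^sub>F t in at_right 0. W (\<beta> t) = lval i s - 1"
proof -
  have "((\<lambda>t. proj L i s - complex_of_real t * (\<i> * tangent L (i, s))) has_vector_derivative - (\<i> * tangent L (i, s))) (at 0)"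
    by (auto intro!: derivative_eq_intros)
  moreover have "-1 * det2 (tangent L (i, s)) (- (\<i> * tangent L (i, s))) > 0"
    using normal_line(2)[OF i, of s] by (simp add: det2_def)
  ultimately have "\<forall>\<^sub>F t in at_right 0. \<beta> t \<notin> diagram \<and> W (\<beta> t) = W (proj L i s - complex_of_real t * (\<i> * tangent L (i, s)))"
    using \<beta> by (intro side_germ_unique[OF i reg, of "-1" _ e _ "- (\<i> * tangent L (i, s))"]) simp_all
  with W_jump[OF i reg] show ?thesis by eventually_elim auto
qed


section \<open>Winding numbers along arcs and around crossings\<close>

lemma finite_crossings: "finite (crossings L)"
  using generic unfolding generic_projection_def by blast

lemma finite_strand_points: "x \<in> crossings L \<Longrightarrow> finite (strand_points L x)"
  using generic unfolding generic_projection_def by (metis card.infinite zero_neq_numeral)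

lemma finite_crossing_params:
  assumes i: "i < length L" shows "finite (crossing_params L i \<inter> {a..b})"
proof -
  let ?T = "\<Union>x\<in>crossings L. snd ` strand_points L x"
  have fin: "finite ?T" using finite_crossings finite_strand_points by blast
  have "crossing_params L i \<inter> {a..b} \<subseteq> (\<lambda>(t, k). t + of_int k) ` (?T \<times> {\<lfloor>a\<rfloor>..\<lfloor>b\<rfloor>})"
  proof
    fix t assume t: "t \<in> crossing_params L i \<inter> {a..b}"
    then have "frac t \<in> ?T" using strand_point_frac[OF i, of t] by (force simp: crossing_params_def)
    moreover have "\<lfloor>t\<rfloor> \<in> {\<lfloor>a\<rfloor>..\<lfloor>b\<rfloor>}" using t by (auto intro: floor_mono)
    moreover have "t = frac t + of_int \<lfloor>t\<rfloor>" by (simp add: frac_def)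
    ultimately show "t \<in> (\<lambda>(t, k). t + of_int k) ` (?T \<times> {\<lfloor>a\<rfloor>..\<lfloor>b\<rfloor>})" by force
  qed
  then show ?thesis using fin finite_subset by blast
qed

lemma crossing_params_isolated:
  assumes i: "i < length L"
  shows "\<forall>\<^sub>F u in at s. u \<notin> crossing_params L i"
proof -
  let ?C = "crossing_params L i \<inter> {s - 1..s + 1}"
  have "\<not> s islimpt ?C" using finite_crossing_params[OF i] islimpt_finite by blast
  then have "\<forall>\<^sub>F u in at s. u \<notin> ?C" by (simp add: islimpt_iff_eventually)
  moreover have "\<forall>\<^sub>F u in at s. dist u s < 1" by (rule eventually_at_ball'[of 1, THEN eventually_mono]) (auto simp: dist_commute)
  ultimately show ?thesis by eventually_elim (auto simp: dist_real_def)
qed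

lemma tendsto_det_pos:
  assumes i: "i < length L" and det: "\<sigma> * det2 (tangent L (i, s)) e > (0::real)"
  shows "\<forall>\<^sub>F u in at s. \<sigma> * det2 (tangent L (i, u)) e > 0"
proof -
  have "((\<lambda>u. \<sigma> * det2 (tangent L (i, u)) e) \<longlongrightarrow> \<sigma> * det2 (tangent L (i, s)) e) (at s)"
    unfolding det2_def by (intro tendsto_intros isCont_tangent[OF i, unfolded isCont_def])
  then show ?thesis using det by (rule order_tendstoD(1))
qed

text \<open>Translating a piece of the strand along the fixed normal at \<open>s\<close> sweeps out
  a connected region off the diagram. For \<open>u\<close> near \<open>s\<close> this normal still
  points to the left, so it computes \<open>lval i u\<close> as well.\<close>

lemma lval_locally_constant:
  assumes i: "i < length L" and reg: "proj L i s \<notin> crossings L"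
  shows "\<forall>\<^sub>F u in at s. lval i u = lval i s"
proof -
  let ?n = "\<i> * tangent L (i, s)"
  obtain \<delta> where \<delta>: "\<delta> > 0" "\<And>s' t'. \<bar>s' - s\<bar> < \<delta> \<Longrightarrow> \<bar>t'\<bar> < \<delta> \<Longrightarrow> t' \<noteq> 0 \<Longrightarrow>
      proj L i s' + of_real t' * ?n \<notin> diagram"
    using normal_region[OF i reg] by blast
  let ?f = "\<lambda>(u, t). proj L i u + complex_of_real t * ?n"
  let ?R = "{s - \<delta><..<s + \<delta>} \<times> {0<..<\<delta>}"
  have "connected (?f ` ?R)"
    unfolding case_prod_beta
    by (intro connected_continuous_image connected_Times continuous_intros
        continuous_on_compose2[OF continuous_proj[OF i, of UNIV]]) auto
  moreover have "?f ` ?R \<inter> diagram = {}" using \<delta>(2) by auto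
  ultimately have const: "W (?f p) = W (?f q)" if "p \<in> ?R" "q \<in> ?R" for p q
    using that by (intro W_constant[OF _ _ imageI imageI])
  have germ: "\<forall>\<^sub>F t in at_right 0. W (?f (u, t)) = lval i u"
    if "proj L i u \<notin> crossings L" "det2 (tangent L (i, u)) ?n > 0" for u
    using that normal_line(1)[OF i] by (intro left_germ[OF i]) auto
  have small: "\<forall>\<^sub>F t in at_right 0. t \<in> {0<..<\<delta>}"
    by (rule eventually_at_rightI[OF _ \<delta>(1)])
  have "\<forall>\<^sub>F u in at s. 1 * det2 (tangent L (i, u)) ?n > 0"
    using normal_line(2)[OF i] by (intro tendsto_det_pos[OF i]) simp
  moreover have "\<forall>\<^sub>F u in at s. dist u s < \<delta>" using \<delta>(1) by (auto simp: eventually_at)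
  ultimately show ?thesis using crossing_params_isolated[OF i]
  proof eventually_elim
    case (elim u)
    have "\<forall>\<^sub>F t in at_right 0. W (?f (u, t)) = lval i u"
      using elim by (intro germ) (auto simp: crossing_params_def)
    moreover have "\<forall>\<^sub>F t in at_right 0. W (?f (s, t)) = lval i s"
      using reg normal_line(2)[OF i] by (intro germ) auto
    ultimately have "\<forall>\<^sub>F t in at_right (0::real). lval i u = lval i s"
      using small
    proof eventually_elim
      case (elim t)
      have "W (?f (u, t)) = W (?f (s, t))"
        using \<open>dist u s < \<delta>\<close> elim(3) \<delta>(1) by (intro const) (auto simp: dist_real_def abs_less_iff)
      then show ?case using elim by simp
    qed
    then show ?case by simp
  qed
qed

lemma lval_arc_constant:
  assumes i: "i < length L" and free: "{a<..<b} \<inter> crossing_params L i = {}"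
    and "s \<in> {a<..<b}" "t \<in> {a<..<b}"
  shows "lval i s = lval i t"
proof (rule connected_local_const[of "{a<..<b}"])
  show "\<forall>u\<in>{a<..<b}. \<forall>\<^sub>F v in at u within {a<..<b}. lval i u = lval i v"
  proof
    fix u assume "u \<in> {a<..<b}"
    then have "proj L i u \<notin> crossings L" using free by (auto simp: crossing_params_def)
    then have "\<forall>\<^sub>F v in at u. lval i u = lval i v"
      using lval_locally_constant[OF i, of u] by (simp add: eq_commute)
    then show "\<forall>\<^sub>F v in at u within {a<..<b}. lval i u = lval i v"
      by (rule filter_leD[OF at_le[OF subset_UNIV]])
  qed
qed (use assms in auto)

text \<open>Near a crossing the two strands are the coordinate axes of the map
  \<open>(h, k) \<mapsto> \<gamma>\<^sub>i (s + h) + \<gamma>\<^sub>j (t + k) - x\<close>, so that \<open>W\<close> is constant on the images of the open quadrants.\<close>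

lemma lval_crossing:
  assumes i: "i < length L" and j: "j < length L" and x: "proj L i s = x" "proj L j t = x"
    and sp: "strand_points L x = {(i, frac s), (j, frac t)}"
    and det: "det2 (tangent L (i, s)) (tangent L (j, t)) > 0"
  shows "\<exists>c. \<forall>\<^sub>F h in at_right 0.
     lval i (s + h) = c - 1 \<and> lval i (s - h) = c \<and> lval j (t + h) = c \<and> lval j (t - h) = c - 1"
proof -
  let ?f = "\<lambda>h k. proj L i (s + h) + (proj L j (t + k) - x)"
  obtain \<delta> where \<delta>: "\<delta> > 0" "\<And>s' t'. \<bar>s' - s\<bar> < \<delta> \<Longrightarrow> \<bar>t' - t\<bar> < \<delta> \<Longrightarrow> t' \<noteq> t \<Longrightarrow> (True \<Longrightarrow> s' \<noteq> s) \<Longrightarrow>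
      proj L i s' + (proj L j t' - proj L j t) \<notin> diagram"
    by (rule quadrant_region[OF i x(1)[symmetric] proj_deriv(1)[OF j] isCont_tangent[OF j], where B = True])
      (use det sp x in auto)
  have off: "?f h k \<notin> diagram" if "h \<noteq> 0" "k \<noteq> 0" "\<bar>h\<bar> < \<delta>" "\<bar>k\<bar> < \<delta>" for h k
    using \<delta>(2)[of "s + h" "t + k"] that x by simp
  \<comment> \<open>\<open>W\<close> on the quadrant with signs \<sigma> and \<tau>, sampled at one
    of its points.\<close>
  define c where "c \<sigma> \<tau> = W (?f (\<sigma> * (\<delta> / 2)) (\<tau> * (\<delta> / 2)))" for \<sigma> \<tau> :: real
  have const: "W (?f (\<sigma> * h) (\<tau> * k)) = c \<sigma> \<tau>"
    if "\<sigma> = 1 \<or> \<sigma> = -1" "\<tau> = 1 \<or> \<tau> = -1" "0 < h" "h < \<delta>" "0 < k" "k < \<delta>" for \<sigma> \<tau> h k :: real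
  proof -
    let ?g = "\<lambda>p. ?f (\<sigma> * fst p) (\<tau> * snd p)"
    have "connected (?g ` ({0<..<\<delta>} \<times> {0<..<\<delta>}))"
      by (intro connected_continuous_image connected_Times continuous_intros
        continuous_on_compose2[OF continuous_proj[OF i, of UNIV]] continuous_on_compose2[OF continuous_proj[OF j, of UNIV]]) auto
    moreover have "?g ` ({0<..<\<delta>} \<times> {0<..<\<delta>}) \<inter> diagram = {}"
    proof -
      have "?g p \<notin> diagram" if "p \<in> {0<..<\<delta>} \<times> {0<..<\<delta>}" for p
        using that \<open>\<sigma> = 1 \<or> \<sigma> = -1\<close> \<open>\<tau> = 1 \<or> \<tau> = -1\<close> by (intro off) auto
      then show ?thesis by blast
    qed
    moreover have "(h, k) \<in> {0<..<\<delta>} \<times> {0<..<\<delta>}" "(\<delta> / 2, \<delta> / 2) \<in> {0<..<\<delta>} \<times> {0<..<\<delta>}"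
      using that \<delta>(1) by auto
    ultimately have "W (?g (h, k)) = W (?g (\<delta> / 2, \<delta> / 2))" by (intro W_constant[OF _ _ imageI imageI])
    then show ?thesis by (simp add: c_def)
  qed
  have small: "\<forall>\<^sub>F h in at_right 0. 0 < h \<and> h < \<delta>"
    by (rule eventually_at_rightI[OF _ \<delta>(1)]) auto
  \<comment> \<open>By the sign of the determinant, moving forward along strand \<open>j\<close>
    leads to the left of strand \<open>i\<close>. So the quadrants with \<open>\<tau> = 1\<close>
    see \<open>lval i\<close>, those with \<open>\<tau> = -1\<close> one less.\<close>
  have *: "\<forall>\<^sub>F h in at_right 0. (\<tau> = 1 \<longrightarrow> c \<sigma> \<tau> = lval i (s + \<sigma> * h)) \<and> (\<tau> = -1 \<longrightarrow> c \<sigma> \<tau> = lval i (s + \<sigma> * h) - 1)"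
    if \<sigma>: "\<sigma> = 1 \<or> \<sigma> = -1" and \<tau>: "\<tau> = 1 \<or> \<tau> = -1" for \<sigma> \<tau> :: real
  proof -
    have "\<forall>\<^sub>F u in at s. 1 * det2 (tangent L (i, u)) (tangent L (j, t)) > 0"
      using det by (intro tendsto_det_pos[OF i]) simp
    then have 1: "\<forall>\<^sub>F h in at_right 0. 1 * det2 (tangent L (i, s + \<sigma> * h)) (tangent L (j, t)) > 0"
      by (rule eventually_at_right_reflect[OF _ \<sigma>])
    have 2: "\<forall>\<^sub>F h in at_right 0. s + \<sigma> * h \<notin> crossing_params L i"
      by (rule eventually_at_right_reflect[OF crossing_params_isolated[OF i] \<sigma>])
    show ?thesis using 1 2 small
    proof eventually_elim
      case (elim h)
      let ?b = "\<lambda>k. ?f (\<sigma> * h) (\<tau> * k)"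
      have reg: "proj L i (s + \<sigma> * h) \<notin> crossings L" using elim(2) by (simp add: crossing_params_def)
      have b0: "?b 0 = proj L i (s + \<sigma> * h)" using x by simp
      have "((\<lambda>k. proj L j (t + \<tau> * k)) has_vector_derivative \<tau> *\<^sub>R tangent L (j, t + \<tau> * 0)) (at 0)"
        by (rule vector_diff_chain_at[of "\<lambda>k. t + \<tau> * k" \<tau> 0 "proj L j", unfolded o_def])
          (auto intro!: derivative_eq_intros proj_deriv(1)[OF j])
      then have bd: "(?b has_vector_derivative \<tau> *\<^sub>R tangent L (j, t)) (at 0)"
        by (auto intro!: derivative_eq_intros)
      have W: "\<forall>\<^sub>F k in at_right 0. W (?b k) = c \<sigma> \<tau>"
        using small by eventually_elim (use const[OF \<sigma> \<tau>] elim(3) in auto)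
      show ?case
      proof (intro conjI impI)
        assume "\<tau> = 1"
        then have "\<forall>\<^sub>F k in at_right 0. W (?b k) = lval i (s + \<sigma> * h)"
          using elim(1) by (intro left_germ[OF i reg b0 bd]) simp
        with W have "\<forall>\<^sub>F k in at_right (0::real). c \<sigma> \<tau> = lval i (s + \<sigma> * h)" by eventually_elim simp
        then show "c \<sigma> \<tau> = lval i (s + \<sigma> * h)" by simp
      next
        assume "\<tau> = -1"
        then have "\<forall>\<^sub>F k in at_right 0. W (?b k) = lval i (s + \<sigma> * h) - 1"
          using elim(1) by (intro right_germ[OF i reg b0 bd]) (simp add: det2_def)
        with W have "\<forall>\<^sub>F k in at_right (0::real). c \<sigma> \<tau> = lval i (s + \<sigma> * h) - 1" by eventually_elim simp
        then show "c \<sigma> \<tau> = lval i (s + \<sigma> * h) - 1" by simp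
      qed
    qed
  qed
  \<comment> \<open>For strand \<open>j\<close> the sides are reversed: moving backward along strand
    \<open>i\<close> leads to its left.\<close>
  have **: "\<forall>\<^sub>F h in at_right 0. (\<sigma> = -1 \<longrightarrow> c \<sigma> \<tau> = lval j (t + \<tau> * h)) \<and> (\<sigma> = 1 \<longrightarrow> c \<sigma> \<tau> = lval j (t + \<tau> * h) - 1)"
    if \<sigma>: "\<sigma> = 1 \<or> \<sigma> = -1" and \<tau>: "\<tau> = 1 \<or> \<tau> = -1" for \<sigma> \<tau> :: real
  proof -
    have "\<forall>\<^sub>F u in at t. -1 * det2 (tangent L (j, u)) (tangent L (i, s)) > 0"
      using det by (intro tendsto_det_pos[OF j]) (simp add: det2_def algebra_simps)
    then have 1: "\<forall>\<^sub>F h in at_right 0. -1 * det2 (tangent L (j, t + \<tau> * h)) (tangent L (i, s)) > 0"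
      by (rule eventually_at_right_reflect[OF _ \<tau>])
    have 2: "\<forall>\<^sub>F h in at_right 0. t + \<tau> * h \<notin> crossing_params L j"
      by (rule eventually_at_right_reflect[OF crossing_params_isolated[OF j] \<tau>])
    show ?thesis using 1 2 small
    proof eventually_elim
      case (elim h)
      let ?b = "\<lambda>k. ?f (\<sigma> * k) (\<tau> * h)"
      have reg: "proj L j (t + \<tau> * h) \<notin> crossings L" using elim(2) by (simp add: crossing_params_def)
      have b0: "?b 0 = proj L j (t + \<tau> * h)" using x by simp
      have "((\<lambda>k. proj L i (s + \<sigma> * k)) has_vector_derivative \<sigma> *\<^sub>R tangent L (i, s + \<sigma> * 0)) (at 0)"
        by (rule vector_diff_chain_at[of "\<lambda>k. s + \<sigma> * k" \<sigma> 0 "proj L i", unfolded o_def])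
          (auto intro!: derivative_eq_intros proj_deriv(1)[OF i])
      then have bd: "(?b has_vector_derivative \<sigma> *\<^sub>R tangent L (i, s)) (at 0)"
        by (auto intro!: derivative_eq_intros)
      have W: "\<forall>\<^sub>F k in at_right 0. W (?b k) = c \<sigma> \<tau>"
        using small by eventually_elim (use const[OF \<sigma> \<tau>] elim(3) in auto)
      show ?case
      proof (intro conjI impI)
        assume "\<sigma> = -1"
        then have "\<forall>\<^sub>F k in at_right 0. W (?b k) = lval j (t + \<tau> * h)"
          using elim(1) by (intro left_germ[OF j reg b0 bd]) (simp add: det2_def)
        with W have "\<forall>\<^sub>F k in at_right (0::real). c \<sigma> \<tau> = lval j (t + \<tau> * h)" by eventually_elim simp
        then show "c \<sigma> \<tau> = lval j (t + \<tau> * h)" by simp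
      next
        assume "\<sigma> = 1"
        then have "\<forall>\<^sub>F k in at_right 0. W (?b k) = lval j (t + \<tau> * h) - 1"
          using elim(1) by (intro right_germ[OF j reg b0 bd]) simp
        with W have "\<forall>\<^sub>F k in at_right (0::real). c \<sigma> \<tau> = lval j (t + \<tau> * h) - 1" by eventually_elim simp
        then show "c \<sigma> \<tau> = lval j (t + \<tau> * h) - 1" by simp
      qed
    qed
  qed
  have "\<forall>\<^sub>F h in at_right 0.
     lval i (s + h) = c 1 1 \<and> lval i (s - h) = c (-1) 1 \<and> lval j (t + h) = c 1 1 + 1 \<and> lval j (t - h) = c (-1) (-1)
     \<and> lval j (t + h) = c (-1) 1 \<and> lval i (s - h) = c (-1) (-1) + 1"
    using *[of 1 1, simplified] *[of "-1" 1, simplified] *[of "-1" "-1", simplified]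
      **[of 1 1, simplified] **[of "-1" "-1", simplified] **[of "-1" 1, simplified]
    by eventually_elim (intro conjI; metis diff_add_cancel)
  then have "\<forall>\<^sub>F h in at_right 0.
     lval i (s + h) = (c 1 1 + 1) - 1 \<and> lval i (s - h) = c 1 1 + 1 \<and> lval j (t + h) = c 1 1 + 1 \<and> lval j (t - h) = (c 1 1 + 1) - 1"
    by eventually_elim (metis add_diff_cancel_right')
  \<comment> \<open>The witness \<open>c 1 1 + 1\<close> equals \<open>c (-1) 1\<close>, the value
    on the quadrant to the left of both strands.\<close>
  then show ?thesis by blast
qed

end


section \<open>Surgery on the orbits of a permutation\<close>

text \<open>Forward iterates suffice: an injective self-map of a finite set returns to its starting
  point.\<close>

definition cyc :: "('a \<Rightarrow> 'a) \<Rightarrow> 'a \<Rightarrow> 'a set" where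
  "cyc f a = range (\<lambda>n. (f ^^ n) a)"

lemma cyc_self [simp]: "a \<in> cyc f a"
  unfolding cyc_def by (metis funpow_0 rangeI)

lemma cyc_step: "y \<in> cyc f a \<Longrightarrow> f y \<in> cyc f a"
proof -
  assume "y \<in> cyc f a"
  then obtain n where "y = (f ^^ n) a" unfolding cyc_def by auto
  then have "f y = (f ^^ Suc n) a" by simp
  then show ?thesis unfolding cyc_def by blast
qed

lemma cyc_minimal:
  assumes "a \<in> T" "\<And>y. y \<in> T \<Longrightarrow> f y \<in> T" shows "cyc f a \<subseteq> T"
proof -
  have "(f ^^ n) a \<in> T" for n by (induction n) (use assms in auto)
  then show ?thesis unfolding cyc_def by auto
qed

locale finite_perm =
  fixes E :: "'a set" and f :: "'a \<Rightarrow> 'a"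
  assumes fin: "finite E" and maps: "\<And>y. y \<in> E \<Longrightarrow> f y \<in> E" and inj: "inj_on f E"
begin

lemma cyc_subset: "a \<in> E \<Longrightarrow> cyc f a \<subseteq> E"
  by (rule cyc_minimal) (auto intro: maps)

lemma funpow_in: "a \<in> E \<Longrightarrow> (f ^^ n) a \<in> E"
  using cyc_subset unfolding cyc_def by blast

lemma period:
  assumes a: "a \<in> E" obtains n where "n > 0" "(f ^^ n) a = a"
proof -
  have "\<not> inj (\<lambda>n. (f ^^ n) a)"
  proof
    assume "inj (\<lambda>n. (f ^^ n) a)"
    moreover have "finite (range (\<lambda>n. (f ^^ n) a))"
      using funpow_in[OF a] fin by (meson finite_subset image_subset_iff)
    ultimately show False using finite_imageD infinite_UNIV_nat by blast
  qed
  then obtain m n where mn: "m < n" "(f ^^ m) a = (f ^^ n) a"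
    unfolding inj_def by (metis linorder_neqE_nat)
  have "(f ^^ k) a = (f ^^ (k + d)) a \<Longrightarrow> a = (f ^^ d) a" for k d
  proof (induction k)
    case (Suc k)
    have "f ((f ^^ k) a) = f ((f ^^ (k + d)) a)" using Suc.prems by simp
    then have "(f ^^ k) a = (f ^^ (k + d)) a"
      using inj funpow_in[OF a] by (meson inj_onD)
    then show ?case by (rule Suc.IH)
  qed simp
  from this[of m "n - m"] mn show ?thesis by (intro that[of "n - m"]) auto
qed

lemma cyc_sym:
  assumes a: "a \<in> E" and b: "b \<in> cyc f a" shows "a \<in> cyc f b"
proof -
  obtain k where k: "b = (f ^^ k) a" using b unfolding cyc_def by auto
  obtain n where n: "n > 0" "(f ^^ n) a = a" using period[OF a] .
  have "(f ^^ (n * m)) a = a" for m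
    by (induction m) (auto simp: funpow_add n)
  then have "a = (f ^^ (n * k - k + k)) a" using n(1) by simp
  also have "\<dots> = (f ^^ (n * k - k)) b" unfolding k by (simp only: funpow_add o_apply)
  finally show ?thesis unfolding cyc_def by blast
qed

lemma cyc_eq:
  assumes a: "a \<in> E" and b: "b \<in> cyc f a" shows "cyc f b = cyc f a"
proof
  show "cyc f b \<subseteq> cyc f a" using b cyc_step by (intro cyc_minimal)
  show "cyc f a \<subseteq> cyc f b" using cyc_sym[OF a b] cyc_step by (intro cyc_minimal)
qed

lemma cyc_eq_or_disjoint: "a \<in> E \<Longrightarrow> b \<in> E \<Longrightarrow> cyc f a = cyc f b \<or> cyc f a \<inter> cyc f b = {}"
  using cyc_eq by blast

lemma bij_betw_cyc:
  assumes a: "a \<in> E" shows "bij_betw f (cyc f a) (cyc f a)"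
proof -
  have "f ` cyc f a \<subseteq> cyc f a" using cyc_step by auto
  moreover have "inj_on f (cyc f a)" using inj cyc_subset[OF a] inj_on_subset by blast
  moreover have "finite (cyc f a)" using fin cyc_subset[OF a] finite_subset by blast
  ultimately show ?thesis by (simp add: bij_betw_def endo_inj_surj)
qed

end

definition orbits :: "'a set \<Rightarrow> ('a \<Rightarrow> 'a) \<Rightarrow> 'a set set" where
  "orbits E f = cyc f ` E"

text \<open>\<open>g = f \<circ> (a b)\<close> on \<open>E\<close>; this relation between \<open>f\<close> and \<open>g\<close> is symmetric.\<close>

locale swapped = f: finite_perm E f + g: finite_perm E g for E :: "'a set" and f g +
  fixes a b
  assumes ab: "a \<in> E" "b \<in> E" "a \<noteq> b" and swap: "g a = f b" "g b = f a"
    and same: "\<And>y. y \<in> E \<Longrightarrow> y \<noteq> a \<Longrightarrow> y \<noteq> b \<Longrightarrow> g y = f y"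
begin

lemma swapped_sym: "swapped E g f a b"
  by unfold_locales (use ab swap same in auto)

lemma cyc_unaffected:
  assumes c: "c \<in> E" "a \<notin> cyc f c" "b \<notin> cyc f c" shows "cyc g c = cyc f c"
proof -
  have "(g ^^ n) c = (f ^^ n) c" for n
  proof (induction n)
    case (Suc n)
    have "(f ^^ n) c \<noteq> a" "(f ^^ n) c \<noteq> b" using c unfolding cyc_def by blast+
    then show ?case using same f.funpow_in[OF c(1)] Suc by simp
  qed simp
  then show ?thesis by (simp add: cyc_def)
qed

text \<open>\<open>f\<close> and \<open>g\<close> differ only by exchanging the images of
  \<open>a\<close> and \<open>b\<close>, so the union of the two orbits of \<open>g\<close> is
  closed under \<open>f\<close> as well.\<close>

lemma cyc_union_subset: "cyc f a \<union> cyc f b \<subseteq> cyc g a \<union> cyc g b"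
proof -
  let ?U = "cyc g a \<union> cyc g b"
  have "f y \<in> ?U" if y: "y \<in> ?U" for y
  proof -
    have "y \<in> E" using y g.cyc_subset[OF ab(1)] g.cyc_subset[OF ab(2)] by auto
    then consider "y = a" | "y = b" | "f y = g y" using same[of y] by metis
    then show ?thesis
    proof cases
      case 1 then show ?thesis using swap(2) cyc_step[of b g b] by simp
    next
      case 2 then show ?thesis using swap(1) cyc_step[of a g a] by simp
    next
      case 3 then show ?thesis using y cyc_step[of y g] by auto
    qed
  qed
  then show ?thesis using cyc_minimal[of a ?U f] cyc_minimal[of b ?U f] by auto
qed

lemma cyc_union: "cyc f a \<union> cyc f b = cyc g a \<union> cyc g b"
  using cyc_union_subset swapped.cyc_union_subset[OF swapped_sym] by blast

text \<open>Started at \<open>b\<close>, the map \<open>g\<close> enters the \<open>f\<close>-orbit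
  of \<open>a\<close> at \<open>f a\<close> and follows it until it arrives at \<open>a\<close>,
  since it does not meet \<open>b\<close> there.\<close>

lemma merge:
  assumes "b \<notin> cyc f a" shows "cyc g a = cyc g b"
proof -
  define n where "n = (LEAST n. n > 0 \<and> (f ^^ n) a = a)"
  have ex: "\<exists>n. n > 0 \<and> (f ^^ n) a = a" using f.period[OF ab(1)] by blast
  have n: "n > 0" "(f ^^ n) a = a" using LeastI_ex[OF ex] unfolding n_def by auto
  have least: "(f ^^ k) a \<noteq> a" if "0 < k" "k < n" for k
    using not_less_Least[of k "\<lambda>n. n > 0 \<and> (f ^^ n) a = a"] that unfolding n_def by simp
  have "(g ^^ Suc k) b = (f ^^ Suc k) a" if "k < n" for k
    using that
  proof (induction k)
    case (Suc k)
    have "(f ^^ Suc k) a \<in> cyc f a" unfolding cyc_def by blast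
    then have "(f ^^ Suc k) a \<noteq> a" "(f ^^ Suc k) a \<noteq> b"
      using least[of "Suc k"] Suc.prems assms by auto
    then have "g ((f ^^ Suc k) a) = f ((f ^^ Suc k) a)" using same f.funpow_in[OF ab(1)] by blast
    then show ?case using Suc by simp
  qed (use swap in simp)
  from this[of "n - 1"] n have "(g ^^ n) b = a" by simp
  then have "a \<in> cyc g b" unfolding cyc_def by blast
  then show ?thesis using g.cyc_eq ab by blast
qed

text \<open>The orbit of \<open>b\<close> under \<open>g\<close> is trapped in the part of the
  \<open>f\<close>-cycle from \<open>f a\<close> to \<open>b\<close>, because at \<open>b\<close>
  the map \<open>g\<close> jumps back to \<open>f a\<close>. This part does not contain
  \<open>a\<close>.\<close>

lemma split:
  assumes "b \<in> cyc f a" shows "b \<notin> cyc g a"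
proof -
  define n where "n = (LEAST n. (f ^^ n) a = b)"
  have ex: "\<exists>n. (f ^^ n) a = b" using assms unfolding cyc_def by auto
  have n: "(f ^^ n) a = b" "\<And>k. k < n \<Longrightarrow> (f ^^ k) a \<noteq> b"
    using LeastI_ex[OF ex] not_less_Least unfolding n_def by blast+
  have "n > 0" using n(1) ab(3) by (cases n) auto
  have na: "(f ^^ k) a \<noteq> a" if "0 < k" "k \<le> n" for k
  proof
    assume k: "(f ^^ k) a = a"
    have "(f ^^ (n - k)) ((f ^^ k) a) = b"
      using n(1) that by (metis comp_apply funpow_add le_add_diff_inverse2)
    then show False using n(2)[of "n - k"] k that by simp
  qed
  define Y where "Y = (\<lambda>k. (f ^^ k) a) ` {1..n}"
  have "cyc g b \<subseteq> Y"
  proof (rule cyc_minimal)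
    show "b \<in> Y" using n(1) \<open>n > 0\<close> unfolding Y_def by force
    fix y assume "y \<in> Y"
    then obtain k where "k \<in> {1..n}" "y = (f ^^ k) a" unfolding Y_def by blast
    then have k: "0 < k" "k \<le> n" "y = (f ^^ k) a" by auto
    show "g y \<in> Y"
    proof (cases "k = n")
      case True
      then have "g y = (f ^^ 1) a" using k n(1) swap by simp
      then show ?thesis unfolding Y_def using \<open>n > 0\<close> by (intro image_eqI[of _ _ 1]) auto
    next
      case False
      then have "y \<noteq> a" "y \<noteq> b" using k na n(2)[of k] by auto
      then have "g y = (f ^^ Suc k) a" using same[of y] f.funpow_in[OF ab(1)] k by simp
      then show ?thesis unfolding Y_def using k False by (intro image_eqI[of _ _ "Suc k"]) auto
    qed
  qed
  moreover have "a \<notin> Y" using na unfolding Y_def by (auto dest: sym)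
  ultimately have "a \<notin> cyc g b" by blast
  then show ?thesis using g.cyc_sym ab by blast
qed

end

text \<open>A split is a merge read backwards, so this locale also serves for splits, with
  \<open>f\<close> and \<open>g\<close> exchanged.\<close>

locale merging = swapped +
  assumes merging: "b \<notin> cyc f a"
begin

lemma cyc_ne: "cyc f a \<noteq> cyc f b" using merging cyc_self[of b f] by metis

lemma cyc_disjoint: "cyc f a \<inter> cyc f b = {}"
  using cyc_ne f.cyc_eq_or_disjoint ab by blast

lemma merged: "cyc g a = cyc f a \<union> cyc f b" "cyc g b = cyc f a \<union> cyc f b"
  using merge[OF merging] cyc_union by auto

definition untouched :: "'a set set" where
  "untouched = cyc f ` (E - (cyc f a \<union> cyc f b))"

lemma cyc_outside:
  assumes "c \<in> E" "c \<notin> cyc f a \<union> cyc f b"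
  shows "cyc g c = cyc f c" "cyc f c \<noteq> cyc f a" "cyc f c \<noteq> cyc f b" "cyc f c \<noteq> cyc g a"
proof -
  have "a \<notin> cyc f c" "b \<notin> cyc f c" using assms f.cyc_sym ab by blast+
  moreover have "a \<in> cyc f a" "b \<in> cyc f b" "a \<in> cyc g a" by simp_all
  ultimately show "cyc g c = cyc f c" "cyc f c \<noteq> cyc f a" "cyc f c \<noteq> cyc f b" "cyc f c \<noteq> cyc g a"
    using cyc_unaffected[OF assms(1)] by metis+
qed

lemma orbits_f: "orbits E f = untouched \<union> {cyc f a, cyc f b}"
proof -
  have "cyc f c \<in> untouched \<union> {cyc f a, cyc f b}" if "c \<in> E" for c
  proof (cases "c \<in> cyc f a \<union> cyc f b")
    case True
    then show ?thesis using f.cyc_eq[OF ab(1), of c] f.cyc_eq[OF ab(2), of c] by blast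
  next
    case False
    then show ?thesis using that unfolding untouched_def by blast
  qed
  then show ?thesis unfolding orbits_def untouched_def using ab by auto
qed

lemma orbits_g: "orbits E g = untouched \<union> {cyc g a}"
proof -
  have "cyc g c \<in> untouched \<union> {cyc g a}" if c: "c \<in> E" for c
  proof (cases "c \<in> cyc f a \<union> cyc f b")
    case True then show ?thesis using g.cyc_eq[OF ab(1), of c] merged by auto
  next
    case False then show ?thesis using cyc_outside(1)[OF c] c unfolding untouched_def by auto
  qed
  moreover have "A \<in> orbits E g" if "A \<in> untouched" for A
    using that cyc_outside(1) unfolding untouched_def orbits_def by force
  moreover have "cyc g a \<in> orbits E g" using ab unfolding orbits_def by blast
  ultimately show ?thesis unfolding orbits_def by auto
qed

lemma not_untouched: "cyc f a \<notin> untouched" "cyc f b \<notin> untouched" "cyc g a \<notin> untouched" "cyc g a \<noteq> cyc f a" "cyc g a \<noteq> cyc f b"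
proof -
  show "cyc f a \<notin> untouched" "cyc f b \<notin> untouched" "cyc g a \<notin> untouched"
    unfolding untouched_def using cyc_outside by blast+
  show "cyc g a \<noteq> cyc f a" "cyc g a \<noteq> cyc f b" using cyc_disjoint merged by (metis Int_absorb Un_Int_eq cyc_self emptyE)+
qed

lemma finite_untouched: "finite untouched"
  unfolding untouched_def using f.fin by blast

lemma card_orbits: "card (orbits E f) = card (orbits E g) + 1"
  unfolding orbits_f orbits_g using finite_untouched not_untouched cyc_ne by (simp add: card_insert_if)

lemma orbits_diff:
  "orbits E f - orbits E g = {cyc f a, cyc f b}" "orbits E g - orbits E f = {cyc g a}" "orbits E f \<inter> orbits E g = untouched"
  unfolding orbits_f orbits_g using not_untouched by auto

end

text \<open>A monomial in the variables \<open>x\<^sub>c\<close>, \<open>c \<in> E\<close>, is evaluated in the tensor power of \<open>\<rat>[X]/(X\<^sup>2)\<close> over the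
  orbits, \<open>x\<^sub>c\<close> being the generator \<open>X = v\<^sub>-\<close> of the factor of the orbit of \<open>c\<close>. Merging is then induced by
  the identity of the polynomial ring, and splitting by multiplication with \<open>x\<^sub>a + x\<^sub>b\<close>.\<close>

definition monomial :: "'a set \<Rightarrow> ('a \<Rightarrow> 'a) \<Rightarrow> 'a list \<Rightarrow> 'a set set \<Rightarrow> rat" where
  "monomial E f l X = (if distinct (map (cyc f) l) \<and> X = orbits E f - cyc f ` set l then 1 else 0)"

text \<open>The formula of \<open>edge_entry\<close> for arbitrary collections of sets, which
  separates the algebra of the cube from the diagram.\<close>

definition surgery_entry :: "'a set set \<Rightarrow> 'a set set \<Rightarrow> 'a set set \<Rightarrow> 'a set set \<Rightarrow> rat" where
  "surgery_entry C C' X X' =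
    (let old = C - C'; new = C' - C; unaffected = C \<inter> C'; p = card (X \<inter> old); p' = card (X' \<inter> new)
     in if X \<inter> unaffected = X' \<inter> unaffected
           \<and> (card old = 2 \<and> card new = 1 \<and> (p = 2 \<and> p' = 1 \<or> p = 1 \<and> p' = 0)
             \<or> card old = 1 \<and> card new = 2 \<and> (p = 1 \<and> p' = 1 \<or> p = 0 \<and> p' = 0))
        then 1 else 0)"

definition surgery :: "'a set \<Rightarrow> ('a \<Rightarrow> 'a) \<Rightarrow> ('a \<Rightarrow> 'a) \<Rightarrow> ('a set set \<Rightarrow> rat) \<Rightarrow> 'a set set \<Rightarrow> rat" where
  "surgery E f g \<phi> X' = (\<Sum>X\<in>Pow (orbits E f). \<phi> X * surgery_entry (orbits E f) (orbits E g) X X')"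

text \<open>A monomial is a single basis vector, or zero if some orbit occurs twice
  (\<open>X^2 = 0\<close>), so the sum over label sets has at most one term.\<close>

lemma surgery_monomial:
  assumes "finite E"
  shows "surgery E f g (monomial E f l) X' =
    (if distinct (map (cyc f) l) then surgery_entry (orbits E f) (orbits E g) (orbits E f - cyc f ` set l) X' else 0)"
proof -
  have "finite (Pow (orbits E f))" using assms by (simp add: orbits_def)
  then have "(\<Sum>X\<in>Pow (orbits E f). if X = orbits E f - cyc f ` set l then surgery_entry (orbits E f) (orbits E g) X X' else 0)
     = surgery_entry (orbits E f) (orbits E g) (orbits E f - cyc f ` set l) X'"
    by (subst sum.delta) auto
  then show ?thesis
    unfolding surgery_def monomial_def by (auto simp: if_distrib[of "\<lambda>x. x * _"] cong: if_cong)
qed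

lemma monomial_perm: "mset l = mset l' \<Longrightarrow> monomial E f l = monomial E f l'"
  unfolding monomial_def fun_eq_iff by (metis mset_map mset_eq_imp_distinct_iff mset_eq_setD)

lemma monomial_cong: "map (cyc f) l = map (cyc f) l' \<Longrightarrow> monomial E f l = monomial E f l'"
proof -
  assume eq: "map (cyc f) l = map (cyc f) l'"
  then have "cyc f ` set l = cyc f ` set l'" by (metis list.set_map)
  with eq show ?thesis unfolding monomial_def by simp
qed

lemma eq_Diff_iff_single:
  assumes "X \<subseteq> U \<union> {A}"
  shows "X = U \<union> {A} - K \<longleftrightarrow> X \<inter> U = U - K \<and> (A \<in> X \<longleftrightarrow> A \<notin> K)"
proof
  assume h: "X \<inter> U = U - K \<and> (A \<in> X \<longleftrightarrow> A \<notin> K)"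
  show "X = U \<union> {A} - K"
  proof (rule set_eqI)
    fix x show "x \<in> X \<longleftrightarrow> x \<in> U \<union> {A} - K"
      using h assms by (cases "x \<in> U"; cases "x = A") auto
  qed
qed auto

lemma eq_Diff_iff_pair:
  assumes "X \<subseteq> U \<union> {A, B}"
  shows "X = U \<union> {A, B} - K \<longleftrightarrow> X \<inter> U = U - K \<and> (A \<in> X \<longleftrightarrow> A \<notin> K) \<and> (B \<in> X \<longleftrightarrow> B \<notin> K)"
proof
  assume h: "X \<inter> U = U - K \<and> (A \<in> X \<longleftrightarrow> A \<notin> K) \<and> (B \<in> X \<longleftrightarrow> B \<notin> K)"
  show "X = U \<union> {A, B} - K"
  proof (rule set_eqI)
    fix x show "x \<in> X \<longleftrightarrow> x \<in> U \<union> {A, B} - K"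
      using h assms by (cases "x \<in> U"; cases "x = A"; cases "x = B") auto
  qed
qed auto

text \<open>What remains of \<open>surgery_merge\<close> after expansion: \<open>p\<close> and
  \<open>q\<close> say that the list meets the orbit of \<open>a\<close> and of \<open>b\<close>,
  \<open>m\<close> that the merged orbit is labelled \<open>+\<close>, and \<open>u\<close> compares
  the untouched orbits.\<close>

lemma merge_count:
  "(if D then of_bool (u \<and> (\<not> p \<and> \<not> q \<and> m \<or> (\<not> p \<longleftrightarrow> \<not> \<not> q) \<and> \<not> m)) else 0) =
    (of_bool (D \<and> \<not> (p \<and> q) \<and> u \<and> (m \<longleftrightarrow> \<not> p \<and> \<not> q)) :: rat)"
  by (cases D; cases p; cases q; cases m; cases u) simp_all

text \<open>The analogue for \<open>surgery_split\<close>, with \<open>x\<close> and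
  \<open>y\<close> for the labels of the two new orbits. The conditions \<open>a1\<close> to
  \<open>a4\<close> stand for the comparisons between the orbits of \<open>a\<close> and
  \<open>b\<close> that arise when the list is extended by \<open>a\<close> or
  \<open>b\<close>.\<close>

lemma split_count:
  assumes "a1" "a4" "\<not> a2" "\<not> a3"
  shows "(if D \<and> \<not> (p \<and> q) then of_bool (u \<and> (\<not> (p \<or> q) \<and> (x \<longleftrightarrow> \<not> y) \<or> \<not> \<not> (p \<or> q) \<and> \<not> x \<and> \<not> y)) else 0) =
    (of_bool ((\<not> p \<and> D) \<and> u \<and> (x \<longleftrightarrow> \<not> (a1 \<or> p)) \<and> (y \<longleftrightarrow> \<not> (a2 \<or> q)))
      + of_bool ((\<not> q \<and> D) \<and> u \<and> (x \<longleftrightarrow> \<not> (a3 \<or> p)) \<and> (y \<longleftrightarrow> \<not> (a4 \<or> q))) :: rat)"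
  using assms by (cases D; cases p; cases q; cases x; cases y; cases u) simp_all

context merging
begin

lemma card_Int_pair: "card (X \<inter> {cyc f a, cyc f b}) = of_bool (cyc f a \<in> X) + of_bool (cyc f b \<in> X)"
  using cyc_ne by (auto simp: Int_insert_right)

lemma card_Int_single: "card (X \<inter> {cyc g a}) = of_bool (cyc g a \<in> X)"
  by (simp add: Int_insert_right)

lemma merge_entry: "surgery_entry (orbits E f) (orbits E g) X X' =
    of_bool (X \<inter> untouched = X' \<inter> untouched \<and>
      (cyc f a \<in> X \<and> cyc f b \<in> X \<and> cyc g a \<in> X' \<or> (cyc f a \<in> X \<longleftrightarrow> cyc f b \<notin> X) \<and> cyc g a \<notin> X'))"
  unfolding surgery_entry_def Let_def orbits_diff card_Int_pair card_Int_single using cyc_ne by auto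

lemma split_entry: "surgery_entry (orbits E g) (orbits E f) X X' =
    of_bool (X \<inter> untouched = X' \<inter> untouched \<and>
      (cyc g a \<in> X \<and> (cyc f a \<in> X' \<longleftrightarrow> cyc f b \<notin> X') \<or> cyc g a \<notin> X \<and> cyc f a \<notin> X' \<and> cyc f b \<notin> X'))"
  unfolding surgery_entry_def Let_def orbits_diff Int_commute[of "orbits E g"] card_Int_pair card_Int_single using cyc_ne by auto

definition fuse :: "'a set \<Rightarrow> 'a set" where
  "fuse D = (if D = cyc f a \<or> D = cyc f b then cyc g a else D)"

lemma fuse_cyc: "c \<in> E \<Longrightarrow> fuse (cyc f c) = cyc g c"
proof (cases "c \<in> cyc f a \<union> cyc f b")
  case True
  then show ?thesis
    using f.cyc_eq[OF ab(1), of c] f.cyc_eq[OF ab(2), of c] g.cyc_eq[OF ab(1), of c] merged unfolding fuse_def by auto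
next
  case False
  moreover assume "c \<in> E"
  ultimately show ?thesis using cyc_outside[of c] unfolding fuse_def by simp
qed

lemma map_cyc_g: "set l \<subseteq> E \<Longrightarrow> map (cyc g) l = map fuse (map (cyc f) l)"
  using fuse_cyc by (auto simp: subset_iff)

text \<open>A new coincidence arises only from a factor in each of the two merged orbits: the
  product of their generators becomes \<open>X^2 = 0\<close>.\<close>

lemma distinct_fuse:
  assumes "set xs \<subseteq> untouched \<union> {cyc f a, cyc f b}"
  shows "distinct (map fuse xs) \<longleftrightarrow> distinct xs \<and> \<not> (cyc f a \<in> set xs \<and> cyc f b \<in> set xs)"
proof -
  have "inj_on fuse (set xs) \<longleftrightarrow> \<not> (cyc f a \<in> set xs \<and> cyc f b \<in> set xs)"
  proof
    assume "inj_on fuse (set xs)"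
    then show "\<not> (cyc f a \<in> set xs \<and> cyc f b \<in> set xs)"
      using cyc_ne unfolding inj_on_def fuse_def by metis
  next
    assume "\<not> (cyc f a \<in> set xs \<and> cyc f b \<in> set xs)"
    then show "inj_on fuse (set xs)"
      using assms not_untouched unfolding inj_on_def fuse_def by (smt (verit, best) UnE insertE singletonD subsetD)
  qed
  then show ?thesis by (auto simp: distinct_map)
qed

lemma fuse_image:
  assumes "K \<subseteq> untouched \<union> {cyc f a, cyc f b}"
  shows "fuse ` K \<inter> untouched = K \<inter> untouched" "cyc g a \<in> fuse ` K \<longleftrightarrow> cyc f a \<in> K \<or> cyc f b \<in> K"
  using assms not_untouched unfolding fuse_def by (auto split: if_splits)

lemma orbit_list: "set l \<subseteq> E \<Longrightarrow> set (map (cyc f) l) \<subseteq> untouched \<union> {cyc f a, cyc f b}"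
  unfolding orbits_f[symmetric] orbits_def by auto

lemma monomial_f:
  assumes l: "set l \<subseteq> E" and X: "X \<subseteq> orbits E f"
  shows "monomial E f l X = of_bool (distinct (map (cyc f) l) \<and> X \<inter> untouched = untouched - cyc f ` set l
    \<and> (cyc f a \<in> X \<longleftrightarrow> cyc f a \<notin> cyc f ` set l) \<and> (cyc f b \<in> X \<longleftrightarrow> cyc f b \<notin> cyc f ` set l))"
proof -
  have "X = orbits E f - cyc f ` set l \<longleftrightarrow> X \<inter> untouched = untouched - cyc f ` set l
    \<and> (cyc f a \<in> X \<longleftrightarrow> cyc f a \<notin> cyc f ` set l) \<and> (cyc f b \<in> X \<longleftrightarrow> cyc f b \<notin> cyc f ` set l)"
    using X unfolding orbits_f by (rule eq_Diff_iff_pair)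
  then show ?thesis unfolding monomial_def by auto
qed

lemma monomial_g:
  assumes l: "set l \<subseteq> E" and X: "X \<subseteq> orbits E g"
  shows "monomial E g l X = of_bool (distinct (map (cyc f) l) \<and> \<not> (cyc f a \<in> cyc f ` set l \<and> cyc f b \<in> cyc f ` set l)
    \<and> X \<inter> untouched = untouched - cyc f ` set l
    \<and> (cyc g a \<in> X \<longleftrightarrow> cyc f a \<notin> cyc f ` set l \<and> cyc f b \<notin> cyc f ` set l))"
proof -
  have im: "cyc g ` set l = fuse ` (cyc f ` set l)"
    using arg_cong[OF map_cyc_g[OF l], of set] by (simp add: image_image)
  have K: "cyc f ` set l \<subseteq> untouched \<union> {cyc f a, cyc f b}" using orbit_list[OF l] by simp
  have d: "distinct (map (cyc g) l) \<longleftrightarrow> distinct (map (cyc f) l) \<and> \<not> (cyc f a \<in> cyc f ` set l \<and> cyc f b \<in> cyc f ` set l)"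
    unfolding map_cyc_g[OF l] using distinct_fuse[OF orbit_list[OF l]] by (simp del: map_map)
  have "X = orbits E g - cyc g ` set l \<longleftrightarrow> X \<inter> untouched = untouched - cyc g ` set l
    \<and> (cyc g a \<in> X \<longleftrightarrow> cyc g a \<notin> cyc g ` set l)"
    using X unfolding orbits_g by (rule eq_Diff_iff_single)
  moreover have "untouched - cyc g ` set l = untouched - cyc f ` set l" "cyc g a \<in> cyc g ` set l \<longleftrightarrow> cyc f a \<in> cyc f ` set l \<or> cyc f b \<in> cyc f ` set l"
    unfolding im using fuse_image[OF K] by blast+
  ultimately show ?thesis unfolding monomial_def d by auto
qed

lemma surgery_merge:
  assumes l: "set l \<subseteq> E" and X: "X \<subseteq> orbits E g"
  shows "surgery E f g (monomial E f l) X = monomial E g l X"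
proof -
  let ?K = "cyc f ` set l"
  have "(orbits E f - ?K) \<inter> untouched = untouched - ?K" "cyc f a \<in> orbits E f" "cyc f b \<in> orbits E f"
    unfolding orbits_f by auto
  then have L: "(orbits E f - ?K) \<inter> untouched = X \<inter> untouched \<longleftrightarrow> X \<inter> untouched = untouched - ?K"
      "cyc f a \<in> orbits E f - ?K \<longleftrightarrow> cyc f a \<notin> ?K" "cyc f b \<in> orbits E f - ?K \<longleftrightarrow> cyc f b \<notin> ?K"
    by (simp_all add: eq_commute)
  show ?thesis
    unfolding surgery_monomial[OF f.fin] merge_entry monomial_g[OF l X] L by (rule merge_count)
qed

lemma surgery_split:
  assumes l: "set l \<subseteq> E" and X: "X \<subseteq> orbits E f"
  shows "surgery E g f (monomial E g l) X = monomial E f (a # l) X + monomial E f (b # l) X"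
proof -
  let ?K = "cyc f ` set l" and ?A = "cyc f a" and ?B = "cyc f b"
  have im: "cyc g ` set l = fuse ` ?K"
    using arg_cong[OF map_cyc_g[OF l], of set] by (simp add: image_image)
  have K: "?K \<subseteq> untouched \<union> {?A, ?B}" using orbit_list[OF l] by simp
  have d: "distinct (map (cyc g) l) \<longleftrightarrow> distinct (map (cyc f) l) \<and> \<not> (?A \<in> ?K \<and> ?B \<in> ?K)"
    unfolding map_cyc_g[OF l] using distinct_fuse[OF orbit_list[OF l]] by (simp del: map_map)
  have "untouched - cyc g ` set l = untouched - ?K"
    unfolding im using fuse_image(1)[OF K] by blast
  moreover have "(orbits E g - cyc g ` set l) \<inter> untouched = untouched - cyc g ` set l"
    unfolding orbits_g by blast
  ultimately have 1: "(orbits E g - cyc g ` set l) \<inter> untouched = untouched - ?K" "cyc g a \<in> orbits E g"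
    "cyc g a \<in> cyc g ` set l \<longleftrightarrow> ?A \<in> ?K \<or> ?B \<in> ?K"
    using fuse_image(2)[OF K] by (simp_all add: orbits_g im)
  have la: "set (a # l) \<subseteq> E" "set (b # l) \<subseteq> E" using l ab by auto
  have 2: "untouched - insert ?A ?K = untouched - ?K" "untouched - insert ?B ?K = untouched - ?K" "?A \<noteq> ?B"
    using not_untouched cyc_ne by auto
  have L: "(orbits E g - cyc g ` set l) \<inter> untouched = X \<inter> untouched \<longleftrightarrow> X \<inter> untouched = untouched - ?K"
    unfolding 1(1) by (rule eq_commute)
  have M: "cyc g a \<in> orbits E g - cyc g ` set l \<longleftrightarrow> \<not> (?A \<in> ?K \<or> ?B \<in> ?K)" using 1 by simp
  have dc: "distinct (map (cyc f) (c # l)) \<longleftrightarrow> cyc f c \<notin> ?K \<and> distinct (map (cyc f) l)"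
    "cyc f ` set (c # l) = insert (cyc f c) ?K" for c by simp_all
  show ?thesis
    unfolding surgery_monomial[OF f.fin] split_entry monomial_f[OF la(1) X] monomial_f[OF la(2) X] d L M dc 2(1,2) insert_iff
    by (rule split_count) (use 2(3) in simp_all)
qed

end

section \<open>Commutation of two surgeries\<close>

context swapped
begin

lemma mergingI: "b \<notin> cyc f a \<Longrightarrow> merging E f g a b"
  by unfold_locales

lemma splittingI: "b \<in> cyc f a \<Longrightarrow> merging E g f a b"
  using swapped.mergingI[OF swapped_sym] split by blast

text \<open>Each case records the change in the number of orbits. The two ways around a square have
  the same total change, which excludes the inconsistent combinations.\<close>

lemma surgery_cases:
  obtains (merge) "b \<notin> cyc f a" "card (orbits E f) = card (orbits E g) + 1"
    "\<And>l X. set l \<subseteq> E \<Longrightarrow> X \<subseteq> orbits E g \<Longrightarrow> surgery E f g (monomial E f l) X = monomial E g l X"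
  | (split) "b \<in> cyc f a" "card (orbits E g) = card (orbits E f) + 1"
    "\<And>l X. set l \<subseteq> E \<Longrightarrow> X \<subseteq> orbits E g \<Longrightarrow>
       surgery E f g (monomial E f l) X = monomial E g (a # l) X + monomial E g (b # l) X"
proof (cases "b \<in> cyc f a")
  case True
  interpret m: merging E g f a b by (rule splittingI[OF True])
  show ?thesis using True m.card_orbits m.surgery_split by (intro split)
next
  case False
  interpret m: merging E f g a b by (rule mergingI[OF False])
  show ?thesis using False m.card_orbits m.surgery_merge by (intro merge)
qed

end

lemma surgery_cong:
  assumes "\<And>X. X \<subseteq> orbits E f \<Longrightarrow> \<phi> X = \<psi> X" shows "surgery E f g \<phi> = surgery E f g \<psi>"
  using assms by (auto simp: surgery_def fun_eq_iff intro!: sum.cong)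

lemma surgery_add: "surgery E f g (\<lambda>X. \<phi> X + \<psi> X) Y = surgery E f g \<phi> Y + surgery E f g \<psi> Y"
  by (simp add: surgery_def distrib_right sum.distrib)

text \<open>The only faces for which the two monomial factors differ formally are those where the two surgeries
  are merge-split in both orders, or split-merge in both orders.\<close>

lemma surgery_square:
  assumes x0: "swapped E f00 f10 a b" and y1: "swapped E f10 f11 c d"
    and y0: "swapped E f00 f01 c d" and x1: "swapped E f01 f11 a b"
    and l: "set l \<subseteq> E" and X: "X \<subseteq> orbits E f11"
  shows "surgery E f10 f11 (surgery E f00 f10 (monomial E f00 l)) X =
    surgery E f01 f11 (surgery E f00 f01 (monomial E f00 l)) X"
proof -
  interpret x0: swapped E f00 f10 a b by (rule x0)
  interpret y1: swapped E f10 f11 c d by (rule y1)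
  interpret y0: swapped E f00 f01 c d by (rule y0)
  interpret x1: swapped E f01 f11 a b by (rule x1)
  note E = x0.ab(1,2) y0.ab(1,2)
  have MM: "surgery E g h (surgery E f g (monomial E f l)) X = surgery E g h (monomial E g l) X"
    if "\<And>X. X \<subseteq> orbits E g \<Longrightarrow> surgery E f g (monomial E f l) X = monomial E g l X" for f g h
    using that by (intro fun_cong[OF surgery_cong])
  have SS: "surgery E g h (surgery E f g (monomial E f l)) X = surgery E g h (monomial E g (u # l)) X + surgery E g h (monomial E g (v # l)) X"
    if "\<And>X. X \<subseteq> orbits E g \<Longrightarrow> surgery E f g (monomial E f l) X = monomial E g (u # l) X + monomial E g (v # l) X" for f g h u v
    unfolding surgery_add[symmetric] using that by (intro fun_cong[OF surgery_cong])
  have lc: "set (u # l) \<subseteq> E" if "u \<in> E" for u using l that by simp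
  have pair: "monomial E f11 (a # l) X + monomial E f11 (b # l) X = monomial E f11 (c # l) X + monomial E f11 (d # l) X"
    if "{cyc f11 a, cyc f11 b} = {cyc f11 c, cyc f11 d}"
  proof -
    have "cyc f11 a = cyc f11 c \<and> cyc f11 b = cyc f11 d \<or> cyc f11 a = cyc f11 d \<and> cyc f11 b = cyc f11 c"
      using that by (metis doubleton_eq_iff)
    then show ?thesis
      using monomial_cong[of f11 "a # l" "c # l" E] monomial_cong[of f11 "b # l" "d # l" E]
        monomial_cong[of f11 "a # l" "d # l" E] monomial_cong[of f11 "b # l" "c # l" E] by auto
  qed
  show ?thesis
  proof (cases rule: x0.surgery_cases)
    case merge
    note x0m = this
    show ?thesis
    proof (cases rule: y1.surgery_cases)
      case merge
      note y1m = this
      show ?thesis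
      proof (cases rule: y0.surgery_cases)
        case merge
        note y0m = this
        show ?thesis
        proof (cases rule: x1.surgery_cases)
          case merge
          show ?thesis by (simp only: MM[OF x0m(3)[OF l]] MM[OF y0m(3)[OF l]] y1m(3)[OF l X] merge(3)[OF l X])
        next
          case split
          then show ?thesis using x0m(2) y1m(2) y0m(2) by simp
        qed
      next
        case split
        show ?thesis by (cases rule: x1.surgery_cases) (use x0m(2) y1m(2) split(2) in simp_all)
      qed
    next
      case split
      note y1s = this
      show ?thesis
      proof (cases rule: y0.surgery_cases)
        case merge
        note y0m = this
        show ?thesis
        proof (cases rule: x1.surgery_cases)
          case merge
          then show ?thesis using x0m(2) y1s(2) y0m(2) by simp
        next
          case split
          \<comment> \<open>Merge-split both ways: the pairs \<open>a\<close>, \<open>b\<close> and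
            \<open>c\<close>, \<open>d\<close> have to represent the same two orbits of
            \<open>f11\<close>. Both pairs lie in the orbit of \<open>f10\<close> created by the
            merge, and the split cuts this orbit into exactly two.\<close>
          interpret M1: merging E f00 f10 a b by (rule x0.mergingI[OF x0m(1)])
          interpret S1: merging E f11 f10 c d by (rule y1.splittingI[OF y1s(1)])
          interpret S2: merging E f11 f01 a b by (rule x1.splittingI[OF split(1)])
          \<comment> \<open>Otherwise the first merge leaves the orbit of \<open>c\<close> alone,
            and \<open>d\<close>, which belongs to it afterwards, would have belonged to it
            before.\<close>
          have "c \<in> cyc f00 a \<union> cyc f00 b"
          proof (rule ccontr)
            assume "c \<notin> cyc f00 a \<union> cyc f00 b"
            then have "cyc f10 c = cyc f00 c" using M1.cyc_outside(1) E by blast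
            then show False using y1s(1) y0m(1) by simp
          qed
          then have "c \<in> cyc f10 a" unfolding M1.merged(1) .
          from x0.g.cyc_eq[OF E(1) this] have u: "cyc f10 a = cyc f11 c \<union> cyc f11 d"
            using S1.merged(1) by simp
          have "cyc f11 e = cyc f11 c \<or> cyc f11 e = cyc f11 d" if "e \<in> cyc f10 a" for e
            using that unfolding u using y1.g.cyc_eq[OF E(3), of e] y1.g.cyc_eq[OF E(4), of e] by (elim UnE) simp_all
          moreover have "a \<in> cyc f10 a" "b \<in> cyc f10 a" unfolding M1.merged(1) by simp_all
          ultimately have "cyc f11 a = cyc f11 c \<or> cyc f11 a = cyc f11 d" "cyc f11 b = cyc f11 c \<or> cyc f11 b = cyc f11 d"
            by blast+
          then have "{cyc f11 a, cyc f11 b} = {cyc f11 c, cyc f11 d}" using S2.cyc_ne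
            by (elim disjE) (simp_all add: insert_commute)
          with pair[OF this] show ?thesis by (simp only: MM[OF x0m(3)[OF l]] MM[OF y0m(3)[OF l]] y1s(3)[OF l X] split(3)[OF l X])
        qed
      next
        case split
        note y0s = this
        show ?thesis
        proof (cases rule: x1.surgery_cases)
          case merge
          show ?thesis by (simp only: MM[OF x0m(3)[OF l]] SS[OF y0s(3)[OF l]] y1s(3)[OF l X] merge(3)[OF lc[OF E(3)] X] merge(3)[OF lc[OF E(4)] X])
        next
          case split
          then show ?thesis using x0m(2) y1s(2) y0s(2) by simp
        qed
      qed
    qed
  next
    case split
    note x0s = this
    show ?thesis
    proof (cases rule: y1.surgery_cases)
      case merge
      note y1m = this
      show ?thesis
      proof (cases rule: y0.surgery_cases)
        case merge
        note y0m = this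
        show ?thesis
        proof (cases rule: x1.surgery_cases)
          case merge
          then show ?thesis using x0s(2) y1m(2) y0m(2) by simp
        next
          case split
          show ?thesis by (simp only: SS[OF x0s(3)[OF l]] MM[OF y0m(3)[OF l]] split(3)[OF l X] y1m(3)[OF lc[OF E(1)] X] y1m(3)[OF lc[OF E(2)] X])
        qed
      next
        case split
        note y0s = this
        show ?thesis
        proof (cases rule: x1.surgery_cases)
          case merge
          \<comment> \<open>Split-merge both ways: \<open>a\<close>, \<open>b\<close>,
            \<open>c\<close>, \<open>d\<close> all end up in one orbit of \<open>f11\<close>, so the
            two sums agree term by term.\<close>
          interpret S1: merging E f10 f00 a b by (rule x0.splittingI[OF x0s(1)])
          interpret M1: merging E f10 f11 c d by (rule y1.mergingI[OF y1m(1)])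
          interpret M2: merging E f01 f11 a b by (rule x1.mergingI[OF merge(1)])
          have "a \<in> cyc f00 c \<or> b \<in> cyc f00 c"
          proof (rule ccontr)
            assume "\<not> (a \<in> cyc f00 c \<or> b \<in> cyc f00 c)"
            then have "cyc f10 c = cyc f00 c" using x0.cyc_unaffected E by blast
            then show False using y1m(1) y0s(1) by simp
          qed
          then have "cyc f00 c = cyc f00 a"
          proof
            assume "a \<in> cyc f00 c"
            from x0.f.cyc_eq[OF E(3) this] show ?thesis by (rule sym)
          next
            assume "b \<in> cyc f00 c"
            from x0.f.cyc_eq[OF E(3) this] x0.f.cyc_eq[OF E(1) x0s(1)] show ?thesis by simp
          qed
          then have "c \<in> cyc f00 a" using cyc_self[of c f00] by simp
          then have "c \<in> cyc f10 a \<or> c \<in> cyc f10 b" unfolding S1.merged(1) by simp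
          then have "cyc f10 c = cyc f10 a \<or> cyc f10 c = cyc f10 b"
            using x0.g.cyc_eq[OF E(1), of c] x0.g.cyc_eq[OF E(2), of c] by argo
          then have "a \<in> cyc f10 c \<or> b \<in> cyc f10 c" by (elim disjE) simp_all
          then have "a \<in> cyc f11 c \<or> b \<in> cyc f11 c" unfolding M1.merged(1) by blast
          then have "cyc f11 a = cyc f11 c"
          proof
            assume "a \<in> cyc f11 c"
            from y1.g.cyc_eq[OF E(3) this] show ?thesis .
          next
            assume "b \<in> cyc f11 c"
            from y1.g.cyc_eq[OF E(3) this] M2.merged show ?thesis by simp
          qed
          then have "{cyc f11 a, cyc f11 b} = {cyc f11 c, cyc f11 d}" using M1.merged M2.merged by simp
          with pair[OF this] show ?thesis by (simp only: SS[OF x0s(3)[OF l]] SS[OF y0s(3)[OF l]] y1m(3)[OF lc[OF E(1)] X] y1m(3)[OF lc[OF E(2)] X]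
              merge(3)[OF lc[OF E(3)] X] merge(3)[OF lc[OF E(4)] X])
        next
          case split
          then show ?thesis using x0s(2) y1m(2) y0s(2) by simp
        qed
      qed
    next
      case split
      note y1s = this
      show ?thesis
      proof (cases rule: y0.surgery_cases)
        case merge
        show ?thesis by (cases rule: x1.surgery_cases) (use x0s(2) y1s(2) merge(2) in simp_all)
      next
        case split
        note y0s = this
        show ?thesis
        proof (cases rule: x1.surgery_cases)
          case merge
          then show ?thesis using x0s(2) y1s(2) y0s(2) by simp
        next
          case split
          \<comment> \<open>Two splits multiply by \<open>x_a + x_b\<close> and
            \<open>x_c + x_d\<close> in either order; the four products agree up to the order of the
            factors.\<close>
          have lcc: "set (u # v # l) \<subseteq> E" if "u \<in> E" "v \<in> E" for u v using l that by simp
          have sw: "monomial E f11 (u # v # l) = monomial E f11 (v # u # l)" for u v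
            by (rule monomial_perm) simp
          show ?thesis by (simp add: SS[OF x0s(3)[OF l]] SS[OF y0s(3)[OF l]] y1s(3)[OF lc[OF E(1)] X] y1s(3)[OF lc[OF E(2)] X]
              split(3)[OF lc[OF E(3)] X] split(3)[OF lc[OF E(4)] X] sw[of a c] sw[of a d] sw[of b c] sw[of b d])
        qed
      qed
    qed
  qed
qed

text \<open>The list contains one representative of each orbit labelled \<open>-\<close>. So every
  basis vector is a monomial, and identities need only be tested on monomials.\<close>

lemma monomial_indicator:
  assumes perm: "finite_perm E f" and X0: "X0 \<subseteq> orbits E f"
  obtains l where "set l \<subseteq> E" "\<And>X. monomial E f l X = of_bool (X = X0)"
proof -
  interpret p: finite_perm E f by (rule perm)
  have "finite (orbits E f - X0)" using p.fin by (simp add: orbits_def)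
  from finite_distinct_list[OF this] obtain ds where ds: "set ds = orbits E f - X0" "distinct ds" by blast
  define r where "r D = (SOME c. c \<in> E \<and> cyc f c = D)" for D
  have r: "r D \<in> E \<and> cyc f (r D) = D" if "D \<in> set ds" for D
  proof -
    have "\<exists>c. c \<in> E \<and> cyc f c = D" using that unfolding ds(1) orbits_def by auto
    from someI_ex[OF this] show ?thesis unfolding r_def .
  qed
  have m: "map (cyc f) (map r ds) = ds" using r by (simp add: map_idI)
  then have i: "cyc f ` set (map r ds) = orbits E f - X0" using ds(1) by (metis list.set_map)
  have d: "orbits E f - (orbits E f - X0) = X0" using X0 by blast
  show ?thesis
  proof (rule that[of "map r ds"])
    show "set (map r ds) \<subseteq> E" using r by auto
    show "monomial E f (map r ds) X = of_bool (X = X0)" for X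
      unfolding monomial_def m i d using ds(2) by simp
  qed
qed


section \<open>Source-sink orientation of the arcs\<close>

context link_diagram
begin

definition side_sign :: "nat \<Rightarrow> real \<Rightarrow> int" where
  "side_sign i s = (if even \<lfloor>Re (lval i s)\<rfloor> then 1 else -1)"

lemma side_sign_pred:
  assumes "lval i s \<in> \<int>" "lval j t = lval i s - 1" shows "side_sign j t = - side_sign i s"
proof -
  obtain n where "lval i s = of_int n" using assms(1) by (auto elim: Ints_cases)
  then show ?thesis using assms(2) by (simp add: side_sign_def)
qed

lemma side_sign_eq: "lval j t = lval i s \<Longrightarrow> side_sign j t = side_sign i s"
  by (simp add: side_sign_def)

lemma strand_points_crossing:
  assumes x: "x \<in> crossings L" and v: "(i, u) \<in> strand_points L x" and w: "(j, v) \<in> strand_points L x" and ne: "(i, u) \<noteq> (j, v)"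
  shows "strand_points L x = {(i, u), (j, v)}" "det2 (tangent L (i, u)) (tangent L (j, v)) \<noteq> 0"
proof -
  have card: "card (strand_points L x) = 2" and
    det: "\<forall>v\<in>strand_points L x. \<forall>w\<in>strand_points L x. v \<noteq> w \<longrightarrow> det2 (tangent L v) (tangent L w) \<noteq> 0"
    using generic x unfolding generic_projection_def by blast+
  have "{(i, u), (j, v)} \<subseteq> strand_points L x" "card {(i, u), (j, v)} = 2" using v w ne by auto
  then show "strand_points L x = {(i, u), (j, v)}"
    using card card_subset_eq[OF finite_strand_points[OF x]] by metis
  show "det2 (tangent L (i, u)) (tangent L (j, v)) \<noteq> 0" using det v w ne by blast
qed

text \<open>The values of \<open>lval\<close> around a crossing are \<open>c\<close>,
  \<open>c\<close>, \<open>c - 1\<close>, \<open>c - 1\<close>, arranged so that each strand changes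
  parity there and the two strands do so in opposite senses. Arbitrary lifts of the strand
  parameters are allowed, since arcs may end beyond 1.\<close>

lemma side_sign_crossing:
  assumes i: "i < length L" and j: "j < length L" and x: "proj L i s = x" "proj L j t = x"
    and ne: "(i, frac s) \<noteq> (j, frac t)"
  shows "\<forall>\<^sub>F h in at_right 0. side_sign i (s - h) = - side_sign i (s + h) \<and>
     side_sign j (t + h) = - side_sign i (s + h) \<and> side_sign j (t - h) = side_sign i (s + h)"
proof -
  have sp: "(i, frac s) \<in> strand_points L x" "(j, frac t) \<in> strand_points L x"
    using strand_point_frac[OF i, of s] strand_point_frac[OF j, of t] x by simp_all
  then have cr: "x \<in> crossings L" using ne unfolding crossings_def by blast
  note two = strand_points_crossing[OF cr sp ne]
  have fr: "tangent L (k, frac u) = tangent L (k, u)" if "k < length L" for k u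
    using tangent_periodic[OF that, of "frac u" "\<lfloor>u\<rfloor>"] by (simp add: frac_def)
  have det: "det2 (tangent L (i, s)) (tangent L (j, t)) \<noteq> 0" using two(2) fr i j by simp
  have reg: "\<forall>\<^sub>F h in at_right 0. lval k (u + \<sigma> * h) \<in> \<int>" if k: "k < length L" and \<sigma>: "\<sigma> = 1 \<or> \<sigma> = -1" for k u \<sigma>
  proof -
    have "\<forall>\<^sub>F h in at_right 0. u + \<sigma> * h \<notin> crossing_params L k"
      by (rule eventually_at_right_reflect[OF crossing_params_isolated[OF k] \<sigma>])
    then show ?thesis by eventually_elim (simp add: crossing_params_def lval_Ints[OF k])
  qed
  have regs: "\<forall>\<^sub>F h in at_right 0. lval i (s - h) \<in> \<int> \<and> lval j (t + h) \<in> \<int> \<and> lval i (s + h) \<in> \<int> \<and> lval j (t - h) \<in> \<int>"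
    using reg[OF i, of "-1" s] reg[OF i, of 1 s] reg[OF j, of "-1" t] reg[OF j, of 1 t]
    by (simp add: eventually_conj_iff)
  show ?thesis
  proof (cases "det2 (tangent L (i, s)) (tangent L (j, t)) > 0")
    case True
    obtain c where "\<forall>\<^sub>F h in at_right 0.
       lval i (s + h) = c - 1 \<and> lval i (s - h) = c \<and> lval j (t + h) = c \<and> lval j (t - h) = c - 1"
      using lval_crossing[OF i j x two(1) True] by blast
    then show ?thesis using regs
    proof eventually_elim
      case (elim h)
      have "side_sign i (s + h) = - side_sign i (s - h)" "side_sign j (t + h) = side_sign i (s - h)"
         "side_sign j (t - h) = side_sign i (s + h)"
        using elim by (auto intro!: side_sign_pred side_sign_eq)
      then show ?case by simp
    qed
  next
    case False
    then have d: "det2 (tangent L (j, t)) (tangent L (i, s)) > 0" using det by (simp add: det2_def algebra_simps)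
    have two': "strand_points L x = {(j, frac t), (i, frac s)}" using two(1) by auto
    obtain c where "\<forall>\<^sub>F h in at_right 0.
       lval j (t + h) = c - 1 \<and> lval j (t - h) = c \<and> lval i (s + h) = c \<and> lval i (s - h) = c - 1"
      using lval_crossing[OF j i x(2,1) two' d] by blast
    then show ?thesis using regs
    proof eventually_elim
      case (elim h)
      have "side_sign i (s - h) = - side_sign i (s + h)" "side_sign j (t - h) = side_sign i (s + h)"
         "side_sign j (t + h) = - side_sign i (s + h)"
        using elim by (auto intro!: side_sign_pred side_sign_eq)
      then show ?case by simp
    qed
  qed
qed

text \<open>Orienting each arc by the parity of \<open>W\<close> on its left gives a source-sink orientation: at every crossing
  one strand has both ends pointing in, the other one both ends pointing out. Hence all circles of all
  resolutions are oriented coherently, which excludes surgeries turning one circle into one circle.\<close>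

fun arc_sign :: "diagram_arc \<Rightarrow> int" where
  "arc_sign (i, a, b) = side_sign i ((a + b) / 2)"

lemma arc_cases:
  assumes "A \<in> arcs L"
  obtains (crossed) i a b where "A = (i, a, b)" "i < length L" "0 \<le> a" "a < 1" "a < b"
      "a \<in> crossing_params L i" "b \<in> crossing_params L i" "{a<..<b} \<inter> crossing_params L i = {}"
  | (closed) i where "A = (i, 0, 1)" "i < length L" "crossing_params L i = {}"
  using assms unfolding arcs_def by blast

lemma crossing_params_periodic: "i < length L \<Longrightarrow> t + of_int k \<in> crossing_params L i \<longleftrightarrow> t \<in> crossing_params L i"
  by (simp add: crossing_params_def proj_periodic)

lemma arc_length:
  assumes "(i, a, b) \<in> arcs L" shows "i < length L" "0 \<le> a" "a < 1" "a < b" "b \<le> a + 1" "{a<..<b} \<inter> crossing_params L i = {}"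
proof -
  from assms have "i < length L \<and> 0 \<le> a \<and> a < 1 \<and> a < b \<and> b \<le> a + 1 \<and> {a<..<b} \<inter> crossing_params L i = {}"
  proof (cases rule: arc_cases)
    case (crossed i' a' b')
    \<comment> \<open>The initial crossing recurs one period later, which bounds the arc.\<close>
    have "a' + 1 \<in> crossing_params L i'" using crossed(2,6) crossing_params_periodic[of i' a' 1] by simp
    then have "a' + 1 \<notin> {a'<..<b'}" using crossed(8) by blast
    then show ?thesis using crossed by simp
  qed simp
  then show "i < length L" "0 \<le> a" "a < 1" "a < b" "b \<le> a + 1" "{a<..<b} \<inter> crossing_params L i = {}"
    by blast+
qed

lemma arc_sign_eq:
  assumes "(i, a, b) \<in> arcs L" "s \<in> {a<..<b}"
  shows "arc_sign (i, a, b) = side_sign i s"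
proof -
  have "(a + b) / 2 \<in> {a<..<b}" using arc_length(4)[OF assms(1)] by simp
  from lval_arc_constant[OF arc_length(1,6)[OF assms(1)] this assms(2)] show ?thesis
    unfolding arc_sign.simps by (rule side_sign_eq)
qed

lemma arc_sign_cases: "arc_sign A = 1 \<or> arc_sign A = -1"
  by (cases A) (simp add: side_sign_def)

lemma arc_sign_germ:
  assumes A: "A \<in> arcs L" and ep: "end_point (A, e) = (i, c)"
  shows "\<forall>\<^sub>F h in at_right 0. side_sign i (c + of_int (end_sign (A, e)) * h) = arc_sign A"
proof -
  obtain a b where ab: "A = (i, a, b)" "c = (if e then a else b)" using ep by (cases A) auto
  note len = arc_length[OF A[unfolded ab(1)]]
  show ?thesis
  proof (rule eventually_at_rightI[of 0 "b - a"])
    fix h assume "h \<in> {0<..<b - a}"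
    then show "side_sign i (c + of_int (end_sign (A, e)) * h) = arc_sign A"
      using arc_sign_eq[OF A[unfolded ab(1)], of "c + of_int (end_sign (A, e)) * h"] ab by auto
  qed (use len in simp)
qed

text \<open>\<open>flow u = 1\<close> iff the source-sink orientation leaves the crossing at the end \<open>u\<close>.\<close>

abbreviation flow :: "arc_end \<Rightarrow> int" where "flow u \<equiv> arc_sign (fst u) * end_sign u"

lemma flow_cases: "flow u = 1 \<or> flow u = -1"
  using arc_sign_cases[of "fst u"] by (cases u; cases "snd u") auto

text \<open>Both the side sign and \<open>end_sign\<close> change from one end of a strand to the
  other, so its two ends have equal flow. On the other strand the parity changes in the opposite
  sense, and the flow is the opposite one.\<close>

lemma flow_opposite:
  assumes A: "fst u \<in> arcs L" "end_point u = (i, s)" and B: "fst v \<in> arcs L" "end_point v = (j, t)"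
    and x: "pos L (end_point u) = pos L (end_point v)" and ne: "(i, frac s) \<noteq> (j, frac t)"
  shows "flow u = - flow v"
proof -
  obtain A e B e' where u: "u = (A, e)" and v: "v = (B, e')" by (cases u; cases v)
  have ij: "i < length L" "j < length L"
    using A B arc_length(1) unfolding u v by (cases A; cases B; auto)+
  have x': "proj L j t = proj L i s" using x A(2) B(2) by simp
  have "\<forall>\<^sub>F h in at_right (0::real). flow u = - flow v"
    using side_sign_crossing[OF ij refl x' ne] arc_sign_germ[OF A(1)[unfolded u fst_conv] A(2)[unfolded u]]
      arc_sign_germ[OF B(1)[unfolded v fst_conv] B(2)[unfolded v]]
    unfolding u v fst_conv
    by eventually_elim (cases e; cases e'; simp)
  then show ?thesis by simp
qed


section \<open>The four arc ends at a crossing\<close>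

definition crossing_end :: "arc_end \<Rightarrow> bool" where
  "crossing_end u \<longleftrightarrow> fst u \<in> arcs L \<and> pos L (end_point u) \<in> crossings L"

text \<open>Reduces the parameter modulo 1: an arc may end at some \<open>b \<ge> 1\<close>, while
  strand points have parameters in \<open>[0, 1)\<close>.\<close>

fun strand :: "arc_end \<Rightarrow> nat \<times> real" where
  "strand u = (fst (end_point u), frac (snd (end_point u)))"

lemma end_component: "fst u \<in> arcs L \<Longrightarrow> fst (end_point u) < length L"
  by (cases u; cases "fst u") (auto dest: arc_length(1))

lemma strand_in: "fst u \<in> arcs L \<Longrightarrow> strand u \<in> strand_points L (pos L (end_point u))"
  using strand_point_frac[OF end_component, of u "snd (end_point u)"] by (cases "end_point u") auto

lemma crossing_end_param:
  assumes "crossing_end ((i, a, b), e)"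
  shows "a \<in> crossing_params L i" "b \<in> crossing_params L i"
proof -
  have A: "(i, a, b) \<in> arcs L" and c: "(if e then a else b) \<in> crossing_params L i"
    using assms by (auto simp: crossing_end_def crossing_params_def split: if_splits)
  from A show "a \<in> crossing_params L i" by (cases rule: arc_cases) (use c in auto)
  from A show "b \<in> crossing_params L i" by (cases rule: arc_cases) (use c in auto)
qed

lemma crossing_end_swap: "crossing_end (A, e) \<Longrightarrow> crossing_end (A, e')"
proof -
  assume h: "crossing_end (A, e)"
  obtain i a b where A: "A = (i, a, b)" by (cases A)
  show ?thesis
    using crossing_end_param[OF h[unfolded A]] h A by (cases e') (auto simp: crossing_end_def crossing_params_def)
qed

lemma initial_end_unique:
  assumes u: "crossing_end ((i, a, b), True)" and v: "crossing_end ((i, a', b'), True)"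
    and eq: "frac a = frac a'"
  shows "a = a'" "b = b'"
proof -
  have A: "(i, a, b) \<in> arcs L" "(i, a', b') \<in> arcs L" using u v by (auto simp: crossing_end_def)
  note l = arc_length[OF A(1)] and l' = arc_length[OF A(2)]
  show "a = a'" using eq l l' by (simp add: frac_eq)
  moreover have "b' \<notin> {a<..<b}" "b \<notin> {a'<..<b'}"
    using l(6) l'(6) crossing_end_param[OF u] crossing_end_param[OF v] by blast+
  ultimately show "b = b'" using l(4) l'(4) by auto
qed

lemma final_end_unique:
  assumes u: "crossing_end ((i, a, b), False)" and v: "crossing_end ((i, a', b'), False)"
    and eq: "frac b = frac b'"
  shows "a = a'" "b = b'"
proof -
  have A: "(i, a, b) \<in> arcs L" "(i, a', b') \<in> arcs L" using u v by (auto simp: crossing_end_def)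
  note l = arc_length[OF A(1)] and l' = arc_length[OF A(2)]
  \<comment> \<open>The final parameters differ by an integer, hence so do the initial ones, as
    neither arc has a crossing in its interior. Since both arcs start in \<open>[0, 1)\<close>, the
    integer is 0.\<close>
  have "b - b' = of_int (\<lfloor>b\<rfloor> - \<lfloor>b'\<rfloor>)" using eq by (simp add: frac_def)
  then obtain k :: int where k: "b = b' + of_int k" by (metis diff_add_cancel add.commute)
  have shift: "a' + of_int k \<in> crossing_params L i" "a + of_int (- k) \<in> crossing_params L i"
    using crossing_params_periodic[OF l(1)] crossing_end_param[OF u] crossing_end_param[OF v] by blast+
  have "a' + of_int k \<notin> {a<..<b}" "a + of_int (- k) \<notin> {a'<..<b'}"
    using shift l(6) l'(6) by blast+
  then have ak: "a = a' + of_int k" using l(4) l'(4) k by auto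
  then have "\<bar>real_of_int k\<bar> < 1" using l(2,3) l'(2,3) by auto
  then have "k = 0" by linarith
  then show "a = a'" "b = b'" using ak k by simp_all
qed

lemma initial_end_exists:
  assumes i: "i < length L" and s: "s \<in> crossing_params L i" "0 \<le> s" "s < 1"
  obtains b where "crossing_end ((i, s, b), True)"
proof -
  define T where "T = crossing_params L i \<inter> {s..s + 1} - {s}"
  have fin: "finite T" unfolding T_def using finite_crossing_params[OF i] by blast
  have "s + 1 \<in> T" using crossing_params_periodic[OF i, of s 1] s unfolding T_def by auto
  then have ne: "T \<noteq> {}" by blast
  define b where "b = Min T"
  have b: "b \<in> T" "\<And>t. t \<in> T \<Longrightarrow> b \<le> t" unfolding b_def using fin ne by auto
  have "t \<notin> crossing_params L i" if "t \<in> {s<..<b}" for t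
    using b(2)[of t] b(1) that unfolding T_def by auto
  then have "(i, s, b) \<in> arcs L" unfolding arcs_def using i s b(1) unfolding T_def by auto
  then show ?thesis using s by (intro that[of b]) (auto simp: crossing_end_def crossing_params_def)
qed

lemma final_end_exists:
  assumes i: "i < length L" and s: "s \<in> crossing_params L i" "0 \<le> s" "s < 1"
  obtains a b where "crossing_end ((i, a, b), False)" "frac b = s"
proof -
  define T where "T = crossing_params L i \<inter> {s - 1..s} - {s}"
  have fin: "finite T" unfolding T_def using finite_crossing_params[OF i] by blast
  have "s - 1 \<in> T" using crossing_params_periodic[OF i, of s "-1"] s unfolding T_def by auto
  then have ne: "T \<noteq> {}" by blast
  define a where "a = Max T"
  have a: "a \<in> T" "\<And>t. t \<in> T \<Longrightarrow> t \<le> a" unfolding a_def using fin ne by auto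
  have free: "t \<notin> crossing_params L i" if "t \<in> {a<..<s}" for t
    using a(2)[of t] a(1) that unfolding T_def by auto
  \<comment> \<open>If the preceding crossing has a negative parameter, the whole arc is moved by
    one period, so that it starts in \<open>[0, 1)\<close>.\<close>
  define k :: int where "k = (if a < 0 then 1 else 0)"
  have "t \<notin> crossing_params L i" if "t \<in> {a + of_int k<..<s + of_int k}" for t
    using free[of "t + of_int (- k)"] crossing_params_periodic[OF i, of t "- k"] that by auto
  moreover have "0 \<le> a + of_int k" "a + of_int k < 1" using a(1) s unfolding T_def k_def by auto
  ultimately have A: "(i, a + of_int k, s + of_int k) \<in> arcs L"
    unfolding arcs_def using i s a(1) crossing_params_periodic[OF i] unfolding T_def by auto
  show ?thesis
  proof (rule that)
    show "crossing_end ((i, a + of_int k, s + of_int k), False)"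
      using A s proj_periodic[OF i] by (auto simp: crossing_end_def crossing_params_def)
    show "frac (s + of_int k) = s" using s by (simp add: frac_eq)
  qed
qed

text \<open>The arcs towards the next and from the previous crossing parameter provide the two ends;
  their directions are the tangent and its negative. With two strands this reduces the analysis of a
  crossing to four ends.\<close>

lemma strand_ends:
  assumes x: "x \<in> crossings L" and w: "w \<in> strand_points L x"
  obtains A B where "\<And>u. crossing_end u \<and> strand u = w \<longleftrightarrow> u = (A, True) \<or> u = (B, False)"
    "end_dir L (B, False) = - end_dir L (A, True)" "pos L (end_point (A, True)) = x"
proof -
  obtain i s where io: "w = (i, s)" "i < length L" "0 \<le> s" "s < 1" "proj L i s = x"
    using w unfolding strand_points_def by auto
  have s: "s \<in> crossing_params L i" using io x by (simp add: crossing_params_def)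
  have fs: "frac s = s" using io by (simp add: frac_eq)
  obtain b where b: "crossing_end ((i, s, b), True)" using initial_end_exists[OF io(2) s io(3,4)] .
  obtain a c where ac: "crossing_end ((i, a, c), False)" "frac c = s" using final_end_exists[OF io(2) s io(3,4)] .
  show ?thesis
  proof (rule that[of "(i, s, b)" "(i, a, c)"])
    fix u
    show "crossing_end u \<and> strand u = w \<longleftrightarrow> u = ((i, s, b), True) \<or> u = ((i, a, c), False)"
    proof
      assume u: "crossing_end u \<and> strand u = w"
      obtain j a' b' e where ue: "u = ((j, a', b'), e)" by (metis prod.exhaust)
      have j: "j = i" using u ue io by simp
      show "u = ((i, s, b), True) \<or> u = ((i, a, c), False)"
      proof (cases e)
        case True
        have e: "frac a' = frac s" using conjunct2[OF u] True unfolding ue io(1) by (simp add: fs)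
        have "crossing_end ((i, a', b'), True)" using conjunct1[OF u] True unfolding ue j by simp
        from initial_end_unique[OF this b e] show ?thesis using True unfolding ue j by simp
      next
        case False
        then have e: "frac b' = frac c" using conjunct2[OF u] False unfolding ue io(1) by (simp add: ac(2))
        have "crossing_end ((i, a', b'), False)" using conjunct1[OF u] False unfolding ue j by simp
        from final_end_unique[OF this ac(1) e] show ?thesis using False unfolding ue j by simp
      qed
    next
      assume "u = ((i, s, b), True) \<or> u = ((i, a, c), False)"
      then show "crossing_end u \<and> strand u = w"
      proof
        assume u: "u = ((i, s, b), True)"
        show ?thesis using b unfolding u io(1) by (simp add: fs)
      next
        assume u: "u = ((i, a, c), False)"
        show ?thesis using ac unfolding u io(1) by simp
      qed
    qed
  next
    have "tangent L (i, frac c) = tangent L (i, c)"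
      using tangent_periodic[OF io(2), of "frac c" "\<lfloor>c\<rfloor>"] by (simp add: frac_def)
    then show "end_dir L ((i, a, c), False) = - end_dir L ((i, s, b), True)"
      using ac by (simp add: end_dir_def)
  qed (use io in simp)
qed

lemma height_frac: "i < length L \<Longrightarrow> height L (i, frac t) = height L (i, t)"
  using height_periodic[of i "frac t" "\<lfloor>t\<rfloor>"] by (simp add: frac_def)

lemma strand_heights:
  assumes "v \<in> strand_points L x" "w \<in> strand_points L x" "v \<noteq> w"
  shows "height L v \<noteq> height L w"
proof
  obtain i s j t where vw: "v = (i, s)" "w = (j, t)" by (cases v; cases w)
  assume "height L v = height L w"
  then have "(L ! i) s = (L ! j) t" "i < length L" "j < length L" "s \<in> {0..<1}" "t \<in> {0..<1}"
    using assms vw by (auto simp: strand_points_def proj_def prod_eq_iff height.simps)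
  then show False using link assms(3) vw unfolding is_link_def by blast
qed

lemma strand_height: "fst u \<in> arcs L \<Longrightarrow> height L (strand u) = height L (end_point u)"
  using height_frac[OF end_component, of u "snd (end_point u)"] by simp

lemma strand_tangent: "fst u \<in> arcs L \<Longrightarrow> tangent L (strand u) = tangent L (end_point u)"
  using tangent_periodic[OF end_component, of u "frac (snd (end_point u))" "\<lfloor>snd (end_point u)\<rfloor>"] by (simp add: frac_def)

lemma joined_strands:
  assumes "joined L S u v"
  shows "crossing_end u" "crossing_end v" "strand u \<noteq> strand v" "pos L (end_point u) = pos L (end_point v)"
proof -
  have h: "fst u \<in> arcs L" "fst v \<in> arcs L" "pos L (end_point u) = pos L (end_point v)"
    "height L (end_point v) < height L (end_point u)" using assms unfolding joined_def by auto
  show "strand u \<noteq> strand v" using h(4) strand_height[OF h(1)] strand_height[OF h(2)] by auto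
  then have "pos L (end_point u) \<in> crossings L"
    using strand_in[OF h(1)] strand_in[OF h(2)] h(3) unfolding crossings_def by force
  then show "crossing_end u" "crossing_end v" "pos L (end_point u) = pos L (end_point v)"
    using h by (auto simp: crossing_end_def)
qed

lemma flow_opposite_strands:
  assumes "fst u \<in> arcs L" "fst v \<in> arcs L" "strand u \<noteq> strand v" "pos L (end_point u) = pos L (end_point v)"
  shows "flow u = - flow v"
  using flow_opposite[of u "fst (end_point u)" "snd (end_point u)" v "fst (end_point v)" "snd (end_point v)"] assms by simp

lemma joined_flow: "joined L S u v \<Longrightarrow> flow u = - flow v"
  using flow_opposite_strands joined_strands unfolding crossing_end_def by blast

definition linked :: "complex set \<Rightarrow> arc_end \<Rightarrow> arc_end \<Rightarrow> bool" where
  "linked S u v \<longleftrightarrow> joined L S u v \<or> joined L S v u"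

text \<open>Exchanging \<open>u\<close> and \<open>v\<close> reverses both the determinant and the
  comparison of heights. The condition is therefore symmetric, and reversing any one of state,
  direction and height order toggles it.\<close>

lemma linked_iff:
  assumes u: "crossing_end u" and v: "crossing_end v" and ne: "strand u \<noteq> strand v"
    and x: "pos L (end_point u) = pos L (end_point v)"
  shows "linked S u v \<longleftrightarrow> (pos L (end_point u) \<in> S \<longleftrightarrow>
     (det2 (end_dir L u) (end_dir L v) > 0 \<longleftrightarrow> height L (end_point v) < height L (end_point u)))"
    and "det2 (end_dir L u) (end_dir L v) \<noteq> 0"
proof -
  have A: "fst u \<in> arcs L" "fst v \<in> arcs L" using u v by (auto simp: crossing_end_def)
  have sp: "strand u \<in> strand_points L (pos L (end_point u))" "strand v \<in> strand_points L (pos L (end_point u))"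
    using strand_in A x by metis+
  have h: "height L (end_point u) \<noteq> height L (end_point v)"
    using strand_heights[OF sp ne] strand_height A by metis
  have "pos L (end_point u) \<in> crossings L" using u by (simp add: crossing_end_def)
  then have "det2 (tangent L (strand u)) (tangent L (strand v)) \<noteq> 0"
    using strand_points_crossing(2) sp ne by (metis surj_pair)
  then have t: "det2 (tangent L (end_point u)) (tangent L (end_point v)) \<noteq> 0"
    using strand_tangent A by metis
  show d: "det2 (end_dir L u) (end_dir L v) \<noteq> 0"
    using t by (cases u; cases v; cases "snd u"; cases "snd v") (auto simp: end_dir_def det2_def)
  have sym: "det2 (end_dir L v) (end_dir L u) = - det2 (end_dir L u) (end_dir L v)"
    by (simp add: det2_def algebra_simps)
  show "linked S u v \<longleftrightarrow> (pos L (end_point u) \<in> S \<longleftrightarrow>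
     (det2 (end_dir L u) (end_dir L v) > 0 \<longleftrightarrow> height L (end_point v) < height L (end_point u)))"
    unfolding linked_def joined_def using A x h d sym by (auto split: if_splits)
qed

end


section \<open>Resolutions as permutations of the arcs\<close>

context link_diagram
begin

declare strand.simps [simp del]

text \<open>\<open>head\<close> is the end where the source-sink orientation, not that of the link,
  runs into a crossing, and \<open>tail\<close> the end where it leaves one.\<close>

definition head :: "diagram_arc \<Rightarrow> arc_end" where "head A = (A, arc_sign A = -1)"
definition tail :: "diagram_arc \<Rightarrow> arc_end" where "tail A = (A, arc_sign A = 1)"

lemma fst_head [simp]: "fst (head A) = A" and fst_tail [simp]: "fst (tail A) = A"
  by (simp_all add: head_def tail_def)

lemma flow_head: "flow u = -1 \<longleftrightarrow> u = head (fst u)"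
  using arc_sign_cases[of "fst u"] by (cases u; cases "snd u") (auto simp: head_def)

lemma flow_tail: "flow u = 1 \<longleftrightarrow> u = tail (fst u)"
  using arc_sign_cases[of "fst u"] by (cases u; cases "snd u") (auto simp: tail_def)

lemma crossing_end_tail: "crossing_end (tail A) \<longleftrightarrow> crossing_end (head A)"
  unfolding head_def tail_def using crossing_end_swap by blast

lemma linked_sym: "linked S u v \<Longrightarrow> linked S v u"
  by (auto simp: linked_def)

lemma linked_strands:
  assumes "linked S u v"
  shows "crossing_end u" "crossing_end v" "strand u \<noteq> strand v" "pos L (end_point u) = pos L (end_point v)" "flow u = - flow v"
proof -
  have "crossing_end u \<and> crossing_end v \<and> strand u \<noteq> strand v \<and> pos L (end_point u) = pos L (end_point v) \<and> flow u = - flow v"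
    using assms unfolding linked_def
  proof
    assume "joined L S u v"
    from joined_strands[OF this] joined_flow[OF this] show ?thesis by simp
  next
    assume "joined L S v u"
    from joined_strands[OF this] joined_flow[OF this] show ?thesis by simp
  qed
  then show "crossing_end u" "crossing_end v" "strand u \<noteq> strand v" "pos L (end_point u) = pos L (end_point v)" "flow u = - flow v"
    by blast+
qed

lemma crossing_end_strand: "crossing_end u \<Longrightarrow> strand u \<in> strand_points L (pos L (end_point u))"
  unfolding crossing_end_def using strand_in by blast

lemma other_strand:
  assumes x: "x \<in> crossings L" and v: "v \<in> strand_points L x"
  obtains w where "w \<in> strand_points L x" "w \<noteq> v" "strand_points L x = {v, w}"
proof -
  obtain a b where "a \<in> strand_points L x" "b \<in> strand_points L x" "a \<noteq> b" using x unfolding crossings_def by blast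
  then obtain w where w: "w \<in> strand_points L x" "w \<noteq> v" by metis
  then have "strand_points L x = {v, w}"
    using strand_points_crossing(1)[OF x, of "fst v" "snd v" "fst w" "snd w"] v by simp
  then show ?thesis using w that by blast
qed

lemma end_at_strand_pos:
  assumes "crossing_end u" "strand u \<in> strand_points L x" shows "pos L (end_point u) = x"
  using crossing_end_strand[OF assms(1)] assms(2) by (auto simp: strand_points_def)

text \<open>The candidates are the two ends of the other strand. Their directions are opposite, so
  their determinants with \<open>u\<close> have opposite signs and exactly one of them fits.\<close>

lemma linked_unique:
  assumes u: "crossing_end u" shows "\<exists>!v. linked S u v"
proof -
  let ?x = "pos L (end_point u)"
  have x: "?x \<in> crossings L" using u by (simp add: crossing_end_def)
  obtain w where w: "w \<in> strand_points L ?x" "w \<noteq> strand u" "strand_points L ?x = {strand u, w}"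
    using other_strand[OF x crossing_end_strand[OF u]] .
  obtain A B where AB: "\<And>v. crossing_end v \<and> strand v = w \<longleftrightarrow> v = (A, True) \<or> v = (B, False)"
    "end_dir L (B, False) = - end_dir L (A, True)" "pos L (end_point (A, True)) = ?x"
    by (rule strand_ends[OF x w(1)]) metis
  have A: "crossing_end (A, True)" "strand (A, True) = w" and B: "crossing_end (B, False)" "strand (B, False) = w"
    using AB(1) by blast+
  have px: "pos L (end_point (A, True)) = ?x" "pos L (end_point (B, False)) = ?x"
    using end_at_strand_pos A B w(1) by metis+
  have hw: "height L (end_point (A, True)) = height L w" "height L (end_point (B, False)) = height L w"
    using strand_height A B unfolding crossing_end_def by metis+
  have det: "det2 (end_dir L u) (end_dir L (B, False)) = - det2 (end_dir L u) (end_dir L (A, True))"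
    unfolding AB(2) by (simp add: det2_def)
  have 1: "linked S u (A, True) \<longleftrightarrow> (?x \<in> S \<longleftrightarrow> (det2 (end_dir L u) (end_dir L (A, True)) > 0 \<longleftrightarrow> height L w < height L (end_point u)))"
    "det2 (end_dir L u) (end_dir L (A, True)) \<noteq> 0"
    using linked_iff[OF u A(1) _ px(1)[symmetric]] A(2) w(2) hw(1) by metis+
  have 2: "linked S u (B, False) \<longleftrightarrow> (?x \<in> S \<longleftrightarrow> (det2 (end_dir L u) (end_dir L (B, False)) > 0 \<longleftrightarrow> height L w < height L (end_point u)))"
    using linked_iff(1)[OF u B(1) _ px(2)[symmetric]] B(2) w(2) hw(2) by metis
  have xor: "linked S u (A, True) \<longleftrightarrow> \<not> linked S u (B, False)"
    unfolding 1(1) 2 det using 1(2) by auto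
  have "v = (A, True) \<or> v = (B, False)" if "linked S u v" for v
  proof -
    note l = linked_strands[OF that]
    have "strand v \<in> {strand u, w}" using crossing_end_strand[OF l(2)] l(4) w(3) by simp
    then have "crossing_end v \<and> strand v = w" using l(2,3) by simp
    then show ?thesis by (rule iffD1[OF AB(1)])
  qed
  then show ?thesis using xor by metis
qed

text \<open>The successor of an arc on its circle along the source-sink orientation, which is the
  same for all resolutions. A component without crossings is a fixed point.\<close>

definition nxt :: "complex set \<Rightarrow> diagram_arc \<Rightarrow> diagram_arc" where
  "nxt S A = (if crossing_end (head A) then fst (THE v. linked S (head A) v) else A)"

lemma nxt_eqI: "linked S (head A) (tail B) \<Longrightarrow> nxt S A = B"
  using the1_equality[OF linked_unique] linked_strands(1) unfolding nxt_def by (metis fst_tail)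

lemma nxt_linked:
  assumes "crossing_end (head A)" shows "linked S (head A) (tail (nxt S A))"
proof -
  obtain v where v: "linked S (head A) v" using linked_unique[OF assms] by blast
  have "flow (head A) = -1" using flow_head[of "head A"] by simp
  then have "flow v = 1" using linked_strands(5)[OF v] by simp
  then have "v = tail (fst v)" by (simp add: flow_tail)
  then show ?thesis using v nxt_eqI by metis
qed

lemma nxt_closed: "\<not> crossing_end (head A) \<Longrightarrow> nxt S A = A"
  by (simp add: nxt_def)

lemma finite_arcs: "finite (arcs L)"
proof -
  let ?X = "{A \<in> arcs L. crossing_end (A, True)}"
  have "(\<lambda>A. strand (A, True)) ` ?X \<subseteq> (\<Union>x\<in>crossings L. strand_points L x)"
    using crossing_end_strand unfolding crossing_end_def by blast
  then have "finite ((\<lambda>A. strand (A, True)) ` ?X)"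
    using finite_crossings finite_strand_points by (meson finite_UN_I finite_subset)
  moreover have "inj_on (\<lambda>A. strand (A, True)) ?X"
  proof (rule inj_onI)
    fix A B assume h: "A \<in> ?X" "B \<in> ?X" "strand (A, True) = strand (B, True)"
    obtain i a b j c d where AB: "A = (i, a, b)" "B = (j, c, d)" by (cases A; cases B)
    have ij: "i = j" and f: "frac a = frac c" using h(3) unfolding AB by (simp_all add: strand.simps)
    show "A = B" using initial_end_unique[OF _ _ f, of j b d] h(1,2) unfolding AB ij by blast
  qed
  ultimately have "finite ?X" using finite_image_iff by blast
  moreover have "arcs L \<subseteq> ?X \<union> (\<lambda>i. (i, 0, 1)) ` {..<length L}"
  proof
    fix A assume A: "A \<in> arcs L"
    then show "A \<in> ?X \<union> (\<lambda>i. (i, 0, 1)) ` {..<length L}"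
    proof (cases rule: arc_cases)
      case (crossed i a b)
      then have "crossing_end (A, True)" using A by (simp add: crossing_end_def crossing_params_def)
      then show ?thesis using A by blast
    qed auto
  qed
  ultimately show ?thesis by (meson finite_UnI finite_imageI finite_lessThan finite_subset)
qed

lemma nxt_perm: "finite_perm (arcs L) (nxt S)"
proof
  show "finite (arcs L)" by (rule finite_arcs)
  fix A assume A: "A \<in> arcs L"
  show "nxt S A \<in> arcs L"
  proof (cases "crossing_end (head A)")
    case True
    from linked_strands(2)[OF nxt_linked[OF True]] show ?thesis unfolding crossing_end_def by simp
  qed (use A in \<open>simp add: nxt_closed\<close>)
next
  show "inj_on (nxt S) (arcs L)"
  proof (rule inj_onI)
    fix A B assume eq: "nxt S A = nxt S B"
    have closed_iff: "crossing_end (head (nxt S C)) \<longleftrightarrow> crossing_end (head C)" for C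
      using nxt_closed linked_strands(2)[OF nxt_linked] crossing_end_tail by metis
    show "A = B"
    proof (cases "crossing_end (head A)")
      case True
      then have B: "crossing_end (head B)" using closed_iff eq by metis
      have "linked S (tail (nxt S A)) (head A)" by (rule linked_sym, rule nxt_linked[OF True])
      moreover have "linked S (tail (nxt S A)) (head B)" unfolding eq by (rule linked_sym, rule nxt_linked[OF B])
      moreover have "crossing_end (tail (nxt S A))" using linked_strands(2)[OF nxt_linked[OF True]] .
      ultimately have "head A = head B" using linked_unique by blast
      then show ?thesis by (metis fst_head)
    next
      case False
      then have "\<not> crossing_end (head B)" using closed_iff eq by metis
      then show ?thesis using False eq by (simp add: nxt_closed)
    qed
  qed
qed

lemma linked_cong: "pos L (end_point u) \<in> S \<longleftrightarrow> pos L (end_point u) \<in> S' \<Longrightarrow> linked S u v \<Longrightarrow> linked S' u v"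
  unfolding linked_def joined_def by auto

text \<open>\<open>a\<close> and \<open>b\<close> are the two arcs flowing into \<open>x\<close>.
  They end on one strand, so their directions are opposite, and changing the resolution exchanges
  their successors. They are chosen before \<open>S\<close>, because parallel edges of the cube must
  use the same pair.\<close>

lemma nxt_insert:
  assumes x: "x \<in> crossings L"
  obtains a b where "\<And>S. x \<notin> S \<Longrightarrow> swapped (arcs L) (nxt S) (nxt (insert x S)) a b"
proof -
  \<comment> \<open>The two strands have opposite flow, so one of them flows in at both of its
    ends.\<close>
  have "\<exists>w\<in>strand_points L x. \<forall>u. crossing_end u \<and> strand u = w \<longrightarrow> flow u = -1"
  proof -
    obtain v w where vw: "v \<in> strand_points L x" "w \<in> strand_points L x" "v \<noteq> w" using x unfolding crossings_def by blast
    have opp: "flow u = - flow u'" if "crossing_end u" "crossing_end u'" "strand u = v" "strand u' = w" for u u'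
      using that vw end_at_strand_pos[of u x] end_at_strand_pos[of u' x]
      by (intro flow_opposite_strands) (auto simp: crossing_end_def)
    obtain A B where AB: "\<And>u. crossing_end u \<and> strand u = v \<longleftrightarrow> u = (A, True) \<or> u = (B, False)"
      by (rule strand_ends[OF x vw(1)]) metis
    obtain A' B' where AB': "\<And>u. crossing_end u \<and> strand u = w \<longleftrightarrow> u = (A', True) \<or> u = (B', False)"
      by (rule strand_ends[OF x vw(2)]) metis
    have v': "crossing_end (A, True) \<and> strand (A, True) = v" and w': "crossing_end (A', True) \<and> strand (A', True) = w"
      using AB AB' by blast+
    show ?thesis
    proof (cases "flow (A, True) = -1")
      case True
      then have "flow (A', True) = 1" using opp v' w' by fastforce
      then have "flow u = -1" if "crossing_end u \<and> strand u = v" for u using opp[of u "(A', True)"] that w' by simp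
      then show ?thesis using vw by blast
    next
      case False
      then have "flow (A, True) = 1" using flow_cases[of "(A, True)"] by blast
      then have "flow u = -1" if "crossing_end u \<and> strand u = w" for u using opp[of "(A, True)" u] that v' by simp
      then show ?thesis using vw by blast
    qed
  qed
  then obtain w where w: "w \<in> strand_points L x" and fl: "\<And>u. crossing_end u \<Longrightarrow> strand u = w \<Longrightarrow> flow u = -1" by blast
  obtain A B where AB: "\<And>u. crossing_end u \<and> strand u = w \<longleftrightarrow> u = (A, True) \<or> u = (B, False)"
    "end_dir L (B, False) = - end_dir L (A, True)"
    by (rule strand_ends[OF x w]) metis
  have A: "crossing_end (A, True)" "strand (A, True) = w" and B: "crossing_end (B, False)" "strand (B, False) = w"
    using AB(1) by blast+
  have hA: "head A = (A, True)" and hB: "head B = (B, False)"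
    using fl[OF A] fl[OF B] flow_head[of "(A, True)"] flow_head[of "(B, False)"] by simp_all
  \<comment> \<open>One head is an initial end and the other a final end, while an arc has only one
    head.\<close>
  have ne: "A \<noteq> B" using hA hB by auto
  have arcs: "A \<in> arcs L" "B \<in> arcs L" using A B by (auto simp: crossing_end_def)
  have pos: "pos L (end_point (head A)) = x" "pos L (end_point (head B)) = x"
    unfolding hA hB using end_at_strand_pos A B w by metis+
  have dir: "end_dir L (head B) = - end_dir L (head A)" "end_dir L (head A) = - end_dir L (head B)"
    unfolding hA hB AB(2) by simp_all
  have ce: "crossing_end (head A)" "crossing_end (head B)" "strand (head A) = strand (head B)"
    unfolding hA hB using A B by simp_all
  \<comment> \<open>Reversing the direction and changing the resolution of \<open>x\<close> both
    toggle the condition of \<open>linked_iff\<close>, so their effects cancel.\<close>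
  have flip: "nxt (insert x S) C = nxt S D"
    if S: "x \<notin> S" and C: "crossing_end (head C)" "pos L (end_point (head C)) = x"
     and D: "crossing_end (head D)" "pos L (end_point (head D)) = x"
     and same: "strand (head C) = strand (head D)" and opp: "end_dir L (head D) = - end_dir L (head C)" for S C D
  proof -
    let ?t = "tail (nxt S D)"
    have l: "linked S (head D) ?t" by (rule nxt_linked[OF D(1)])
    note ls = linked_strands[OF l]
    have h: "height L (end_point (head C)) = height L (end_point (head D))"
      using strand_height same C D unfolding crossing_end_def by metis
    have det: "det2 (end_dir L (head D)) (end_dir L ?t) = - det2 (end_dir L (head C)) (end_dir L ?t)"
      unfolding opp by (simp add: det2_def)
    have "strand (head C) \<noteq> strand ?t" "pos L (end_point (head C)) = pos L (end_point ?t)"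
      using ls same C D by simp_all
    note lC = linked_iff[OF C(1) ls(2) this] and lD = linked_iff[OF D(1) ls(2,3,4)]
    have "linked (insert x S) (head C) ?t"
      using l S lC(2) unfolding lC(1) lD(1) C(2) D(2) det h by auto
    then show ?thesis by (rule nxt_eqI)
  qed
  show ?thesis
  proof (rule that[of A B])
    fix S assume S: "x \<notin> S"
    interpret f: finite_perm "arcs L" "nxt S" by (rule nxt_perm)
    interpret g: finite_perm "arcs L" "nxt (insert x S)" by (rule nxt_perm)
    show "swapped (arcs L) (nxt S) (nxt (insert x S)) A B"
    proof
      show "nxt (insert x S) A = nxt S B"
        using S ce pos dir by (intro flip) simp_all
      show "nxt (insert x S) B = nxt S A"
        using S ce pos dir by (intro flip) simp_all
      fix C assume C: "C \<in> arcs L" "C \<noteq> A" "C \<noteq> B"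
      show "nxt (insert x S) C = nxt S C"
      proof (cases "crossing_end (head C)")
        case True
        have off: "pos L (end_point (head C)) \<noteq> x"
        proof
          assume px: "pos L (end_point (head C)) = x"
          have "strand (head C) = w"
          proof (rule ccontr)
            assume "strand (head C) \<noteq> w"
            then have "flow (head C) = - flow (head A)"
              using px pos A hA True by (intro flow_opposite_strands) (simp_all add: crossing_end_def)
            then show False using flow_head[of "head C"] flow_head[of "head A"] by simp
          qed
          then have "crossing_end (head C) \<and> strand (head C) = w" using True by simp
          then have "head C = head A \<or> head C = head B" unfolding hA hB by (rule iffD1[OF AB(1)])
          then have "C = A \<or> C = B" unfolding head_def by (elim disjE) simp_all
          then show False using C by simp
        qed
        have "linked (insert x S) (head C) (tail (nxt S C))"
          by (rule linked_cong[OF _ nxt_linked[OF True]]) (simp add: off)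
        then show ?thesis by (rule nxt_eqI)
      qed (simp add: nxt_closed)
    qed (use arcs ne in auto)
  qed
qed

text \<open>Joined ends have opposite flow, hence one is a head and the other a tail. So joining
  relates an arc to its image or preimage under \<open>nxt S\<close>, and for a permutation of a
  finite set the generated equivalence classes are the cycles.\<close>

lemma circles_orbits: "circles L S = orbits (arcs L) (nxt S)"
proof -
  interpret p: finite_perm "arcs L" "nxt S" by (rule nxt_perm)
  let ?R = "\<lambda>A B. \<exists>e e'. joined L S (A, e) (B, e')"
  have link: "B = nxt S A \<or> A = nxt S B" if R: "?R A B" for A B
  proof -
    obtain e e' where j: "joined L S (A, e) (B, e')" using R by blast
    then have l: "linked S (A, e) (B, e')" "linked S (B, e') (A, e)" by (simp_all add: linked_def)
    have fl: "flow (A, e) = - flow (B, e')" by (rule joined_flow[OF j])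
    from flow_cases[of "(A, e)"] show ?thesis
    proof
      assume 1: "flow (A, e) = 1"
      then have "(A, e) = tail A" "(B, e') = head B" using fl flow_tail[of "(A, e)"] flow_head[of "(B, e')"] by auto
      then show ?thesis using nxt_eqI l(2) by metis
    next
      assume 1: "flow (A, e) = -1"
      then have "(A, e) = head A" "(B, e') = tail B" using fl flow_head[of "(A, e)"] flow_tail[of "(B, e')"] by auto
      then show ?thesis using nxt_eqI l(1) by metis
    qed
  qed
  have fwd: "equivclp ?R A (nxt S A)" for A
  proof (cases "crossing_end (head A)")
    case True
    have "?R A (nxt S A) \<or> ?R (nxt S A) A" using nxt_linked[OF True, of S] unfolding linked_def head_def tail_def by blast
    then show ?thesis using r_into_equivclp[of ?R] converse_r_into_equivclp[of ?R] by blast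
  qed (simp add: nxt_closed)
  have eq: "{B. B \<in> arcs L \<and> equivclp ?R A B} = cyc (nxt S) A" if A: "A \<in> arcs L" for A
  proof
    show "{B. B \<in> arcs L \<and> equivclp ?R A B} \<subseteq> cyc (nxt S) A"
    proof
      fix B assume "B \<in> {B. B \<in> arcs L \<and> equivclp ?R A B}"
      then have "equivclp ?R A B" by simp
      then show "B \<in> cyc (nxt S) A"
      proof (induction rule: equivclp_induct)
        case (step y z)
        then have yz: "y \<in> arcs L" "z \<in> arcs L" unfolding joined_def by auto
        have "z = nxt S y \<or> y = nxt S z" using step(2) link by blast
        then show ?case
        proof
          assume "z = nxt S y" then show ?thesis using step(3) cyc_step by metis
        next
          assume "y = nxt S z"
          then have "y \<in> cyc (nxt S) z" using cyc_step[OF cyc_self] by metis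
          then have "z \<in> cyc (nxt S) y" using p.cyc_sym yz by blast
          then show ?thesis using p.cyc_eq[OF A step(3)] by simp
        qed
      qed simp
    qed
    show "cyc (nxt S) A \<subseteq> {B. B \<in> arcs L \<and> equivclp ?R A B}"
    proof (rule cyc_minimal)
      show "A \<in> {B. B \<in> arcs L \<and> equivclp ?R A B}" using A by (simp add: equivclp_refl)
      fix y assume "y \<in> {B. B \<in> arcs L \<and> equivclp ?R A B}"
      then show "nxt S y \<in> {B. B \<in> arcs L \<and> equivclp ?R A B}"
        using p.maps[of y] equivclp_trans[OF _ fwd[of y]] by simp
    qed
  qed
  have "circles L S = (\<lambda>A. {B. B \<in> arcs L \<and> equivclp ?R A B}) ` arcs L"
    unfolding circles_def quotient_def by auto
  also have "\<dots> = orbits (arcs L) (nxt S)" unfolding orbits_def using eq by (intro image_cong refl)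
  finally show ?thesis .
qed

end


section \<open>Homology classes of circles\<close>

lemma exp_2pi_eq_1: "exp (2 * pi * \<i> * z) = 1 \<Longrightarrow> z \<in> \<int>"
proof -
  assume "exp (2 * pi * \<i> * z) = 1"
  then obtain n :: int where n: "Im z = 0" "- (2 * pi * Im z) = 0" "2 * pi * Re z = of_int (2 * n) * pi"
    unfolding exp_eq_1 by auto
  then have "Re z = of_int n" by simp
  then have "z = of_int n" using n by (simp add: complex_eq_iff)
  then show ?thesis by simp
qed

context link_diagram
begin

lemma punctures_off: "p \<in> P \<Longrightarrow> p \<notin> diagram"
proof
  assume p: "p \<in> P" "p \<in> diagram"
  then obtain i t where it: "i < length L" "p = proj L i t" unfolding diagram_def by auto
  have "range (L ! i) \<subseteq> punctured_disk P \<times> {0..1}" using link it(1) unfolding is_link_def by auto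
  then have "(L ! i) t \<in> punctured_disk P \<times> {0..1}" by blast
  then have "fst ((L ! i) t) \<in> punctured_disk P" by (simp add: mem_Times_iff)
  then show False using p it by (simp add: proj_def punctured_disk_def)
qed

lemma arc_winding_exp:
  assumes A: "A \<in> arcs L" and p: "p \<notin> diagram"
  shows "exp (2 * pi * \<i> * (of_int (arc_sign A) * winding_number (arc_path L A) p)) =
    (pos L (end_point (head A)) - p) / (pos L (end_point (tail A)) - p)"
proof -
  obtain i a b where ab: "A = (i, a, b)" by (cases A)
  have i: "i < length L" using A arc_length(1) ab by blast
  have "path (subpath a b (proj L i))"
    unfolding subpath_def path_def
    by (rule continuous_on_compose2[OF continuous_proj[OF i, of UNIV]]) (auto intro!: continuous_intros)
  moreover have "p \<notin> path_image (subpath a b (proj L i))"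
    using p i by (auto simp: path_image_def subpath_def diagram_def)
  ultimately have w: "proj L i b - p = exp (2 * pi * \<i> * winding_number (arc_path L A) p) * (proj L i a - p)"
    using winding_number_exp_2pi[of "subpath a b (proj L i)" p] by (simp add: ab pathstart_def pathfinish_def subpath_def)
  have ne: "proj L i a - p \<noteq> 0" "proj L i b - p \<noteq> 0" using p i by (auto simp: diagram_def)
  from arc_sign_cases[of A] show ?thesis
  proof
    assume "arc_sign A = 1"
    then show ?thesis using w ne by (simp add: ab head_def tail_def)
  next
    assume s: "arc_sign A = -1"
    have "exp (2 * pi * \<i> * (of_int (arc_sign A) * winding_number (arc_path L A) p)) =
      inverse (exp (2 * pi * \<i> * winding_number (arc_path L A) p))"
      unfolding s by (simp add: exp_minus)
    also have "\<dots> = (proj L i a - p) / (proj L i b - p)"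
      using w ne by (simp add: field_simps)
    finally show ?thesis using s by (simp add: ab head_def tail_def)
  qed
qed

lemma head_tail_nxt:
  assumes A: "A \<in> arcs L" shows "pos L (end_point (tail (nxt S A))) = pos L (end_point (head A))"
proof (cases "crossing_end (head A)")
  case True
  from linked_strands(4)[OF nxt_linked[OF True, of S]] show ?thesis by simp
next
  case False
  from A have "pos L (end_point (A, True)) = pos L (end_point (A, False))"
  proof (cases rule: arc_cases)
    case (crossed i a b)
    then have "crossing_end (A, True)" using A by (simp add: crossing_end_def crossing_params_def)
    then show ?thesis using False crossing_end_swap unfolding head_def by blast
  next
    case (closed i)
    then show ?thesis using proj_periodic[of i 0 1] by simp
  qed
  then have "pos L (end_point (A, e)) = pos L (end_point (A, e'))" for e e'
    by (cases e; cases e') simp_all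
  then show ?thesis unfolding nxt_closed[OF False] head_def tail_def by blast
qed

text \<open>The exponentials of the arcs of a circle telescope along the traversal \<open>nxt S\<close>.\<close>

lemma circle_winding_Ints:
  assumes C: "C \<in> circles L S" and p: "p \<notin> diagram"
  shows "circle_winding L C arc_sign p \<in> \<int>"
proof (rule exp_2pi_eq_1)
  interpret pm: finite_perm "arcs L" "nxt S" by (rule nxt_perm)
  obtain A0 where A0: "A0 \<in> arcs L" "C = cyc (nxt S) A0" using C unfolding circles_orbits orbits_def by blast
  have sub: "C \<subseteq> arcs L" using pm.cyc_subset A0 by simp
  then have fin: "finite C" using finite_arcs finite_subset by blast
  let ?h = "\<lambda>A. pos L (end_point (head A)) - p" and ?t = "\<lambda>A. pos L (end_point (tail A)) - p"
  have bij: "bij_betw (nxt S) C C" using pm.bij_betw_cyc A0 by simp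
  have "(\<Prod>A\<in>C. ?h A) = (\<Prod>A\<in>C. ?t (nxt S A))"
    using head_tail_nxt sub by (intro prod.cong) auto
  also have "\<dots> = (\<Prod>A\<in>C. ?t A)" by (rule prod.reindex_bij_betw[OF bij])
  finally have eq: "(\<Prod>A\<in>C. ?h A) = (\<Prod>A\<in>C. ?t A)" .
  have "?t A \<noteq> 0" if "A \<in> C" for A
  proof -
    have "A \<in> arcs L" using sub that by blast
    then have "fst (end_point (tail A)) < length L" using end_component[of "tail A"] by simp
    then have "pos L (end_point (tail A)) \<in> diagram"
      by (cases "end_point (tail A)") (auto simp: diagram_def)
    then show ?thesis using p by auto
  qed
  then have nz: "(\<Prod>A\<in>C. ?t A) \<noteq> 0" using fin by simp
  have "exp (2 * pi * \<i> * circle_winding L C arc_sign p) =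
     (\<Prod>A\<in>C. exp (2 * pi * \<i> * (of_int (arc_sign A) * winding_number (arc_path L A) p)))"
    unfolding circle_winding_def sum_distrib_left by (rule exp_sum[OF fin])
  also have "\<dots> = (\<Prod>A\<in>C. ?h A / ?t A)"
    using arc_winding_exp[OF _ p] sub by (intro prod.cong) auto
  also have "\<dots> = 1" using eq nz by (simp add: prod_dividef)
  finally show "exp (2 * pi * \<i> * circle_winding L C arc_sign p) = 1" .
qed

lemma arc_sign_orientation: "circle_orientation L S C arc_sign"
proof -
  have "arc_sign A * end_sign (A, e) = - (arc_sign B * end_sign (B, e'))" if "joined L S (A, e) (B, e')" for A B e e'
    using joined_flow[OF that] by simp
  then show ?thesis using arc_sign_cases unfolding circle_orientation_def by blast
qed

lemma minus_arc_sign_orientation: "circle_orientation L S C (\<lambda>A. - arc_sign A)"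
proof -
  have "- arc_sign A * end_sign (A, e) = - (- arc_sign B * end_sign (B, e'))" if "joined L S (A, e) (B, e')" for A B e e'
    using joined_flow[OF that] by simp
  moreover have "- arc_sign A \<in> {1, -1}" for A using arc_sign_cases[of A] by auto
  ultimately show ?thesis unfolding circle_orientation_def by blast
qed

text \<open>The condition at a joined pair determines the sign of \<open>nxt S A\<close> from that
  of \<open>A\<close>, so one arc fixes the signs on its whole cycle.\<close>

lemma orientation_unique:
  assumes C: "C \<in> circles L S" and ori: "circle_orientation L S C ori"
  obtains c where "c = 1 \<or> c = (-1::int)" "\<And>A. A \<in> C \<Longrightarrow> ori A = c * arc_sign A"
proof -
  interpret pm: finite_perm "arcs L" "nxt S" by (rule nxt_perm)
  obtain A0 where A0: "A0 \<in> arcs L" "C = cyc (nxt S) A0" using C unfolding circles_orbits orbits_def by blast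
  define c where "c = ori A0 * arc_sign A0"
  have A0C: "A0 \<in> C" using A0 by simp
  have vals: "ori A = 1 \<or> ori A = -1" if "A \<in> C" for A using ori that unfolding circle_orientation_def by blast
  have c: "c = 1 \<or> c = -1" using vals[OF A0C] arc_sign_cases[of A0] unfolding c_def by auto
  have sq: "arc_sign A * arc_sign A = 1" for A using arc_sign_cases[of A] by auto
  have "C \<subseteq> {A \<in> C. ori A = c * arc_sign A}"
    unfolding A0(2)
  proof (rule cyc_minimal, unfold A0(2)[symmetric])
    show "A0 \<in> {A \<in> C. ori A = c * arc_sign A}" using A0C sq[of A0] by (simp add: c_def)
    fix A assume "A \<in> {A \<in> C. ori A = c * arc_sign A}"
    then have A: "A \<in> C" "ori A = c * arc_sign A" by auto
    have nA: "nxt S A \<in> C" using A(1) cyc_step unfolding A0(2) by metis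
    have "ori (nxt S A) = c * arc_sign (nxt S A)"
    proof (cases "crossing_end (head A)")
      case True
      have j: "joined L S (head A) (tail (nxt S A)) \<or> joined L S (tail (nxt S A)) (head A)"
        using nxt_linked[OF True, of S] by (simp add: linked_def)
      have "ori A * end_sign (head A) = - (ori (nxt S A) * end_sign (tail (nxt S A)))"
        using j ori A(1) nA unfolding circle_orientation_def head_def tail_def by fastforce
      moreover have "end_sign (head B) = - arc_sign B" "end_sign (tail B) = arc_sign B" for B
        using arc_sign_cases[of B] by (auto simp: head_def tail_def)
      ultimately have "ori A * arc_sign A = ori (nxt S A) * arc_sign (nxt S A)" by simp
      then have "ori (nxt S A) * arc_sign (nxt S A) = c" using A(2) sq[of A] by (simp add: mult.assoc)
      then show ?thesis using sq[of "nxt S A"] by (metis mult.assoc mult.right_neutral)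
    qed (use A in \<open>simp add: nxt_closed\<close>)
    then show "nxt S A \<in> {A \<in> C. ori A = c * arc_sign A}" using nA by simp
  qed
  then show ?thesis using c that by blast
qed

definition signed_class :: "complex \<Rightarrow> circle \<Rightarrow> int" where
  "signed_class p C = \<lfloor>Re (circle_winding L C arc_sign p)\<rfloor>"

lemma signed_class: "C \<in> circles L S \<Longrightarrow> p \<notin> diagram \<Longrightarrow> circle_winding L C arc_sign p = of_int (signed_class p C)"
  using circle_winding_Ints[of C S p] by (auto simp: signed_class_def elim!: Ints_cases)

text \<open>The two orientations of a circle have opposite winding numbers about \<open>p\<close>,
  and the description picks the nonnegative one. The set \<open>Q\<close> will be \<open>P\<close>
  or \<open>P'\<close>.\<close>

lemma circle_class_eq:
  assumes C: "C \<in> circles L S" and Q: "Q \<subseteq> P"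
  shows "circle_class Q L S C p = (if p \<in> Q then \<bar>signed_class p C\<bar> else 0)"
proof (cases "p \<in> Q")
  case True
  then have p: "p \<notin> diagram" using punctures_off Q by blast
  note n = signed_class[OF C p]
  have neg: "circle_winding L C (\<lambda>A. - arc_sign A) p = - circle_winding L C arc_sign p"
    by (simp add: circle_winding_def sum_negf)
  have "(THE k. 0 \<le> k \<and> (\<exists>ori. circle_orientation L S C ori \<and> of_int k = circle_winding L C ori p)) = \<bar>signed_class p C\<bar>"
  proof (rule the_equality)
    show "0 \<le> \<bar>signed_class p C\<bar> \<and> (\<exists>ori. circle_orientation L S C ori \<and> of_int \<bar>signed_class p C\<bar> = circle_winding L C ori p)"
    proof (cases "signed_class p C \<ge> 0")
      case True
      then show ?thesis using arc_sign_orientation n by (intro conjI exI[of _ arc_sign]) auto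
    next
      case False
      then show ?thesis using minus_arc_sign_orientation n neg by (intro conjI exI[of _ "\<lambda>A. - arc_sign A"]) auto
    qed
    fix k :: int assume k: "0 \<le> k \<and> (\<exists>ori. circle_orientation L S C ori \<and> of_int k = circle_winding L C ori p)"
    then obtain ori where ori: "circle_orientation L S C ori" "of_int k = circle_winding L C ori p" by blast
    obtain c where c: "c = 1 \<or> c = (-1::int)" "\<And>A. A \<in> C \<Longrightarrow> ori A = c * arc_sign A"
      using orientation_unique[OF C ori(1)] by blast
    have "circle_winding L C ori p = of_int c * circle_winding L C arc_sign p"
      unfolding circle_winding_def sum_distrib_left using c(2) by (intro sum.cong) auto
    then have "(of_int k :: complex) = of_int (c * signed_class p C)" using ori(2) n by simp
    then have "k = c * signed_class p C" by (simp only: of_int_eq_iff)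
    then show "k = \<bar>signed_class p C\<bar>" using c(1) k by auto
  qed
  then show ?thesis using True by (simp add: circle_class_def)
qed (simp add: circle_class_def)

text \<open>All circles of all resolutions are oriented by the same \<open>arc_sign\<close>, so the
  sum over the arcs of the union splits without changes of sign.\<close>

lemma signed_class_union:
  assumes "C \<in> circles L S" "D \<in> circles L S" "C \<inter> D = {}" "C \<union> D \<in> circles L S'" "p \<notin> diagram"
  shows "signed_class p (C \<union> D) = signed_class p C + signed_class p D"
proof -
  have sub: "B \<subseteq> arcs L" if "B \<in> circles L S" for B
    using that finite_perm.cyc_subset[OF nxt_perm] unfolding circles_orbits orbits_def by blast
  have "finite C" "finite D" using sub assms finite_arcs finite_subset by metis+
  then have "circle_winding L (C \<union> D) arc_sign p = circle_winding L C arc_sign p + circle_winding L D arc_sign p"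
    unfolding circle_winding_def using assms(3) by (intro sum.union_disjoint)
  then have "(of_int (signed_class p (C \<union> D)) :: complex) = of_int (signed_class p C + signed_class p D)"
    using assms signed_class by simp
  then show ?thesis by (simp only: of_int_eq_iff)
qed

end

text \<open>With \<open>w\<close> the absolute class about a puncture this is a coordinate of the
  puncture grading; with \<open>w\<close> constantly 1 it is the contribution of the labels to the
  quantum degree.\<close>

definition label_sum :: "'c set \<Rightarrow> 'c set \<Rightarrow> ('c \<Rightarrow> int) \<Rightarrow> int" where
  "label_sum Cs X w = (\<Sum>C\<in>Cs. (if C \<in> X then 1 else -1) * w C)"

context merging
begin

lemma label_sum_untouched: "X \<inter> untouched = X' \<inter> untouched \<Longrightarrow> label_sum untouched X w = label_sum untouched X' w"
  unfolding label_sum_def by (rule sum.cong) (auto split: if_splits)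

lemma label_sum_f: "label_sum (orbits E f) X w = label_sum untouched X w +
    (if cyc f a \<in> X then 1 else -1) * w (cyc f a) + (if cyc f b \<in> X then 1 else -1) * w (cyc f b)"
proof -
  have "orbits E f = insert (cyc f a) (insert (cyc f b) untouched)" unfolding orbits_f by blast
  then show ?thesis unfolding label_sum_def using finite_untouched not_untouched cyc_ne by simp
qed

lemma label_sum_g: "label_sum (orbits E g) X w = label_sum untouched X w + (if cyc g a \<in> X then 1 else -1) * w (cyc g a)"
proof -
  have "orbits E g = insert (cyc g a) untouched" unfolding orbits_g by blast
  then show ?thesis unfolding label_sum_def using finite_untouched not_untouched by simp
qed

text \<open>Each admissible labelling requires one triangle inequality: \<open>++\<close> to
  \<open>+\<close> needs the first, \<open>+-\<close> and \<open>-+\<close> to \<open>-\<close> need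
  the other two. All three hold when \<open>w\<close> is the absolute value of an additive
  quantity.\<close>

lemma merge_label_sum:
  assumes nz: "surgery_entry (orbits E f) (orbits E g) X X' \<noteq> 0"
  shows "w (cyc g a) \<le> w (cyc f a) + w (cyc f b) \<Longrightarrow> w (cyc f a) \<le> w (cyc g a) + w (cyc f b) \<Longrightarrow>
      w (cyc f b) \<le> w (cyc g a) + w (cyc f a) \<Longrightarrow> label_sum (orbits E g) X' w \<le> label_sum (orbits E f) X w"
    and "label_sum (orbits E g) X' (\<lambda>_. 1) = label_sum (orbits E f) X (\<lambda>_. 1) - 1"
proof -
  have U: "X \<inter> untouched = X' \<inter> untouched" and
    c: "cyc f a \<in> X \<and> cyc f b \<in> X \<and> cyc g a \<in> X' \<or> (cyc f a \<in> X \<longleftrightarrow> cyc f b \<notin> X) \<and> cyc g a \<notin> X'"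
    using nz unfolding merge_entry by (auto split: if_splits)
  note eqs = label_sum_f label_sum_g label_sum_untouched[OF U]
  show "label_sum (orbits E g) X' w \<le> label_sum (orbits E f) X w"
    if "w (cyc g a) \<le> w (cyc f a) + w (cyc f b)" "w (cyc f a) \<le> w (cyc g a) + w (cyc f b)" "w (cyc f b) \<le> w (cyc g a) + w (cyc f a)"
    unfolding eqs using c that by (cases "cyc f a \<in> X"; cases "cyc f b \<in> X"; cases "cyc g a \<in> X'"; simp)
  show "label_sum (orbits E g) X' (\<lambda>_. 1) = label_sum (orbits E f) X (\<lambda>_. 1) - 1"
    unfolding eqs using c by (cases "cyc f a \<in> X"; cases "cyc f b \<in> X"; cases "cyc g a \<in> X'"; simp)
qed

lemma split_label_sum:
  assumes nz: "surgery_entry (orbits E g) (orbits E f) X X' \<noteq> 0"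
  shows "w (cyc g a) \<le> w (cyc f a) + w (cyc f b) \<Longrightarrow> w (cyc f a) \<le> w (cyc g a) + w (cyc f b) \<Longrightarrow>
      w (cyc f b) \<le> w (cyc g a) + w (cyc f a) \<Longrightarrow> label_sum (orbits E f) X' w \<le> label_sum (orbits E g) X w"
    and "label_sum (orbits E f) X' (\<lambda>_. 1) = label_sum (orbits E g) X (\<lambda>_. 1) - 1"
proof -
  have U: "X \<inter> untouched = X' \<inter> untouched" and
    c: "cyc g a \<in> X \<and> (cyc f a \<in> X' \<longleftrightarrow> cyc f b \<notin> X') \<or> cyc g a \<notin> X \<and> cyc f a \<notin> X' \<and> cyc f b \<notin> X'"
    using nz unfolding split_entry by (auto split: if_splits)
  note eqs = label_sum_f label_sum_g label_sum_untouched[OF U]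
  show "label_sum (orbits E f) X' w \<le> label_sum (orbits E g) X w"
    if "w (cyc g a) \<le> w (cyc f a) + w (cyc f b)" "w (cyc f a) \<le> w (cyc g a) + w (cyc f b)" "w (cyc f b) \<le> w (cyc g a) + w (cyc f a)"
    unfolding eqs using c that by (cases "cyc f a \<in> X'"; cases "cyc f b \<in> X'"; cases "cyc g a \<in> X"; simp)
  show "label_sum (orbits E f) X' (\<lambda>_. 1) = label_sum (orbits E g) X (\<lambda>_. 1) - 1"
    unfolding eqs using c by (cases "cyc f a \<in> X'"; cases "cyc f b \<in> X'"; cases "cyc g a \<in> X"; simp)
qed

end

lemma edge_entry_surgery: "edge_entry L (S, X) (S', X') = surgery_entry (circles L S) (circles L S') X X'"
  by (simp add: surgery_entry_def Let_def)

context link_diagram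
begin

lemma edge_label_sum:
  assumes x: "x \<in> crossings L" "x \<notin> S" and nz: "edge_entry L (S, X) (insert x S, X') \<noteq> 0"
  shows "p \<notin> diagram \<Longrightarrow> label_sum (circles L (insert x S)) X' (\<lambda>C. \<bar>signed_class p C\<bar>) \<le> label_sum (circles L S) X (\<lambda>C. \<bar>signed_class p C\<bar>)"
    and "label_sum (circles L (insert x S)) X' (\<lambda>_. 1) = label_sum (circles L S) X (\<lambda>_. 1) - 1"
proof -
  let ?w = "\<lambda>p C. \<bar>signed_class p C\<bar>"
  let ?f = "nxt S" and ?g = "nxt (insert x S)"
  obtain a b where "\<And>S. x \<notin> S \<Longrightarrow> swapped (arcs L) (nxt S) (nxt (insert x S)) a b" using nxt_insert[OF x(1)] by blast
  then interpret sw: swapped "arcs L" ?f ?g a b using x(2) by blast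
  have nz': "surgery_entry (orbits (arcs L) ?f) (orbits (arcs L) ?g) X X' \<noteq> 0"
    using nz unfolding edge_entry_surgery circles_orbits .
  have orb: "cyc (nxt S) c \<in> circles L S" if "c \<in> arcs L" for c S using that unfolding circles_orbits orbits_def by blast
  have tri: "?w p (C \<union> D) \<le> ?w p C + ?w p D \<and> ?w p C \<le> ?w p (C \<union> D) + ?w p D \<and> ?w p D \<le> ?w p (C \<union> D) + ?w p C"
    if "C \<in> circles L S" "D \<in> circles L S" "C \<inter> D = {}" "C \<union> D \<in> circles L S'" "p \<notin> diagram" for C D S S' p
    using signed_class_union[OF that] by linarith
  have "(p \<notin> diagram \<longrightarrow> label_sum (circles L (insert x S)) X' (?w p) \<le> label_sum (circles L S) X (?w p))
    \<and> label_sum (circles L (insert x S)) X' (\<lambda>_. 1) = label_sum (circles L S) X (\<lambda>_. 1) - 1" for p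
  proof (cases "b \<in> cyc ?f a")
    case False
    interpret m: merging "arcs L" ?f ?g a b by (rule sw.mergingI[OF False])
    have "cyc ?f a \<union> cyc ?f b \<in> circles L (insert x S)" unfolding m.merged(1)[symmetric] by (rule orb[OF sw.ab(1)])
    note t = tri[OF orb[OF sw.ab(1)] orb[OF sw.ab(2)] m.cyc_disjoint this, of p]
    show ?thesis unfolding circles_orbits
      using m.merge_label_sum(1)[OF nz', of "?w p"] m.merge_label_sum(2)[OF nz'] t unfolding m.merged(1) by blast
  next
    case True
    interpret m: merging "arcs L" ?g ?f a b by (rule sw.splittingI[OF True])
    have "cyc ?g a \<union> cyc ?g b \<in> circles L S" unfolding m.merged(1)[symmetric] by (rule orb[OF sw.ab(1)])
    note t = tri[OF orb[OF sw.ab(1)] orb[OF sw.ab(2)] m.cyc_disjoint this, of p]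
    show ?thesis unfolding circles_orbits
      using m.split_label_sum(1)[OF nz', of "?w p"] m.split_label_sum(2)[OF nz'] t unfolding m.merged(1) by blast
  qed
  then show "p \<notin> diagram \<Longrightarrow> label_sum (circles L (insert x S)) X' (?w p) \<le> label_sum (circles L S) X (?w p)"
    "label_sum (circles L (insert x S)) X' (\<lambda>_. 1) = label_sum (circles L S) X (\<lambda>_. 1) - 1" by blast+
qed

lemma state_class_label_sum:
  "Q \<subseteq> P \<Longrightarrow> state_class Q L (S, X) p = (if p \<in> Q then label_sum (circles L S) X (\<lambda>C. \<bar>signed_class p C\<bar>) else 0)"
  by (auto simp: state_class_def label_sum_def circle_class_eq intro!: sum.cong)

end


section \<open>The Khovanov differential\<close>

lemma surgery_indicator:
  assumes "finite E" "X \<subseteq> orbits E f"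
  shows "surgery E f g (\<lambda>X'. of_bool (X' = X)) Z = surgery_entry (orbits E f) (orbits E g) X Z"
proof -
  have "finite (Pow (orbits E f))" using assms(1) by (simp add: orbits_def)
  moreover have "surgery E f g (\<lambda>X'. of_bool (X' = X)) Z =
    (\<Sum>X'\<in>Pow (orbits E f). if X' = X then surgery_entry (orbits E f) (orbits E g) X Z else 0)"
    unfolding surgery_def by (intro sum.cong) auto
  ultimately show ?thesis using assms(2) by (simp add: sum.delta)
qed

lemma diff_entry_nonzero:
  assumes "diff_entry cs L x y \<noteq> 0"
  obtains c where "c \<in> set cs" "c \<notin> fst x" "fst y = insert c (fst x)" "edge_entry L x y \<noteq> 0"
proof -
  obtain j where "j \<in> {..<length cs}" "(if cs ! j \<notin> fst x \<and> fst y = insert (cs ! j) (fst x)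
      then (-1) ^ card {i. i < j \<and> cs ! i \<in> fst x} * edge_entry L x y else 0) \<noteq> 0"
    using assms unfolding diff_entry_def by (rule sum.not_neutral_contains_not_neutral)
  then show ?thesis by (intro that[of "cs ! j"]) (auto split: if_splits)
qed

lemma diff_entry_insert:
  assumes "distinct cs" "j < length cs" "cs ! j \<notin> S"
  shows "diff_entry cs L (S, X) (insert (cs ! j) S, Y) =
    (-1) ^ card {i. i < j \<and> cs ! i \<in> S} * edge_entry L (S, X) (insert (cs ! j) S, Y)"
proof -
  let ?T = "\<lambda>j. (-1) ^ card {i. i < j \<and> cs ! i \<in> S} * edge_entry L (S, X) (insert (cs ! j) S, Y)"
  have "cs ! j' \<notin> S \<and> insert (cs ! j) S = insert (cs ! j') S \<longleftrightarrow> j' = j" if "j' < length cs" for j'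
    using assms that by (metis insert_ident insertCI insertE nth_eq_iff_index_eq)
  then have "diff_entry cs L (S, X) (insert (cs ! j) S, Y) = (\<Sum>j'<length cs. if j' = j then ?T j else 0)"
    unfolding diff_entry_def by (intro sum.cong) auto
  also have "\<dots> = ?T j" using assms(2) by (simp add: sum.delta)
  finally show ?thesis .
qed

context link_diagram
begin

lemma finite_circles: "finite (circles L S)"
  unfolding circles_orbits orbits_def using finite_arcs by blast

lemma finite_enhanced_states: "finite (enhanced_states L)"
proof -
  have "enhanced_states L = Sigma (Pow (crossings L)) (\<lambda>S. Pow (circles L S))"
    unfolding enhanced_states_def by auto
  then show ?thesis using finite_crossings finite_circles by simp
qed

text \<open>In the quantum degree the sum of the labels drops by one, which the additional
  1-resolution compensates.\<close>

lemma diff_entry_degrees: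
  assumes cs: "set cs = crossings L" and x: "x \<in> enhanced_states L" and y: "y \<in> enhanced_states L" and nz: "diff_entry cs L x y \<noteq> 0"
  shows "hdeg L y = hdeg L x + 1" "qdeg L y = qdeg L x" "Q \<subseteq> P \<Longrightarrow> state_class Q L y \<le> state_class Q L x"
proof -
  obtain S X T Y where xy: "x = (S, X)" "y = (T, Y)" by (cases x; cases y)
  obtain c where c: "c \<in> crossings L" "c \<notin> S" "T = insert c S" "edge_entry L (S, X) (insert c S, Y) \<noteq> 0"
    using diff_entry_nonzero[OF nz] cs unfolding xy by (metis fst_conv)
  have "finite S" using x finite_crossings finite_subset unfolding xy enhanced_states_def by auto
  then have card: "card T = card S + 1" using c by simp
  then show "hdeg L y = hdeg L x + 1" by (simp add: hdeg_def xy)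
  have q: "qdeg L (S, X) = label_sum (circles L S) X (\<lambda>_. 1) + int (card S) - n_minus L + writhe L" for S X
    by (simp add: qdeg_def label_sum_def)
  show "qdeg L y = qdeg L x" unfolding xy q using edge_label_sum(2)[OF c(1,2,4)] card c(3) by simp
  assume Q: "Q \<subseteq> P"
  show "state_class Q L y \<le> state_class Q L x"
    unfolding xy c(3) using edge_label_sum(1)[OF c(1,2,4)] punctures_off Q
    by (auto simp: le_fun_def state_class_label_sum[OF Q])
qed

text \<open>The starting basis vector is written as a monomial, and parallel edges of the face are
  surgeries at the same pair of arcs, as \<open>surgery_square\<close> demands.\<close>

lemma face_commutes:
  assumes u: "u \<in> crossings L" "u \<notin> S" and v: "v \<in> crossings L" "v \<notin> S" and ne: "u \<noteq> v"
    and X: "X \<subseteq> circles L S" and Y: "Y \<subseteq> circles L (insert v (insert u S))"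
  shows "(\<Sum>Z\<in>Pow (circles L (insert u S)). edge_entry L (S, X) (insert u S, Z) * edge_entry L (insert u S, Z) (insert v (insert u S), Y))
    = (\<Sum>Z\<in>Pow (circles L (insert v S)). edge_entry L (S, X) (insert v S, Z) * edge_entry L (insert v S, Z) (insert v (insert u S), Y))"
proof -
  let ?E = "arcs L" and ?T = "insert v (insert u S)"
  obtain a b where ab: "\<And>S. u \<notin> S \<Longrightarrow> swapped ?E (nxt S) (nxt (insert u S)) a b" using nxt_insert[OF u(1)] by blast
  obtain c d where cd: "\<And>S. v \<notin> S \<Longrightarrow> swapped ?E (nxt S) (nxt (insert v S)) c d" using nxt_insert[OF v(1)] by blast
  obtain l where l: "set l \<subseteq> ?E" "\<And>X'. monomial ?E (nxt S) l X' = of_bool (X' = X)"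
    using monomial_indicator[OF nxt_perm] X unfolding circles_orbits by metis
  have m: "monomial ?E (nxt S) l = (\<lambda>X'. of_bool (X' = X))" using l(2) by blast
  have comp: "(\<Sum>Z\<in>Pow (circles L S'). edge_entry L (S, X) (S', Z) * edge_entry L (S', Z) (?T, Y))
     = surgery ?E (nxt S') (nxt ?T) (surgery ?E (nxt S) (nxt S') (monomial ?E (nxt S) l)) Y" for S'
    unfolding m surgery_def[of ?E "nxt S'" "nxt ?T"] surgery_indicator[OF finite_arcs X[unfolded circles_orbits]]
    by (simp only: edge_entry_surgery circles_orbits)
  have T: "?T = insert u (insert v S)" by (rule insert_commute)
  have 1: "swapped ?E (nxt (insert v S)) (nxt ?T) a b" unfolding T using ab[of "insert v S"] u ne by simp
  have 2: "swapped ?E (nxt (insert u S)) (nxt ?T) c d" using cd[of "insert u S"] v ne by simp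
  show ?thesis unfolding comp
    by (rule surgery_square[OF ab[OF u(2)] 2 cd[OF v(2)] 1 l(1)]) (use Y in \<open>simp add: circles_orbits\<close>)
qed

text \<open>A nonzero term requires the states to differ in two crossings, and then the intermediate
  generators form two families, one for each order. Without signs their sums agree by
  \<open>face_commutes\<close>, and the signs are opposite.\<close>

lemma diff_entry_square:
  assumes d: "distinct cs" and cs: "set cs = crossings L" and x: "x \<in> enhanced_states L" and y: "y \<in> enhanced_states L"
  shows "(\<Sum>z\<in>enhanced_states L. diff_entry cs L x z * diff_entry cs L z y) = 0"
proof -
  obtain S X T Y where xy: "x = (S, X)" "y = (T, Y)" by (cases x; cases y)
  have S: "S \<subseteq> crossings L" "X \<subseteq> circles L S" and T: "T \<subseteq> crossings L" "Y \<subseteq> circles L T"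
    using x y unfolding xy enhanced_states_def by auto
  let ?t = "\<lambda>z. diff_entry cs L x z * diff_entry cs L z y"
  have path: "\<exists>c c'. c \<in> set cs \<and> c' \<in> set cs \<and> c \<notin> S \<and> c' \<notin> S \<and> c \<noteq> c' \<and> fst z = insert c S \<and> T = insert c' (insert c S)"
    if nz: "?t z \<noteq> 0" for z
  proof -
    have 1: "diff_entry cs L x z \<noteq> 0" and 2: "diff_entry cs L z y \<noteq> 0" using nz by auto
    obtain c where c: "c \<in> set cs" "c \<notin> S" "fst z = insert c S" using diff_entry_nonzero[OF 1] unfolding xy by (metis fst_conv)
    obtain c' where c': "c' \<in> set cs" "c' \<notin> fst z" "T = insert c' (fst z)" using diff_entry_nonzero[OF 2] unfolding xy by (metis fst_conv)
    show ?thesis using c c' by auto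
  qed
  show ?thesis
  proof (cases "\<exists>z. ?t z \<noteq> 0")
    case False
    then show ?thesis by (intro sum.neutral) blast
  next
    case True
    then obtain c c' where cc: "c \<in> set cs" "c' \<in> set cs" "c \<notin> S" "c' \<notin> S" "c \<noteq> c'" "T = insert c' (insert c S)"
      using path by blast
    obtain i i' where ii: "i < length cs" "cs ! i = c" "i' < length cs" "cs ! i' = c'" using cc by (metis in_set_conv_nth)
    \<comment> \<open>Arranged so that \<open>u = cs ! j\<close> comes before
      \<open>v = cs ! k\<close>, since the signs are not symmetric in the two crossings.\<close>
    have "\<exists>j k. j < k \<and> k < length cs \<and> (cs ! j = c \<and> cs ! k = c' \<or> cs ! j = c' \<and> cs ! k = c)"
    proof (cases "i < i'")
      case True then show ?thesis using ii by blast
    next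
      case False
      then have "i' < i" using ii cc(5) by (metis linorder_neqE_nat)
      then show ?thesis using ii by blast
    qed
    then obtain j k where jk: "j < k" "k < length cs" and eq: "cs ! j = c \<and> cs ! k = c' \<or> cs ! j = c' \<and> cs ! k = c" by blast
    define u v where "u = cs ! j" and "v = cs ! k"
    have c2: "u = c \<and> v = c' \<or> u = c' \<and> v = c" using eq by (simp add: u_def v_def)
    have uv: "u \<in> crossings L" "v \<in> crossings L" "u \<notin> S" "v \<notin> S" "u \<noteq> v"
      using c2 cc(1-5) cs by (elim disjE; simp)+
    have uvT: "T = insert v (insert u S)" using c2 cc(6) by (elim disjE) (simp_all add: insert_commute)
    note uv = uv uvT
    define A where "A w = (\<lambda>Z. (insert w S, Z)) ` Pow (circles L (insert w S))" for w
    have sub: "A w \<subseteq> enhanced_states L" if "w \<in> crossings L" for w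
      using that S unfolding A_def enhanced_states_def by auto
    have "u \<notin> insert v S" using uv(3,5) by simp
    then have ne: "insert u S \<noteq> insert v S" by blast
    have disj: "A u \<inter> A v = {}" unfolding A_def using ne by auto
    have zero: "?t z = 0" if z: "z \<in> enhanced_states L - (A u \<union> A v)" for z
    proof (rule ccontr)
      assume "?t z \<noteq> 0"
      then obtain e e' where e: "e \<notin> S" "fst z = insert e S" "T = insert e' (insert e S)" using path by blast
      then have "e = u \<or> e = v" using uv by blast
      moreover have "snd z \<subseteq> circles L (fst z)" using z unfolding enhanced_states_def by auto
      ultimately have "z \<in> A u \<union> A v" unfolding A_def using e(2) by (cases z) auto
      then show False using z by blast
    qed
    have finA: "finite (A w)" for w unfolding A_def using finite_circles by simp
    have union: "(\<Sum>z\<in>enhanced_states L. ?t z) = (\<Sum>z\<in>A u. ?t z) + (\<Sum>z\<in>A v. ?t z)"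
    proof -
      have "(\<Sum>z\<in>enhanced_states L. ?t z) = (\<Sum>z\<in>A u \<union> A v. ?t z)"
        using sub[OF uv(1)] sub[OF uv(2)] zero by (intro sum.mono_neutral_right finite_enhanced_states) blast+
      then show ?thesis using sum.union_disjoint[OF finA finA disj, of ?t] by simp
    qed
    have A_sum: "(\<Sum>z\<in>A w. ?t z) = (\<Sum>Z\<in>Pow (circles L (insert w S)). ?t (insert w S, Z))" for w
      unfolding A_def by (subst sum.reindex) (simp_all add: inj_on_def)
    define s where "s m R = ((-1) ^ card {i. i < m \<and> cs ! i \<in> R} :: rat)" for m R
    note entry = diff_entry_insert[OF d, folded s_def]
    have T2: "T = insert u (insert v S)" unfolding uv(6) by (rule insert_commute)
    have jl: "j < length cs" using jk by simp
    have du: "diff_entry cs L x (insert u S, Z) = s j S * edge_entry L (S, X) (insert u S, Z)" for Z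
      unfolding xy u_def by (rule entry[OF jl]) (use uv(3) in \<open>simp add: u_def\<close>)
    have dv: "diff_entry cs L x (insert v S, Z) = s k S * edge_entry L (S, X) (insert v S, Z)" for Z
      unfolding xy v_def by (rule entry[OF jk(2)]) (use uv(4) in \<open>simp add: v_def\<close>)
    have duv: "diff_entry cs L (insert u S, Z) y = s k (insert u S) * edge_entry L (insert u S, Z) (T, Y)" for Z
      unfolding xy uv(6) v_def by (rule entry[OF jk(2)]) (use uv(4,5) in \<open>simp add: v_def\<close>)
    have dvu: "diff_entry cs L (insert v S, Z) y = s j (insert v S) * edge_entry L (insert v S, Z) (T, Y)" for Z
      unfolding xy T2 u_def by (rule entry[OF jl]) (use uv(3,5) in \<open>simp add: u_def\<close>)
    let ?c = "\<lambda>w. \<Sum>Z\<in>Pow (circles L (insert w S)). edge_entry L (S, X) (insert w S, Z) * edge_entry L (insert w S, Z) (T, Y)"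
    have Au: "(\<Sum>z\<in>A u. ?t z) = (s j S * s k (insert u S)) * ?c u"
      unfolding A_sum du duv sum_distrib_left by (rule sum.cong[OF refl]) (simp only: mult_ac)
    have Av: "(\<Sum>z\<in>A v. ?t z) = (s k S * s j (insert v S)) * ?c v"
      unfolding A_sum dv dvu sum_distrib_left by (rule sum.cong[OF refl]) (simp only: mult_ac)
    have c: "?c u = ?c v"
      using face_commutes[OF uv(1,3,2,4,5) S(2) T(2)[unfolded uv(6)], folded uv(6)] .
    \<comment> \<open>If \<open>u\<close> is changed first, it is counted among the crossings before
      \<open>v\<close>; changing \<open>v\<close> first does not affect the sign belonging to
      \<open>u\<close>.\<close>
    have sk: "s k (insert u S) = - s k S"
    proof -
      have "{i. i < k \<and> cs ! i \<in> insert u S} = insert j {i. i < k \<and> cs ! i \<in> S}"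
        using jk d by (auto simp: u_def nth_eq_iff_index_eq)
      moreover have "j \<notin> {i. i < k \<and> cs ! i \<in> S}" using uv(3) by (simp add: u_def)
      ultimately show ?thesis by (simp add: s_def)
    qed
    have sj: "s j (insert v S) = s j S"
    proof -
      have "{i. i < j \<and> cs ! i \<in> insert v S} = {i. i < j \<and> cs ! i \<in> S}"
        using jk d by (auto simp: v_def nth_eq_iff_index_eq)
      then show ?thesis by (simp add: s_def)
    qed
    show ?thesis unfolding union Au Av c sk sj by (simp add: mult.commute)
  qed
qed

lemma CKh_diff_square:
  assumes "distinct cs" "set cs = crossings L"
  shows "CKh_diff cs L (CKh_diff cs L f) = 0"
proof
  fix y
  let ?X = "enhanced_states L"
  show "CKh_diff cs L (CKh_diff cs L f) y = 0 y"
  proof (cases "y \<in> ?X")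
    case True
    have "CKh_diff cs L (CKh_diff cs L f) y = (\<Sum>z\<in>?X. (\<Sum>x\<in>?X. f x * diff_entry cs L x z) * diff_entry cs L z y)"
      using True by (simp add: CKh_diff_def)
    also have "\<dots> = (\<Sum>z\<in>?X. \<Sum>x\<in>?X. f x * (diff_entry cs L x z * diff_entry cs L z y))"
      by (simp add: sum_distrib_right mult.assoc)
    also have "\<dots> = (\<Sum>x\<in>?X. f x * (\<Sum>z\<in>?X. diff_entry cs L x z * diff_entry cs L z y))"
      by (subst sum.swap) (simp add: sum_distrib_left)
    also have "\<dots> = 0" using diff_entry_square[OF assms _ True] by (intro sum.neutral) simp
    finally show ?thesis by simp
  qed (simp add: CKh_diff_def)
qed

end


section \<open>The spectral sequence of a filtered complex\<close>

lemma qv_subspaceI: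
  assumes "0 \<in> V" "\<And>f g. f \<in> V \<Longrightarrow> g \<in> V \<Longrightarrow> f + g \<in> V" "\<And>c f. f \<in> V \<Longrightarrow> qscale c f \<in> V"
  shows "qv.subspace V"
  using assms unfolding qv.subspace_def by blast

lemma qv_linear_id: "Vector_Spaces.linear qscale qscale (\<lambda>f. f)"
  by (simp add: Vector_Spaces.linear_iff qv.vector_space_axioms)

locale filtered_complex =
  fixes D :: "('y \<Rightarrow> rat) \<Rightarrow> 'y \<Rightarrow> rat" and F :: "int \<Rightarrow> int \<Rightarrow> int \<Rightarrow> ('y \<Rightarrow> rat) set" and lo hi :: int
  assumes linear: "Vector_Spaces.linear qscale qscale D"
    and sub: "\<And>k h q. qv.subspace (F k h q)"
    and mono: "\<And>k k' h q. k \<le> k' \<Longrightarrow> F k h q \<subseteq> F k' h q"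
    and D_D: "\<And>k h q f. f \<in> F k h q \<Longrightarrow> D (D f) = 0"
    and below: "\<And>k h q. k < lo \<Longrightarrow> F k h q = {0}"
    and above: "\<And>k h q. hi \<le> k \<Longrightarrow> F k h q = F hi h q"
begin

lemma D_add: "D (f + g) = D f + D g" and D_scale: "D (qscale c f) = qscale c (D f)"
  using linear by (auto simp: Vector_Spaces.linear_iff)

lemma D_zero: "D 0 = 0"
  using D_add[of 0 0] by simp

lemma D_diff: "D (f - g) = D f - D g"
  using D_add[of "f - g" g] by (simp add: algebra_simps)

lemma F_zero: "0 \<in> F k h q" and F_add: "f \<in> F k h q \<Longrightarrow> g \<in> F k h q \<Longrightarrow> f + g \<in> F k h q"
  and F_diff: "f \<in> F k h q \<Longrightarrow> g \<in> F k h q \<Longrightarrow> f - g \<in> F k h q"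
  and F_scale: "f \<in> F k h q \<Longrightarrow> qscale c f \<in> F k h q"
  using qv.subspace_0[OF sub] qv.subspace_add[OF sub] qv.subspace_diff[OF sub] qv.subspace_scale[OF sub] by blast+

lemma F_mono: "f \<in> F k h q \<Longrightarrow> k \<le> k' \<Longrightarrow> f \<in> F k' h q"
  using mono by blast

text \<open>The usual \<open>Z_r^k\<close> is \<open>Z k (k - r)\<close>. The level of the image is
  a separate index because numerators and denominators of the pages combine the levels
  differently.\<close>

definition Z :: "int \<Rightarrow> int \<Rightarrow> int \<Rightarrow> int \<Rightarrow> ('y \<Rightarrow> rat) set" where
  "Z k l h q = {f \<in> F k h q. D f \<in> F l (h + 1) q}"

definition B :: "int \<Rightarrow> int \<Rightarrow> int \<Rightarrow> int \<Rightarrow> ('y \<Rightarrow> rat) set" where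
  "B r k h q = {f + D u | f u. f \<in> Z (k - 1) (k - r) h q \<and> u \<in> Z (k + r - 1) k (h - 1) q}"

text \<open>\<open>E\<^sub>r = Z\<^sub>r\<^sup>k / (Z\<^sub>r\<^sub>-\<^sub>1\<^sup>k\<^sup>-\<^sup>1 + D Z\<^sub>r\<^sub>-\<^sub>1\<^sup>k\<^sup>+\<^sup>r\<^sup>-\<^sup>1)\<close>; unlike with \<open>F (k - 1)\<close> added to both parts, \<open>D\<close> itself
  represents all the page differentials.\<close>

definition page :: "'y pages" where
  "page r k h q = (Z k (k - int r) h q, B (int r) k h q)"

lemma Z_subspace: "qv.subspace (Z k l h q)"
  by (rule qv_subspaceI) (auto simp: Z_def F_zero F_add F_scale D_zero D_add D_scale)

lemma Z_add: "f \<in> Z k l h q \<Longrightarrow> g \<in> Z k l h q \<Longrightarrow> f + g \<in> Z k l h q"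
  and Z_diff: "f \<in> Z k l h q \<Longrightarrow> g \<in> Z k l h q \<Longrightarrow> f - g \<in> Z k l h q"
  and Z_zero: "0 \<in> Z k l h q"
  using Z_subspace qv.subspace_add qv.subspace_diff qv.subspace_0 by blast+

lemma Z_mono: "f \<in> Z k l h q \<Longrightarrow> k \<le> k' \<Longrightarrow> l \<le> l' \<Longrightarrow> f \<in> Z k' l' h q"
  using F_mono by (auto simp: Z_def)

lemma D_Z: "f \<in> Z k l (h - 1) q \<Longrightarrow> D f \<in> Z l l' h q"
  using D_D F_zero by (auto simp: Z_def)

lemma B_subspace: "qv.subspace (B r k h q)"
proof (rule qv_subspaceI)
  show "0 \<in> B r k h q" unfolding B_def using Z_zero D_zero by force
  fix f g assume "f \<in> B r k h q" "g \<in> B r k h q"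
  then obtain f1 u1 f2 u2 where h: "f = f1 + D u1" "g = f2 + D u2" "f1 \<in> Z (k - 1) (k - r) h q" "u1 \<in> Z (k + r - 1) k (h - 1) q"
    "f2 \<in> Z (k - 1) (k - r) h q" "u2 \<in> Z (k + r - 1) k (h - 1) q" unfolding B_def by auto
  have "f + g = (f1 + f2) + D (u1 + u2)" unfolding h D_add by simp
  then show "f + g \<in> B r k h q" unfolding B_def using Z_add h by blast
next
  fix c f assume "f \<in> B r k h q"
  then obtain f1 u1 where h: "f = f1 + D u1" "f1 \<in> Z (k - 1) (k - r) h q" "u1 \<in> Z (k + r - 1) k (h - 1) q"
    unfolding B_def by auto
  have "qscale c f = qscale c f1 + D (qscale c u1)" unfolding h D_scale by (simp add: qv.scale_right_distrib)
  then show "qscale c f \<in> B r k h q" unfolding B_def using h qv.subspace_scale[OF Z_subspace] by blast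
qed

lemma B_I: "f \<in> Z (k - 1) (k - r) h q \<Longrightarrow> f \<in> B r k h q"
  and B_D: "u \<in> Z (k + r - 1) k (h - 1) q \<Longrightarrow> D u \<in> B r k h q"
  unfolding B_def using Z_zero D_zero by force+

lemma B_E:
  assumes "g \<in> B r k h q"
  obtains f u where "g = f + D u" "f \<in> Z (k - 1) (k - r) h q" "u \<in> Z (k + r - 1) k (h - 1) q"
  using assms unfolding B_def by blast

lemma B_add: "f \<in> B r k h q \<Longrightarrow> g \<in> B r k h q \<Longrightarrow> f + g \<in> B r k h q"
  using B_subspace qv.subspace_add by blast

lemma B_subset_Z: "B r k h q \<subseteq> Z k (k - r) h q"
proof
  fix g assume "g \<in> B r k h q"
  then obtain f u where g: "g = f + D u" "f \<in> Z (k - 1) (k - r) h q" "u \<in> Z (k + r - 1) k (h - 1) q" by (rule B_E)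
  show "g \<in> Z k (k - r) h q" unfolding g(1) using Z_mono[OF g(2)] D_Z[OF g(3)] by (intro Z_add) auto
qed

lemma D_page:
  "f \<in> Z k (k - r) h q \<Longrightarrow> D f \<in> Z (k - r) l (h + 1) q"
  "f \<in> B r k h q \<Longrightarrow> D f \<in> B r (k - r) (h + 1) q"
proof -
  show "f \<in> Z k (k - r) h q \<Longrightarrow> D f \<in> Z (k - r) l (h + 1) q" using D_Z[of f k "k - r" "h + 1" q l] by simp
  assume "f \<in> B r k h q"
  then obtain g u where g: "f = g + D u" "g \<in> Z (k - 1) (k - r) h q" "u \<in> Z (k + r - 1) k (h - 1) q" by (rule B_E)
  have "D f = D g" unfolding g(1) D_add using g(3) D_D by (auto simp: Z_def)
  then show "D f \<in> B r (k - r) (h + 1) q" using B_D[of g "k - r" r "h + 1" q] g(2) by simp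
qed

text \<open>The identity of the ambient space induces the isomorphism; only the subspaces change
  from one page to the next.\<close>

lemma page_homology:
  assumes r: "r \<ge> 1"
  shows "page (Suc r) k h q \<cong>\<^sub>q homology D D (page r (k + int r) (h - 1) q) (page r k h q) (page r (k - int r) (h + 1) q)"
proof -
  let ?r = "int r"
  have cyc: "fst (homology D D (page r (k + ?r) (h - 1) q) (page r k h q) (page r (k - ?r) (h + 1) q)) = {y \<in> Z k (k - ?r) h q. D y \<in> B ?r (k - ?r) (h + 1) q}"
    by (simp add: homology_def cycles_def page_def)
  have bd: "snd (homology D D (page r (k + ?r) (h - 1) q) (page r k h q) (page r (k - ?r) (h + 1) q)) = {D x + b | x b. x \<in> Z (k + ?r) k (h - 1) q \<and> b \<in> B ?r k h q}"
    by (simp add: homology_def boundaries_def page_def)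
  have pg: "fst (page (Suc r) k h q) = Z k (k - ?r - 1) h q" "snd (page (Suc r) k h q) = B (?r + 1) k h q"
    by (simp_all add: page_def algebra_simps)
  show ?thesis
    unfolding subquot_iso_def subquot_map_def cyc bd pg
  proof (intro exI[of _ "\<lambda>f. f"] conjI ballI impI)
    show "(\<lambda>f. f) ` Z k (k - ?r - 1) h q \<subseteq> {y \<in> Z k (k - ?r) h q. D y \<in> B ?r (k - ?r) (h + 1) q}"
    proof clarsimp
      fix f assume f: "f \<in> Z k (k - ?r - 1) h q"
      have "D f \<in> Z (k - ?r - 1) (k - ?r - ?r) (h + 1) q"
        using D_page(1)[of f k "?r + 1" h q] f by (simp add: algebra_simps)
      then show "f \<in> Z k (k - ?r) h q \<and> D f \<in> B ?r (k - ?r) (h + 1) q" using Z_mono[OF f] by (auto intro: B_I)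
    qed
    show "(\<lambda>f. f) ` B (?r + 1) k h q \<subseteq> {D x + b | x b. x \<in> Z (k + ?r) k (h - 1) q \<and> b \<in> B ?r k h q}"
    proof clarsimp
      fix f assume "f \<in> B (?r + 1) k h q"
      then obtain g u where g: "f = g + D u" "g \<in> Z (k - 1) (k - (?r + 1)) h q" "u \<in> Z (k + (?r + 1) - 1) k (h - 1) q" by (rule B_E)
      have "g \<in> Z (k - 1) (k - ?r) h q" using Z_mono[OF g(2)] by simp
      then have "g \<in> B ?r k h q" by (rule B_I)
      moreover have "u \<in> Z (k + ?r) k (h - 1) q" using g(3) by (simp add: algebra_simps)
      ultimately show "\<exists>x b. f = D x + b \<and> x \<in> Z (k + ?r) k (h - 1) q \<and> b \<in> B ?r k h q"
        using g(1) by (metis add.commute)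
    qed
    fix x assume x: "x \<in> Z k (k - ?r - 1) h q" and "x \<in> {D x + b | x b. x \<in> Z (k + ?r) k (h - 1) q \<and> b \<in> B ?r k h q}"
    then obtain u b where u: "x = D u + b" "u \<in> Z (k + ?r) k (h - 1) q" "b \<in> B ?r k h q" by blast
    obtain g w where g: "b = g + D w" "g \<in> Z (k - 1) (k - ?r) h q" "w \<in> Z (k + ?r - 1) k (h - 1) q" using u(3) by (rule B_E)
    have xg: "x = g + D (u + w)" unfolding u(1) g(1) D_add by simp
    have uw: "u + w \<in> Z (k + ?r) k (h - 1) q" using u(2) Z_mono[OF g(3)] by (intro Z_add) auto
    have "D (D (u + w)) = 0" using uw unfolding Z_def by (intro D_D) blast
    then have "D g = D x" unfolding xg D_add[of g] by simp
    \<comment> \<open>\<open>D g = D x\<close> lies one level deeper than the choice of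
      \<open>g\<close> alone guarantees.\<close>
    then have "g \<in> Z (k - 1) (k - (?r + 1)) h q" using g(2) x by (simp add: Z_def algebra_simps)
    moreover have "u + w \<in> Z (k + (?r + 1) - 1) k (h - 1) q" using uw by (simp add: algebra_simps)
    ultimately show "x \<in> B (?r + 1) k h q" unfolding xg using B_I B_D B_add by blast
  next
    fix y assume "y \<in> {y \<in> Z k (k - ?r) h q. D y \<in> B ?r (k - ?r) (h + 1) q}"
    then have y: "y \<in> Z k (k - ?r) h q" "D y \<in> B ?r (k - ?r) (h + 1) q" by auto
    obtain g u where g: "D y = g + D u" "g \<in> Z (k - ?r - 1) (k - ?r - ?r) (h + 1) q" "u \<in> Z (k - ?r + ?r - 1) (k - ?r) (h + 1 - 1) q"
      using y(2) by (rule B_E)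
    have u: "u \<in> Z (k - 1) (k - ?r) h q" using g(3) by simp
    \<comment> \<open>The part \<open>D u\<close> of the boundary \<open>D y\<close> is removed by
      subtracting \<open>u\<close>, which vanishes on the page because it lies one level
      lower.\<close>
    have "D (y - u) = g" unfolding D_diff g(1) by simp
    moreover have "y - u \<in> Z k (k - ?r) h q" using y(1) Z_mono[OF u] by (intro Z_diff) auto
    ultimately have "y - u \<in> Z k (k - ?r - 1) h q" using g(2) by (simp add: Z_def)
    moreover have "y - (y - u) = D 0 + u" by (simp add: D_zero)
    ultimately show "\<exists>x\<in>Z k (k - ?r - 1) h q. y - x \<in> {D x + b | x b. x \<in> Z (k + ?r) k (h - 1) q \<and> b \<in> B ?r k h q}"
      using Z_zero B_I[OF u] by blast
  qed (rule qv_linear_id)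
qed

lemma spectral_sequence_page: "spectral_sequence page (\<lambda>r k h q. D)"
  unfolding spectral_sequence_def
proof (intro allI impI conjI)
  fix r :: nat and k h q :: int assume r: "r \<ge> 1"
  show "is_subquot (page r k h q)"
    using Z_subspace B_subspace B_subset_Z by (simp add: is_subquot_def page_def)
  show "subquot_map D (page r k h q) (page r (k - int r) (h + 1) q)"
    unfolding subquot_map_def page_def
    using linear D_page(1)[of _ k "int r" h q] D_page(2)[of _ "int r" k h q] by auto
  show "\<forall>x\<in>fst (page r k h q). D (D x) \<in> snd (page r (k - int r - int r) (h + 1 + 1) q)"
    using D_D qv.subspace_0[OF B_subspace] by (auto simp: page_def Z_def)
  show "page (Suc r) k h q \<cong>\<^sub>q homology D D (page r (k + int r) (h - 1) q) (page r k h q) (page r (k - int r) (h + 1) q)"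
    by (rule page_homology[OF r])
qed

text \<open>The filtration is bounded: eventually the outgoing differentials end below
  \<open>lo\<close>, and the sources of the incoming ones are the whole complex once their level
  reaches \<open>hi\<close>.\<close>

lemma page_stable:
  obtains R where "R \<ge> 1"
    "\<And>r. r \<ge> R \<Longrightarrow> D ` fst (page r k h q) \<subseteq> snd (page r (k - int r) (h + 1) q)
            \<and> D ` fst (page r (k + int r) (h - 1) q) \<subseteq> snd (page r k h q)"
    "fst (page R k h q) = {f \<in> F k h q. D f = 0}"
    "snd (page R k h q) = {f + D u | f u. f \<in> F (k - 1) h q \<and> D f = 0 \<and> u \<in> F hi (h - 1) q \<and> D u \<in> F k h q}"
proof -
  \<comment> \<open>Large enough for \<open>k - R < lo\<close> and
    \<open>hi \<le> k + R - 1\<close>; the latter is the level from which the denominator takes its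
    boundaries.\<close>
  define R where "R = nat (\<bar>k - lo\<bar> + \<bar>hi - k\<bar> + 2)"
  have R: "R \<ge> 1" "k - int r < lo" "hi \<le> k + int r - 1" "hi \<le> k + int r" if "r \<ge> R" for r using that unfolding R_def by linarith+
  have low: "F (k - int r) (h + 1) q = {0}" if "r \<ge> R" for r using below R(2)[OF that] by blast
  have high: "F (k + int r - 1) (h - 1) q = F hi (h - 1) q" "F (k + int r) (h - 1) q = F hi (h - 1) q" if "r \<ge> R" for r
    using above R(3,4)[OF that] by blast+
  show ?thesis
  proof (rule that[of R])
    show "R \<ge> 1" using R(1) by blast
    fix r assume r: "r \<ge> R"
    have "D f = 0" if "f \<in> fst (page r k h q)" for f using that low[OF r] by (simp add: page_def Z_def)
    moreover have "0 \<in> snd (page r (k - int r) (h + 1) q)" using qv.subspace_0[OF B_subspace] by (simp add: page_def)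
    moreover have "D f \<in> snd (page r k h q)" if "f \<in> fst (page r (k + int r) (h - 1) q)" for f
      using that high[OF r] B_D[of f k "int r" h q] by (simp add: page_def Z_def)
    ultimately show "D ` fst (page r k h q) \<subseteq> snd (page r (k - int r) (h + 1) q)
            \<and> D ` fst (page r (k + int r) (h - 1) q) \<subseteq> snd (page r k h q)" by auto
  next
    show "fst (page R k h q) = {f \<in> F k h q. D f = 0}" using low[of R] by (simp add: page_def Z_def)
    show "snd (page R k h q) = {f + D u | f u. f \<in> F (k - 1) h q \<and> D f = 0 \<and> u \<in> F hi (h - 1) q \<and> D u \<in> F k h q}"
      using low[of R] high[of R] by (auto simp: page_def B_def Z_def)
  qed
qed

end


section \<open>The filtered associated graded complex\<close>

lemma sum_fun_apply: "finite A \<Longrightarrow> (\<Sum>i\<in>A. f i) y = (\<Sum>i\<in>A. f i y)"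
  by (induction A rule: finite_induct) auto

lemma support_finite_add:
  fixes f g :: "'a \<times> 'b \<Rightarrow> rat"
  assumes "finite {a. \<exists>x. f (a, x) \<noteq> 0}" "finite {a. \<exists>x. g (a, x) \<noteq> 0}"
  shows "finite {a. \<exists>x. (f + g) (a, x) \<noteq> 0}"
proof (rule finite_subset[OF _ finite_UnI[OF assms]])
  show "{a. \<exists>x. (f + g) (a, x) \<noteq> 0} \<subseteq> {a. \<exists>x. f (a, x) \<noteq> 0} \<union> {a. \<exists>x. g (a, x) \<noteq> 0}"
    by (auto simp: plus_fun_def)
qed

lemma support_cases:
  fixes f g :: "'a \<Rightarrow> rat"
  shows "(f + g) x \<noteq> 0 \<Longrightarrow> f x \<noteq> 0 \<or> g x \<noteq> 0" and "qscale c f x \<noteq> 0 \<Longrightarrow> f x \<noteq> 0"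
  by (auto simp: plus_fun_def qscale_def)

locale khovanov = link_diagram +
  fixes P' :: "complex set" and cs :: "complex list"
  assumes finite_punctures: "finite P" and sub: "P' \<subseteq> P"
    and distinct: "distinct cs" and set_cs: "set cs = crossings L"
begin

declare split_paired_All [simp del] split_paired_Ex [simp del]

abbreviation ES where "ES \<equiv> enhanced_states L"
abbreviation cl where "cl Q x \<equiv> state_class Q L x"
abbreviation dd where "dd \<equiv> diff_entry cs L"
abbreviation gd where "gd \<equiv> gr_diff cs L"

text \<open>With \<open>R\<close> equal to \<le> or < this is the numerator or the denominator of
  the associated graded sum, so that both share their linear algebra. The finiteness condition comes
  from the direct sum over degrees.\<close>

definition gr_space :: "((complex \<Rightarrow> int) \<Rightarrow> (complex \<Rightarrow> int) \<Rightarrow> bool) \<Rightarrow> complex set \<Rightarrow> (complex \<Rightarrow> int) set \<Rightarrow>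
    int \<Rightarrow> int \<Rightarrow> ((complex \<Rightarrow> int) \<times> enhanced_state \<Rightarrow> rat) set" where
  "gr_space R Q I h q = {g. (\<forall>a x. g (a, x) \<noteq> 0 \<longrightarrow> a \<in> I \<and> x \<in> ES \<and> hdeg L x = h \<and> qdeg L x = q \<and> R (cl Q x) a)
     \<and> finite {a. \<exists>x. g (a, x) \<noteq> 0}}"

abbreviation GV where "GV \<equiv> gr_space (\<le>)"
abbreviation GL where "GL \<equiv> gr_space (<)"

lemma gr_space_D: "g \<in> gr_space R Q I h q \<Longrightarrow> g (a, x) \<noteq> 0 \<Longrightarrow> a \<in> I \<and> x \<in> ES \<and> hdeg L x = h \<and> qdeg L x = q \<and> R (cl Q x) a"
  and gr_space_fin: "g \<in> gr_space R Q I h q \<Longrightarrow> finite {a. \<exists>x. g (a, x) \<noteq> 0}"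
  unfolding gr_space_def by blast+

lemmas GV_D = gr_space_D[of _ "(\<le>)"] and GL_D = gr_space_D[of _ "(<)"]

lemma gr_space_subspace: "qv.subspace (gr_space R Q I h q)"
proof (rule qv_subspaceI)
  show "0 \<in> gr_space R Q I h q" by (simp add: gr_space_def)
  fix f g assume "f \<in> gr_space R Q I h q" "g \<in> gr_space R Q I h q"
  then show "f + g \<in> gr_space R Q I h q"
    using support_finite_add[of f g] support_cases(1)[of f g] unfolding gr_space_def by blast
next
  fix c f assume f: "f \<in> gr_space R Q I h q"
  have "{a. \<exists>x. qscale c f (a, x) \<noteq> 0} \<subseteq> {a. \<exists>x. f (a, x) \<noteq> 0}" using support_cases(2)[of c f] by blast
  then have "finite {a. \<exists>x. qscale c f (a, x) \<noteq> 0}" using gr_space_fin[OF f] finite_subset by blast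
  then show "qscale c f \<in> gr_space R Q I h q" using f support_cases(2)[of c f] unfolding gr_space_def by blast
qed

lemmas gr_space_add = qv.subspace_add[OF gr_space_subspace] and gr_space_zero = qv.subspace_0[OF gr_space_subspace]
  and gr_space_neg = qv.subspace_neg[OF gr_space_subspace]

lemma class_lattice: "cl Q x \<in> lattice Q"
  by (auto simp: lattice_def state_class_def circle_class_def)

lemma fst_gr_CKh: "fst (gr_CKh Q I L h q) = GV Q I h q"
proof -
  have "f \<in> direct_sum_space I (puncture_filtration Q L h q) \<longleftrightarrow> f \<in> GV Q I h q" for f
    unfolding direct_sum_space_def gr_space_def puncture_filtration_def CKh_def by blast
  then show ?thesis unfolding gr_CKh_def direct_sum_def assoc_gr_def by auto
qed

text \<open>A generator lies in the filtration level of its own class, so a function supported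
  strictly below \<open>a\<close> is the sum of its parts on single generators, each from a lower
  level.\<close>

lemma span_lower:
  assumes a: "a \<in> lattice Q"
  shows "qv.span (\<Union>b\<in>{b \<in> lattice Q. b < a}. puncture_filtration Q L h q b)
    = {f \<in> CKh L h q. \<forall>x. f x \<noteq> 0 \<longrightarrow> cl Q x < a}" (is "qv.span ?U = ?R")
proof
  have "qv.subspace ?R"
  proof (rule qv_subspaceI)
    show "0 \<in> ?R" by (simp add: CKh_def)
    fix f g assume "f \<in> ?R" "g \<in> ?R"
    then show "f + g \<in> ?R" using support_cases(1)[of f g] unfolding CKh_def by blast
  next
    fix c f assume "f \<in> ?R"
    then show "qscale c f \<in> ?R" using support_cases(2)[of c f] unfolding CKh_def by blast
  qed
  moreover have "?U \<subseteq> ?R" unfolding puncture_filtration_def using le_less_trans by blast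
  ultimately show "qv.span ?U \<subseteq> ?R" by (intro qv.span_minimal)
  show "?R \<subseteq> qv.span ?U"
  proof
    fix f assume f: "f \<in> ?R"
    let ?e = "\<lambda>x y. if y = x then f x else 0"
    have "?e x \<in> qv.span ?U" for x
    proof (cases "f x = 0")
      case True
      then have "?e x = 0" by auto
      then show ?thesis using qv.span_zero by simp
    next
      case False
      then have "?e x \<in> puncture_filtration Q L h q (cl Q x)" "cl Q x < a"
        using f unfolding puncture_filtration_def CKh_def by auto
      then show ?thesis using class_lattice by (intro qv.span_base) blast
    qed
    then have "(\<Sum>x\<in>ES. ?e x) \<in> qv.span ?U" by (intro qv.span_sum)
    moreover have "(\<Sum>x\<in>ES. ?e x) = f"
    proof
      fix y
      show "(\<Sum>x\<in>ES. ?e x) y = f y"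
        using f finite_enhanced_states unfolding CKh_def by (auto simp: sum_fun_apply)
    qed
    ultimately show "f \<in> qv.span ?U" by simp
  qed
qed

lemma snd_gr_CKh:
  assumes "I \<subseteq> lattice Q" shows "snd (gr_CKh Q I L h q) = GL Q I h q"
proof -
  have "f \<in> direct_sum_space I (\<lambda>a. qv.span (\<Union>b\<in>{b \<in> lattice Q. b < a}. puncture_filtration Q L h q b)) \<longleftrightarrow> f \<in> GL Q I h q" for f
  proof -
    have "(\<forall>i\<in>I. (\<lambda>x. f (i, x)) \<in> qv.span (\<Union>b\<in>{b \<in> lattice Q. b < i}. puncture_filtration Q L h q b))
       \<longleftrightarrow> (\<forall>i\<in>I. \<forall>x. f (i, x) \<noteq> 0 \<longrightarrow> x \<in> ES \<and> hdeg L x = h \<and> qdeg L x = q \<and> cl Q x < i)"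
      using span_lower assms by (intro ball_cong refl) (auto simp: CKh_def subset_iff)
    then show ?thesis unfolding direct_sum_space_def gr_space_def by blast
  qed
  then show ?thesis unfolding gr_CKh_def direct_sum_def assoc_gr_def by auto
qed

lemma gd_apply: "gd g (a, y) = (if y \<in> ES then \<Sum>x\<in>ES. g (a, x) * dd x y else 0)"
  by (simp add: gr_diff_def componentwise_def CKh_diff_def)

lemma gd_add: "gd (f + g) = gd f + gd g"
  by (rule ext, case_tac x) (simp add: gd_apply distrib_right sum.distrib)

lemma gd_scale: "gd (qscale c f) = qscale c (gd f)"
  by (rule ext, case_tac x) (simp add: gd_apply qscale_def sum_distrib_left mult.assoc)

lemma gd_gd: "gd (gd g) = 0"
proof
  fix z :: "(complex \<Rightarrow> int) \<times> enhanced_state"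
  have "CKh_diff cs L (CKh_diff cs L (\<lambda>x. g (fst z, x))) (snd z) = 0"
    using CKh_diff_square[OF distinct set_cs] by simp
  then show "gd (gd g) z = 0 z"
    by (cases z) (simp add: gr_diff_def componentwise_def)
qed

lemma gd_nonzero:
  assumes "gd g (a, y) \<noteq> 0"
  obtains x where "x \<in> ES" "y \<in> ES" "g (a, x) \<noteq> 0" "dd x y \<noteq> 0"
    "hdeg L y = hdeg L x + 1" "qdeg L y = qdeg L x" "\<And>Q. Q \<subseteq> P \<Longrightarrow> cl Q y \<le> cl Q x"
proof -
  have y: "y \<in> ES" using assms by (simp add: gd_apply split: if_splits)
  then have "(\<Sum>x\<in>ES. g (a, x) * dd x y) \<noteq> 0" using assms by (simp add: gd_apply)
  then obtain x where x: "x \<in> ES" "g (a, x) * dd x y \<noteq> 0" by (rule sum.not_neutral_contains_not_neutral)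
  then have "dd x y \<noteq> 0" by simp
  from diff_entry_degrees[OF set_cs x(1) y this] show ?thesis using x y by (intro that[of x]) auto
qed

lemma gd_fin: "finite {a. \<exists>x. g (a, x) \<noteq> 0} \<Longrightarrow> finite {a. \<exists>x. gd g (a, x) \<noteq> 0}"
  by (rule finite_subset) (auto elim: gd_nonzero)

lemma gd_gr_space:
  assumes g: "g \<in> gr_space R Q I h q" and Q: "Q \<subseteq> P" and R: "\<And>a b c. a \<le> b \<Longrightarrow> R b c \<Longrightarrow> R a c"
  shows "gd g \<in> gr_space R Q I (h + 1) q"
proof -
  have "a \<in> I \<and> y \<in> ES \<and> hdeg L y = h + 1 \<and> qdeg L y = q \<and> R (cl Q y) a" if nz: "gd g (a, y) \<noteq> 0" for a y
  proof -
    from nz obtain x where x: "x \<in> ES" "y \<in> ES" "g (a, x) \<noteq> 0"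
      "hdeg L y = hdeg L x + 1" "qdeg L y = qdeg L x" "\<And>Q. Q \<subseteq> P \<Longrightarrow> cl Q y \<le> cl Q x" by (rule gd_nonzero) blast
    then show ?thesis using gr_space_D[OF g x(3)] R[OF x(6)[OF Q], of a] by simp
  qed
  then show ?thesis using gd_fin[OF gr_space_fin[OF g]] unfolding gr_space_def by blast
qed

lemma gd_GV: "g \<in> GV Q I h q \<Longrightarrow> Q \<subseteq> P \<Longrightarrow> gd g \<in> GV Q I (h + 1) q"
  and gd_GL: "g \<in> GL Q I h q \<Longrightarrow> Q \<subseteq> P \<Longrightarrow> gd g \<in> GL Q I (h + 1) q"
  by (erule gd_gr_space; auto)+

lemma fst_MKh_on: "I \<subseteq> lattice Q \<Longrightarrow> fst (MKh_on Q I cs L h q) = {g \<in> GV Q I h q. gd g \<in> GL Q I (h + 1) q}"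
  by (simp add: MKh_on_def homology_def cycles_def fst_gr_CKh snd_gr_CKh)

lemma snd_MKh_on: "I \<subseteq> lattice Q \<Longrightarrow> snd (MKh_on Q I cs L h q) = {gd u + b | u b. u \<in> GV Q I (h - 1) q \<and> b \<in> GL Q I h q}"
  by (simp add: MKh_on_def homology_def boundaries_def fst_gr_CKh snd_gr_CKh)

text \<open>\<open>diag Q\<close> picks the normal form of an element of \<open>gr\<close>: each generator in its own degree.\<close>

definition diag :: "complex set \<Rightarrow> ((complex \<Rightarrow> int) \<times> enhanced_state \<Rightarrow> rat) \<Rightarrow> (complex \<Rightarrow> int) \<times> enhanced_state \<Rightarrow> rat" where
  "diag Q g = (\<lambda>(a, x). if x \<in> ES \<and> a = cl Q x then g (a, x) else 0)"

lemma diag_apply: "diag Q g (a, x) = (if x \<in> ES \<and> a = cl Q x then g (a, x) else 0)"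
  by (simp add: diag_def)

lemma diag_add: "diag Q (f + g) = diag Q f + diag Q g"
  and diag_scale: "diag Q (qscale c f) = qscale c (diag Q f)"
  by (auto simp: diag_def qscale_def fun_eq_iff)

lemma diag_GL: "g \<in> GL Q I h q \<Longrightarrow> diag Q g = 0"
proof
  fix z :: "(complex \<Rightarrow> int) \<times> enhanced_state" assume g: "g \<in> GL Q I h q"
  obtain a x where z: "z = (a, x)" by (cases z)
  show "diag Q g z = 0 z" using GL_D[OF g, of a x] by (auto simp: z diag_apply)
qed

lemma diag_zero: "diag Q 0 = 0"
  using diag_add[of Q 0 0] by simp

lemma diag_fin: "finite {a. \<exists>x. diag Q g (a, x) \<noteq> 0}"
proof (rule finite_subset)
  show "{a. \<exists>x. diag Q g (a, x) \<noteq> 0} \<subseteq> cl Q ` ES" by (auto simp: diag_apply split: if_splits)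
qed (simp add: finite_enhanced_states)

text \<open>An entry outside the normal form has a class that is at most its degree and different
  from it, hence strictly below.\<close>

lemma diff_diag_GL:
  assumes g: "g \<in> GV Q I h q" shows "g - diag Q g \<in> GL Q I h q"
proof -
  have 1: "g (a, x) \<noteq> 0 \<and> a \<noteq> cl Q x" if "(g - diag Q g) (a, x) \<noteq> 0" for a x
    using that GV_D[OF g, of a x] by (auto simp: diag_apply split: if_splits)
  have "finite {a. \<exists>x. (g - diag Q g) (a, x) \<noteq> 0}"
    by (rule finite_subset[OF _ gr_space_fin[OF g]]) (use 1 in blast)
  moreover have "a \<in> I \<and> x \<in> ES \<and> hdeg L x = h \<and> qdeg L x = q \<and> cl Q x < a" if "(g - diag Q g) (a, x) \<noteq> 0" for a x
    using GV_D[OF g, of a x] 1[OF that] by (auto simp: order.strict_iff_order)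
  ultimately show ?thesis unfolding gr_space_def by blast
qed

lemma GL_iff_diag: "g \<in> GV Q I h q \<Longrightarrow> g \<in> GL Q I h q \<longleftrightarrow> diag Q g = 0"
  using diag_GL diff_diag_GL by fastforce

text \<open>\<open>gd\<close> preserves the denominator \<open>GL\<close>, which
  \<open>diag Q\<close> annihilates, so the differential may be computed on normal forms.\<close>

lemma diag_gd_diag:
  assumes g: "g \<in> GV Q I h q" and Q: "Q \<subseteq> P" shows "diag Q (gd (diag Q g)) = diag Q (gd g)"
proof -
  have "gd g = gd (diag Q g) + gd (g - diag Q g)" unfolding gd_add[symmetric] by simp
  then have "diag Q (gd g) = diag Q (gd (diag Q g)) + diag Q (gd (g - diag Q g))" by (simp only: diag_add)
  then show ?thesis using diag_GL[OF gd_GL[OF diff_diag_GL[OF g] Q]] by simp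
qed

section \<open>The filtered complex of normal forms\<close>

abbreviation deg where "deg x \<equiv> coord_sum P (cl P x)"

text \<open>The differential of the quotient complex for \<open>P'\<close>, transported to normal
  forms, where it is an honest linear map of functions.\<close>

definition D :: "((complex \<Rightarrow> int) \<times> enhanced_state \<Rightarrow> rat) \<Rightarrow> (complex \<Rightarrow> int) \<times> enhanced_state \<Rightarrow> rat" where
  "D f = diag P' (gd f)"

definition F :: "int \<Rightarrow> int \<Rightarrow> int \<Rightarrow> ((complex \<Rightarrow> int) \<times> enhanced_state \<Rightarrow> rat) set" where
  "F k h q = {f. \<forall>a x. f (a, x) \<noteq> 0 \<longrightarrow> x \<in> ES \<and> hdeg L x = h \<and> qdeg L x = q \<and> a = cl P' x \<and> deg x \<le> k}"

lemma F_D: "f \<in> F k h q \<Longrightarrow> f (a, x) \<noteq> 0 \<Longrightarrow> x \<in> ES \<and> hdeg L x = h \<and> qdeg L x = q \<and> a = cl P' x \<and> deg x \<le> k"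
  unfolding F_def by blast

lemma F_diag: "f \<in> F k h q \<Longrightarrow> diag P' f = f"
proof
  fix z :: "(complex \<Rightarrow> int) \<times> enhanced_state" assume f: "f \<in> F k h q"
  obtain a x where z: "z = (a, x)" by (cases z)
  show "diag P' f z = f z" using F_D[OF f, of a x] by (auto simp: z diag_apply)
qed

lemma F_GV: "f \<in> F k h q \<Longrightarrow> f \<in> GV P' (lattice P') h q"
proof -
  assume f: "f \<in> F k h q"
  have "finite {a. \<exists>x. f (a, x) \<noteq> 0}" using diag_fin[of P' f] F_diag[OF f] by simp
  then show ?thesis using F_D[OF f] class_lattice unfolding gr_space_def by blast
qed

lemma diag_in_F:
  assumes g: "g \<in> GV P' I h q" and deg: "\<And>a x. g (a, x) \<noteq> 0 \<Longrightarrow> deg x \<le> k" shows "diag P' g \<in> F k h q"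
proof -
  have "x \<in> ES \<and> hdeg L x = h \<and> qdeg L x = q \<and> a = cl P' x \<and> deg x \<le> k" if "diag P' g (a, x) \<noteq> 0" for a x
    using that GV_D[OF g, of a x] deg[of a x] by (auto simp: diag_apply split: if_splits)
  then show ?thesis unfolding F_def by blast
qed

lemma deg_mono: "cl P y \<le> cl P x \<Longrightarrow> deg y \<le> deg x"
  unfolding coord_sum_def by (intro sum_mono) (auto simp: le_fun_def)

lemma deg_eq_class:
  assumes le: "cl P y \<le> cl P x" and eq: "deg y = deg x" shows "cl P y = cl P x"
proof
  fix p show "cl P y p = cl P x p"
  proof (cases "p \<in> P")
    case True
    have "sum (cl P y) P = sum (cl P x) P" using eq by (simp add: coord_sum_def)
    then show ?thesis using sum_mono_inv[of "cl P y" P "cl P x" p] le finite_punctures True by (auto simp: le_fun_def)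
  next
    case False
    then show ?thesis using class_lattice[of P x] class_lattice[of P y] by (simp add: lattice_def)
  qed
qed

text \<open>The class for \<open>P'\<close> consists of the coordinates at \<open>P'\<close> of the
  class for \<open>P\<close>.\<close>

lemma class_restrict: "cl P x = cl P y \<Longrightarrow> cl P' x = cl P' y"
proof
  fix p assume eq: "cl P x = cl P y"
  have "cl P' x p = (if p \<in> P' then cl P x p else 0)" for x
    using sub state_class_label_sum[OF sub, of "fst x" "snd x" p] state_class_label_sum[of P "fst x" "snd x" p] by auto
  then show "cl P' x p = cl P' y p" using eq by simp
qed

lemma D_nonzero:
  assumes "D f (a, y) \<noteq> 0"
  obtains x where "x \<in> ES" "y \<in> ES" "a = cl P' y" "f (a, x) \<noteq> 0"
    "hdeg L y = hdeg L x + 1" "qdeg L y = qdeg L x" "\<And>Q. Q \<subseteq> P \<Longrightarrow> cl Q y \<le> cl Q x"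
proof -
  have a: "a = cl P' y" "gd f (a, y) \<noteq> 0" using assms by (simp_all add: D_def diag_apply split: if_splits)
  from a(2) show ?thesis by (rule gd_nonzero) (use that a(1) in blast)
qed

lemma D_add': "D (f + g) = D f + D g" and D_scale': "D (qscale c f) = qscale c (D f)"
  by (simp_all add: D_def gd_add diag_add gd_scale diag_scale)

lemma D_linear: "Vector_Spaces.linear qscale qscale D"
  by (simp add: Vector_Spaces.linear_iff qv.vector_space_axioms D_add' D_scale')

definition hi :: int where "hi = Max (insert 0 (deg ` ES))"
definition lo :: int where "lo = Min (insert 0 (deg ` ES))"

lemma hi: "x \<in> ES \<Longrightarrow> deg x \<le> hi" and lo: "x \<in> ES \<Longrightarrow> lo \<le> deg x"
  unfolding hi_def lo_def using finite_enhanced_states by auto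

lemma D_F: "f \<in> F k h q \<Longrightarrow> D f \<in> F k (h + 1) q"
proof -
  assume f: "f \<in> F k h q"
  have "y \<in> ES \<and> hdeg L y = h + 1 \<and> qdeg L y = q \<and> a = cl P' y \<and> deg y \<le> k" if nz: "D f (a, y) \<noteq> 0" for a y
  proof -
    from nz obtain x where x: "x \<in> ES" "y \<in> ES" "a = cl P' y" "f (a, x) \<noteq> 0"
      "hdeg L y = hdeg L x + 1" "qdeg L y = qdeg L x" "\<And>Q. Q \<subseteq> P \<Longrightarrow> cl Q y \<le> cl Q x" by (rule D_nonzero) blast
    then show ?thesis using F_D[OF f x(4)] deg_mono[OF x(7)[OF order_refl]] by simp
  qed
  then show ?thesis unfolding F_def by blast
qed

lemma gd_minus_D:
  assumes "f \<in> F k h q" shows "gd f - D f \<in> GL P' (lattice P') (h + 1) q"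
  unfolding D_def by (rule diff_diag_GL[OF gd_GV[OF F_GV[OF assms] sub]])

text \<open>\<open>gd\<close> squares to zero, and replacing \<open>gd f\<close> by its normal form
  \<open>D f\<close> changes it by an element of \<open>GL\<close>, which \<open>D\<close> sends to
  0.\<close>

lemma D_square: "f \<in> F k h q \<Longrightarrow> D (D f) = 0"
proof -
  assume f: "f \<in> F k h q"
  have "D (gd f) = D (D f) + D (gd f - D f)" unfolding D_add'[symmetric] by simp
  moreover have "D (gd f) = 0" unfolding D_def gd_gd by (rule diag_zero)
  moreover have "D (gd f - D f) = 0"
    unfolding D_def[of "gd f - D f"] by (rule diag_GL[OF gd_GL[OF gd_minus_D[OF f] sub]])
  ultimately show ?thesis by simp
qed

sublocale fc: filtered_complex D F lo hi
proof (rule filtered_complex.intro)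
  show "Vector_Spaces.linear qscale qscale D" by (rule D_linear)
  show "qv.subspace (F k h q)" for k h q
  proof (rule qv_subspaceI)
    show "0 \<in> F k h q" by (simp add: F_def)
    fix f g assume "f \<in> F k h q" "g \<in> F k h q"
    then show "f + g \<in> F k h q" using support_cases(1)[of f g] unfolding F_def by blast
  next
    fix c f assume "f \<in> F k h q"
    then show "qscale c f \<in> F k h q" using support_cases(2)[of c f] unfolding F_def by blast
  qed
  show "F k h q \<subseteq> F k' h q" if "k \<le> k'" for k k' h q using that unfolding F_def by fastforce
  show "D (D f) = 0" if "f \<in> F k h q" for k h q f using that by (rule D_square)
  show "F k h q = {0}" if "k < lo" for k h q
  proof -
    have "f = 0" if f: "f \<in> F k h q" for f
    proof
      fix z :: "(complex \<Rightarrow> int) \<times> enhanced_state"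
      obtain a x where z: "z = (a, x)" by (cases z)
      show "f z = 0 z" using F_D[OF f, of a x] lo[of x] \<open>k < lo\<close> by (force simp: z)
    qed
    moreover have "0 \<in> F k h q" by (simp add: F_def)
    ultimately show ?thesis by blast
  qed
  show "F k h q = F hi h q" if "hi \<le> k" for k h q
    using that hi unfolding F_def by fastforce
qed


text \<open>Makes \<open>diag P'\<close> a chain map from the graded complex to the normal forms, by
  which cycles and boundaries are transferred.\<close>

lemma diag_gd_normal:
  assumes w: "w \<in> GV P' (lattice P') h q"
  shows "diag P' (gd w) = D (diag P' w)"
  using diag_gd_diag[OF w sub] by (simp add: D_def)

lemma diag_in_F_hi: "w \<in> GV P' I h q \<Longrightarrow> diag P' w \<in> F hi h q"
  by (rule diag_in_F) (use GV_D hi in blast)+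

section \<open>The limit of the spectral sequence\<close>

abbreviation M where "M h q \<equiv> MKh P' cs L h q"

lemma fst_M: "fst (M h q) = {g \<in> GV P' (lattice P') h q. gd g \<in> GL P' (lattice P') (h + 1) q}"
  and snd_M: "snd (M h q) = {gd u + b | u b. u \<in> GV P' (lattice P') (h - 1) q \<and> b \<in> GL P' (lattice P') h q}"
  unfolding MKh_def by (rule fst_MKh_on snd_MKh_on, rule order_refl)+

lemma fst_M_subspace: "qv.subspace (fst (M h q))"
proof (rule qv_subspaceI)
  show "0 \<in> fst (M h q)" using gr_space_zero gd_scale[of 0 0] by (simp add: fst_M qscale_def zero_fun_def)
  show "f + g \<in> fst (M h q)" if "f \<in> fst (M h q)" "g \<in> fst (M h q)" for f g
    using that gr_space_add by (simp add: fst_M gd_add)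
  show "qscale c f \<in> fst (M h q)" if "f \<in> fst (M h q)" for c f
    using that qv.subspace_scale[OF gr_space_subspace] by (simp add: fst_M gd_scale)
qed

lemma snd_M_subspace: "qv.subspace (snd (M h q))"
proof (rule qv_subspaceI)
  have "0 = gd 0 + (0 :: (complex \<Rightarrow> int) \<times> enhanced_state \<Rightarrow> rat)"
    using gd_add[of 0 0] by simp
  then show "0 \<in> snd (M h q)" unfolding snd_M using gr_space_zero by blast
  fix f g assume "f \<in> snd (M h q)" "g \<in> snd (M h q)"
  then obtain u b v c where e: "f = gd u + b" "g = gd v + c" "u \<in> GV P' (lattice P') (h - 1) q" "b \<in> GL P' (lattice P') h q"
    "v \<in> GV P' (lattice P') (h - 1) q" "c \<in> GL P' (lattice P') h q" unfolding snd_M by blast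
  have "f + g = gd (u + v) + (b + c)" unfolding e gd_add by simp
  then show "f + g \<in> snd (M h q)" unfolding snd_M using gr_space_add e by blast
next
  fix k f assume "f \<in> snd (M h q)"
  then obtain u b where e: "f = gd u + b" "u \<in> GV P' (lattice P') (h - 1) q" "b \<in> GL P' (lattice P') h q"
    unfolding snd_M by blast
  have "qscale k f = gd (qscale k u) + qscale k b" unfolding e gd_scale by (rule qv.scale_right_distrib)
  then show "qscale k f \<in> snd (M h q)"
    unfolding snd_M using qv.subspace_scale[OF gr_space_subspace] e by blast
qed

abbreviation MF where "MF h q k \<equiv> MKh_filtration P P' cs L h q k"

definition low :: "int \<Rightarrow> ((complex \<Rightarrow> int) \<times> enhanced_state \<Rightarrow> rat) set" where
  "low k = {z. \<forall>a x. z (a, x) \<noteq> 0 \<longrightarrow> deg x \<le> k}"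

lemma low_subspace: "qv.subspace (low k)"
proof (rule qv_subspaceI)
  show "0 \<in> low k" by (simp add: low_def)
  show "f + g \<in> low k" if "f \<in> low k" "g \<in> low k" for f g using that support_cases(1)[of f g] unfolding low_def by blast
  show "qscale c f \<in> low k" if "f \<in> low k" for c f using that support_cases(2)[of c f] unfolding low_def by blast
qed

lemma MF_eq: "MF h q k = {z + b | z b. z \<in> fst (M h q) \<and> b \<in> snd (M h q) \<and> z \<in> low k}"
  unfolding MKh_filtration_def low_def by simp

lemma MF_subspace: "qv.subspace (MF h q k)"
proof -
  have "MF h q k = {z + b | z b. z \<in> fst (M h q) \<inter> low k \<and> b \<in> snd (M h q)}" unfolding MF_eq by blast
  then show ?thesis
    using qv.subspace_sums[OF qv.subspace_inter[OF fst_M_subspace low_subspace] snd_M_subspace] by simp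
qed

lemma MF_mono: "k \<le> l \<Longrightarrow> MF h q k \<subseteq> MF h q l"
proof
  fix f assume k: "k \<le> l" and "f \<in> MF h q k"
  then obtain z b where zb: "f = z + b" "z \<in> fst (M h q)" "b \<in> snd (M h q)" "z \<in> low k" unfolding MF_eq by blast
  have "z \<in> low l" using zb(4) k unfolding low_def by force
  then show "f \<in> MF h q l" unfolding MF_eq using zb by blast
qed

lemma snd_gr_MKh: "snd (gr_MKh P P' cs L k h q) = MF h q (k - 1)"
proof -
  \<comment> \<open>The levels are indexed by integers and increase, so everything below
    \<open>k\<close> is contained in level \<open>k - 1\<close>.\<close>
  have "(\<Union>b\<in>{b \<in> UNIV. b < k}. MF h q b) = MF h q (k - 1)"
  proof
    show "(\<Union>b\<in>{b \<in> UNIV. b < k}. MF h q b) \<subseteq> MF h q (k - 1)"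
      using MF_mono[of _ "k - 1"] by (intro UN_least) auto
    have "k - 1 \<in> {b \<in> UNIV. b < k}" by simp
    then show "MF h q (k - 1) \<subseteq> (\<Union>b\<in>{b \<in> UNIV. b < k}. MF h q b)" by (rule UN_upper)
  qed
  then show ?thesis unfolding gr_MKh_def assoc_gr_def by (simp only: snd_conv qv.span_eq_iff[THEN iffD2, OF MF_subspace])
qed

lemma fst_gr_MKh: "fst (gr_MKh P P' cs L k h q) = MF h q k"
  by (simp add: gr_MKh_def assoc_gr_def)

lemma snd_M_subset_MF: "snd (M h q) \<subseteq> MF h q k"
proof
  fix b assume "b \<in> snd (M h q)"
  moreover have "0 \<in> fst (M h q)" "0 \<in> low k" using qv.subspace_0 fst_M_subspace low_subspace by blast+
  ultimately show "b \<in> MF h q k" unfolding MF_eq by force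
qed

lemma cycle_F_MF:
  assumes f: "f \<in> F k h q" and d: "D f = 0" shows "f \<in> MF h q k"
proof -
  have "gd f \<in> GL P' (lattice P') (h + 1) q" using gd_minus_D[OF f] unfolding d by simp
  then have "f \<in> fst (M h q)" using F_GV[OF f] by (simp add: fst_M)
  moreover have "f \<in> low k" using F_D[OF f] unfolding low_def by blast
  moreover have "0 \<in> snd (M h q)" using qv.subspace_0 snd_M_subspace by blast
  moreover have "f = f + 0" by simp
  ultimately show ?thesis unfolding MF_eq by blast
qed

lemma D_snd_M:
  assumes u: "u \<in> F k (h - 1) q" shows "D u \<in> snd (M h q)"
proof -
  have "D u = gd u + - (gd u - D u)" by simp
  moreover have "- (gd u - D u) \<in> GL P' (lattice P') h q" using gr_space_neg[OF gd_minus_D[OF u]] by simp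
  ultimately show ?thesis unfolding snd_M using F_GV[OF u] by blast
qed

lemma diag_snd_M:
  assumes "b \<in> snd (M h q)" obtains w where "w \<in> F hi (h - 1) q" "diag P' b = D w"
proof -
  obtain u c where e: "b = gd u + c" "u \<in> GV P' (lattice P') (h - 1) q" "c \<in> GL P' (lattice P') h q"
    using assms unfolding snd_M by blast
  have "diag P' b = D (diag P' u)" unfolding e(1) diag_add diag_GL[OF e(3)] diag_gd_normal[OF e(2)] by simp
  then show ?thesis using that diag_in_F_hi[OF e(2)] by blast
qed

text \<open>Passing to the normal form only deletes entries, all of them in \<open>GL\<close>: the
  degrees of the support stay bounded by \<open>k\<close>, and the homology class is
  unchanged.\<close>

lemma diag_cycle:
  assumes "z \<in> fst (M h q)" "z \<in> low k" shows "diag P' z \<in> F k h q" "D (diag P' z) = 0" "z - diag P' z \<in> snd (M h q)"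
proof -
  have z: "z \<in> GV P' (lattice P') h q" "gd z \<in> GL P' (lattice P') (h + 1) q" using assms(1) by (simp_all add: fst_M)
  show "diag P' z \<in> F k h q" using assms(2) by (intro diag_in_F[OF z(1)]) (auto simp: low_def)
  show "D (diag P' z) = 0" using diag_gd_normal[OF z(1)] diag_GL[OF z(2)] by simp
  have "z - diag P' z = gd 0 + (z - diag P' z)" using gd_add[of 0 0] by simp
  then show "z - diag P' z \<in> snd (M h q)" unfolding snd_M using gr_space_zero diff_diag_GL[OF z(1)] by blast
qed

text \<open>The stable page consists of the \<open>D\<close>-cycles of level \<open>k\<close> modulo
  those homologous to cycles of level \<open>k - 1\<close>. Read as classes in \<open>MKh\<close>,
  these are the steps of the induced filtration, so the identity again represents the
  isomorphism.\<close>

lemma E_infinity: "E_infinity_iso fc.page (\<lambda>r k h q. D) (gr_MKh P P' cs L)"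
  unfolding E_infinity_iso_def
proof (intro allI)
  fix k h q
  obtain R where R: "R \<ge> 1"
    "\<And>r. r \<ge> R \<Longrightarrow> D ` fst (fc.page r k h q) \<subseteq> snd (fc.page r (k - int r) (h + 1) q)
            \<and> D ` fst (fc.page r (k + int r) (h - 1) q) \<subseteq> snd (fc.page r k h q)"
    and page: "fst (fc.page R k h q) = {f \<in> F k h q. D f = 0}"
    "snd (fc.page R k h q) = {f + D u | f u. f \<in> F (k - 1) h q \<and> D f = 0 \<and> u \<in> F hi (h - 1) q \<and> D u \<in> F k h q}"
    by (rule fc.page_stable[of k h q]) blast
  have "fc.page R k h q \<cong>\<^sub>q gr_MKh P P' cs L k h q"
    unfolding subquot_iso_def subquot_map_def page fst_gr_MKh snd_gr_MKh
  proof (intro exI[of _ "\<lambda>f. f"] conjI ballI impI)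
    show "(\<lambda>f. f) ` {f \<in> F k h q. D f = 0} \<subseteq> MF h q k" using cycle_F_MF by auto
    show "(\<lambda>f. f) ` {f + D u | f u. f \<in> F (k - 1) h q \<and> D f = 0 \<and> u \<in> F hi (h - 1) q \<and> D u \<in> F k h q} \<subseteq> MF h q (k - 1)"
    proof -
      have "f + D u \<in> MF h q (k - 1)" if "f \<in> F (k - 1) h q" "D f = 0" "u \<in> F hi (h - 1) q" for f u
        using cycle_F_MF[OF that(1,2)] D_snd_M[OF that(3)] snd_M_subset_MF qv.subspace_add[OF MF_subspace] by blast
      then show ?thesis by auto
    qed
    fix f assume f: "f \<in> {f \<in> F k h q. D f = 0}" and "f \<in> MF h q (k - 1)"
    then obtain z b where zb: "f = z + b" "z \<in> fst (M h q)" "b \<in> snd (M h q)" "z \<in> low (k - 1)" unfolding MF_eq by blast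
    obtain w where w: "w \<in> F hi (h - 1) q" "diag P' b = D w" using diag_snd_M[OF zb(3)] by blast
    note z = diag_cycle[OF zb(2,4)]
    have fk: "f \<in> F k h q" using f by simp
    \<comment> \<open>\<open>f\<close> is its own normal form, so taking normal forms in
      \<open>f = z + b\<close> decomposes it into a cycle of level \<open>k - 1\<close> and a
      boundary \<open>D w\<close>.\<close>
    have "f = diag P' f" using F_diag[OF fk] by simp
    also have "\<dots> = diag P' z + D w" unfolding zb(1) diag_add w(2) ..
    finally have eq: "f = diag P' z + D w" .
    have "D w = f - diag P' z" using eq by simp
    then have "D w \<in> F k h q" using fc.F_diff[OF fk fc.F_mono[OF z(1)]] by simp
    then show "f \<in> {f + D u | f u. f \<in> F (k - 1) h q \<and> D f = 0 \<and> u \<in> F hi (h - 1) q \<and> D u \<in> F k h q}"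
      using eq z w(1) by blast
  next
    fix y assume "y \<in> MF h q k"
    then obtain z b where zb: "y = z + b" "z \<in> fst (M h q)" "b \<in> snd (M h q)" "z \<in> low k" unfolding MF_eq by blast
    note z = diag_cycle[OF zb(2,4)]
    have e: "y - diag P' z = (z - diag P' z) + b" unfolding zb(1) by simp
    have "y - diag P' z \<in> snd (M h q)" unfolding e by (rule qv.subspace_add[OF snd_M_subspace z(3) zb(3)])
    then show "\<exists>x\<in>{f \<in> F k h q. D f = 0}. y - x \<in> MF h q (k - 1)" using z snd_M_subset_MF by blast
  qed (rule qv_linear_id)
  then show "\<exists>R\<ge>1.
      (\<forall>r\<ge>R. D ` fst (fc.page r k h q) \<subseteq> snd (fc.page r (k - int r) (h + 1) q)
            \<and> D ` fst (fc.page r (k + int r) (h - 1) q) \<subseteq> snd (fc.page r k h q))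
    \<and> fc.page R k h q \<cong>\<^sub>q gr_MKh P P' cs L k h q"
    using R by blast
qed

section \<open>The first page\<close>

definition level :: "int \<Rightarrow> (complex \<Rightarrow> int) set" where
  "level k = {a \<in> lattice P. coord_sum P a = k}"

text \<open>\<open>to_gr\<close> relabels the part of degree \<open>k\<close> by the classes in \<open>P\<close> instead of those in \<open>P'\<close>.\<close>

definition to_gr :: "int \<Rightarrow> ((complex \<Rightarrow> int) \<times> enhanced_state \<Rightarrow> rat) \<Rightarrow> (complex \<Rightarrow> int) \<times> enhanced_state \<Rightarrow> rat" where
  "to_gr k f = (\<lambda>(a, x). if x \<in> ES \<and> a = cl P x \<and> deg x = k then f (cl P' x, x) else 0)"

definition of_gr :: "int \<Rightarrow> ((complex \<Rightarrow> int) \<times> enhanced_state \<Rightarrow> rat) \<Rightarrow> (complex \<Rightarrow> int) \<times> enhanced_state \<Rightarrow> rat" where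
  "of_gr k g = (\<lambda>(a, x). if x \<in> ES \<and> a = cl P' x \<and> deg x = k then g (cl P x, x) else 0)"

lemma to_gr_apply: "to_gr k f (a, x) = (if x \<in> ES \<and> a = cl P x \<and> deg x = k then f (cl P' x, x) else 0)"
  and of_gr_apply: "of_gr k f (a, x) = (if x \<in> ES \<and> a = cl P' x \<and> deg x = k then f (cl P x, x) else 0)"
  by (simp_all add: to_gr_def of_gr_def)

lemma to_gr_add: "to_gr k (f + g) = to_gr k f + to_gr k g"
  and to_gr_scale: "to_gr k (qscale c f) = qscale c (to_gr k f)"
  by (auto simp: to_gr_def qscale_def fun_eq_iff)

lemma to_gr_diff: "to_gr k (f - g) = to_gr k f - to_gr k g"
  by (auto simp: to_gr_def fun_eq_iff)

lemma to_gr_linear: "Vector_Spaces.linear qscale qscale (to_gr k)"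
  by (simp add: Vector_Spaces.linear_iff qv.vector_space_axioms to_gr_add to_gr_scale)

lemma to_gr_GV:
  assumes f: "f \<in> F l h q" shows "to_gr k f \<in> GV P (level k) h q"
proof -
  have "a \<in> level k \<and> x \<in> ES \<and> hdeg L x = h \<and> qdeg L x = q \<and> cl P x \<le> a" if "to_gr k f (a, x) \<noteq> 0" for a x
    using that F_D[OF f, of "cl P' x" x] class_lattice[of P x] by (auto simp: to_gr_apply level_def split: if_splits)
  moreover have "{a. \<exists>x. to_gr k f (a, x) \<noteq> 0} \<subseteq> cl P ` ES" by (auto simp: to_gr_apply split: if_splits)
  then have "finite {a. \<exists>x. to_gr k f (a, x) \<noteq> 0}" using finite_enhanced_states finite_subset by blast
  ultimately show ?thesis unfolding gr_space_def by blast
qed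

lemma diag_to_gr: "diag P (to_gr k f) = to_gr k f"
proof
  fix z :: "(complex \<Rightarrow> int) \<times> enhanced_state"
  show "diag P (to_gr k f) z = to_gr k f z" by (cases z) (auto simp: diag_apply to_gr_apply)
qed

lemma of_gr_F: "g \<in> GV P I h q \<Longrightarrow> of_gr k g \<in> F k h q"
proof -
  assume g: "g \<in> GV P I h q"
  have "x \<in> ES \<and> hdeg L x = h \<and> qdeg L x = q \<and> a = cl P' x \<and> deg x \<le> k" if "of_gr k g (a, x) \<noteq> 0" for a x
    using that GV_D[OF g, of "cl P x" x] by (auto simp: of_gr_apply split: if_splits)
  then show ?thesis unfolding F_def by blast
qed

lemma to_gr_of_gr:
  assumes g: "g \<in> GV P (level k) h q" shows "to_gr k (of_gr k g) = diag P g"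
proof
  fix z :: "(complex \<Rightarrow> int) \<times> enhanced_state"
  obtain a x where z: "z = (a, x)" by (cases z)
  show "to_gr k (of_gr k g) z = diag P g z"
  proof (cases "x \<in> ES \<and> a = cl P x \<and> g (a, x) \<noteq> 0")
    case True
    then have "deg x = k" using GV_D[OF g, of a x] by (auto simp: level_def)
    then show ?thesis using True by (auto simp: z to_gr_apply of_gr_apply diag_apply)
  next
    case False
    then show ?thesis by (auto simp: z to_gr_apply of_gr_apply diag_apply)
  qed
qed

text \<open>\<open>to_gr k\<close> retains exactly the generators of degree \<open>k\<close>, so its
  kernel on level \<open>k\<close> is the level below.\<close>

lemma to_gr_eq_0_iff:
  assumes f: "f \<in> F k h q" shows "to_gr k f = 0 \<longleftrightarrow> f \<in> F (k - 1) h q"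
proof
  assume 0: "to_gr k f = 0"
  have "x \<in> ES \<and> hdeg L x = h \<and> qdeg L x = q \<and> a = cl P' x \<and> deg x \<le> k - 1" if nz: "f (a, x) \<noteq> 0" for a x
  proof -
    note d = F_D[OF f nz]
    have "to_gr k f (cl P x, x) = 0" using 0 by simp
    then have "deg x \<noteq> k" using d nz by (auto simp: to_gr_apply)
    then show ?thesis using d by linarith
  qed
  then show "f \<in> F (k - 1) h q" unfolding F_def by blast
next
  assume f': "f \<in> F (k - 1) h q"
  show "to_gr k f = 0"
  proof
    fix z :: "(complex \<Rightarrow> int) \<times> enhanced_state"
    obtain a x where z: "z = (a, x)" by (cases z)
    show "to_gr k f z = 0 z" using F_D[OF f', of "cl P' x" x] by (auto simp: z to_gr_apply)
  qed
qed

text \<open>An entry of the differential which preserves the degree \<open>k\<close> preserves the class in \<open>P\<close>, since it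
  does not increase any coordinate of it.\<close>

lemma to_gr_D:
  assumes f: "f \<in> F k h q" shows "to_gr k (D f) = diag P (gd (to_gr k f))"
proof
  fix z :: "(complex \<Rightarrow> int) \<times> enhanced_state"
  obtain a y where z: "z = (a, y)" by (cases z)
  have term_eq: "f (cl P' y, x) * dd x y = to_gr k f (cl P y, x) * dd x y"
    if y: "y \<in> ES" "deg y = k" and x: "x \<in> ES" for x
  proof (cases "dd x y = 0")
    case False
    have le: "cl P y \<le> cl P x" using diff_entry_degrees(3)[OF set_cs x y(1) False order_refl] .
    show ?thesis
    proof (cases "f (cl P' y, x) = 0")
      case True
      then show ?thesis using class_restrict[of x y] by (auto simp: to_gr_apply)
    next
      case False
      then have "deg y = deg x" using F_D[OF f False] deg_mono[OF le] y(2) by simp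
      then have "cl P y = cl P x" by (rule deg_eq_class[OF le])
      then show ?thesis using F_D[OF f False] x \<open>deg y = deg x\<close> y(2) by (auto simp: to_gr_apply)
    qed
  qed simp
  show "to_gr k (D f) z = diag P (gd (to_gr k f)) z"
  proof (cases "y \<in> ES \<and> a = cl P y")
    case True
    show ?thesis
    proof (cases "deg y = k")
      case k: True
      have "to_gr k (D f) z = (\<Sum>x\<in>ES. f (cl P' y, x) * dd x y)"
        using True k by (auto simp: z to_gr_apply D_def diag_apply gd_apply)
      also have "\<dots> = (\<Sum>x\<in>ES. to_gr k f (cl P y, x) * dd x y)"
        using term_eq True k by (intro sum.cong) auto
      also have "\<dots> = diag P (gd (to_gr k f)) z" using True by (auto simp: z diag_apply gd_apply)
      finally show ?thesis .
    next
      case k: False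
      have "to_gr k f (cl P y, x) = 0" for x using k by (auto simp: to_gr_apply)
      then have "gd (to_gr k f) (cl P y, y) = 0" by (simp add: gd_apply)
      then show ?thesis using k by (simp add: z to_gr_apply diag_apply)
    qed
  qed (auto simp: z to_gr_apply diag_apply)
qed

lemma level_lattice: "level k \<subseteq> lattice P"
  by (auto simp: level_def)

lemma fst_flat: "fst (flat_MKh P cs L k h q) = {g \<in> GV P (level k) h q. gd g \<in> GL P (level k) (h + 1) q}"
  and snd_flat: "snd (flat_MKh P cs L k h q) = {gd u + b | u b. u \<in> GV P (level k) (h - 1) q \<and> b \<in> GL P (level k) h q}"
  unfolding flat_MKh_def level_def[symmetric] by (rule fst_MKh_on[OF level_lattice] snd_MKh_on[OF level_lattice])+

lemma GL_snd_flat: "b \<in> GL P (level k) h q \<Longrightarrow> b \<in> snd (flat_MKh P cs L k h q)"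
proof -
  assume b: "b \<in> GL P (level k) h q"
  have "b = gd 0 + b" using gd_add[of 0 0] by simp
  then show ?thesis unfolding snd_flat using gr_space_zero b by blast
qed

lemma gd_diag_diff:
  assumes "g \<in> GV P (level k) (h - 1) q" shows "diag P (gd g) \<in> snd (flat_MKh P cs L k h q)"
proof -
  have v: "gd g \<in> GV P (level k) h q" using gd_GV[OF assms order_refl] by simp
  have "diag P (gd g) = gd g + - (gd g - diag P (gd g))" by simp
  then show ?thesis unfolding snd_flat using assms gr_space_neg[OF diff_diag_GL[OF v]] by blast
qed

text \<open>\<open>to_gr k\<close> identifies \<open>F k / F (k - 1)\<close>, with the differential
  induced by \<open>D\<close>, with the part of degree \<open>k\<close> of the graded complex for
  \<open>P\<close>, and the first page is the homology of this quotient. Up to \<open>GL\<close> its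
  inverse is \<open>of_gr k\<close>.\<close>

lemma E1_iso: "fc.page 1 k h q \<cong>\<^sub>q flat_MKh P cs L k h q"
proof -
  have pg: "fst (fc.page 1 k h q) = fc.Z k (k - 1) h q" "snd (fc.page 1 k h q) = fc.B 1 k h q"
    by (simp_all add: fc.page_def)
  have ZF: "f \<in> F k h q" "D f \<in> F l (h + 1) q" if "f \<in> fc.Z k l h q" for f k l h q
    using that by (simp_all add: fc.Z_def)
  show ?thesis
    unfolding subquot_iso_def subquot_map_def pg
  proof (intro exI[of _ "to_gr k"] conjI ballI impI)
    show "to_gr k ` fc.Z k (k - 1) h q \<subseteq> fst (flat_MKh P cs L k h q)"
    proof
      fix g assume "g \<in> to_gr k ` fc.Z k (k - 1) h q"
      then obtain f where f: "f \<in> fc.Z k (k - 1) h q" "g = to_gr k f" by blast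
      have v: "to_gr k f \<in> GV P (level k) h q" by (rule to_gr_GV[OF ZF(1)[OF f(1)]])
      have "to_gr k (D f) = 0" using to_gr_eq_0_iff[OF D_F[OF ZF(1)[OF f(1)]]] ZF(2)[OF f(1)] by simp
      then have "gd (to_gr k f) \<in> GL P (level k) (h + 1) q"
        using GL_iff_diag[OF gd_GV[OF v order_refl]] to_gr_D[OF ZF(1)[OF f(1)]] by simp
      then show "g \<in> fst (flat_MKh P cs L k h q)" using v f(2) by (simp add: fst_flat)
    qed
    show "to_gr k ` fc.B 1 k h q \<subseteq> snd (flat_MKh P cs L k h q)"
    proof
      fix g assume "g \<in> to_gr k ` fc.B 1 k h q"
      then obtain b where b: "b \<in> fc.B 1 k h q" "g = to_gr k b" by blast
      obtain f u where fu: "b = f + D u" "f \<in> fc.Z (k - 1) (k - 1) h q" "u \<in> fc.Z (k + 1 - 1) k (h - 1) q"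
        using b(1) by (rule fc.B_E)
      have f: "f \<in> F (k - 1) h q" using ZF(1)[OF fu(2)] .
      then have "to_gr k f = 0" using to_gr_eq_0_iff[OF fc.F_mono[OF f]] by simp
      moreover have u: "u \<in> F k (h - 1) q" using ZF(1)[OF fu(3)] by simp
      ultimately have "g = diag P (gd (to_gr k u))" unfolding b(2) fu(1) to_gr_add to_gr_D[OF u] by simp
      then show "g \<in> snd (flat_MKh P cs L k h q)" using gd_diag_diff[OF to_gr_GV[OF u]] by simp
    qed
    fix f assume fZ: "f \<in> fc.Z k (k - 1) h q" and "to_gr k f \<in> snd (flat_MKh P cs L k h q)"
    then obtain w b where w: "to_gr k f = gd w + b" "w \<in> GV P (level k) (h - 1) q" "b \<in> GL P (level k) h q"
      unfolding snd_flat by blast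
    \<comment> \<open>Lifts the bounding chain to level \<open>k\<close>. Then \<open>f\<close> and
      \<open>D u\<close> have the same image under \<open>to_gr k\<close>, so they differ by an
      element of the level below.\<close>
    define u where "u = of_gr k w"
    have u: "u \<in> F k (h - 1) q" unfolding u_def by (rule of_gr_F[OF w(2)])
    have "to_gr k f = diag P (gd w)" using arg_cong[OF w(1), of "diag P"] unfolding diag_to_gr diag_add diag_GL[OF w(3)] by simp
    also have "\<dots> = to_gr k (D u)"
      unfolding to_gr_D[OF u] unfolding u_def to_gr_of_gr[OF w(2)] diag_gd_diag[OF w(2) order_refl] ..
    finally have "to_gr k (f - D u) = 0" by (simp add: to_gr_diff)
    moreover have Du: "D u \<in> F k h q" using D_F[OF u] by simp
    then have "f - D u \<in> F k h q" using fc.F_diff[OF ZF(1)[OF fZ]] by simp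
    ultimately have f': "f - D u \<in> F (k - 1) h q" using to_gr_eq_0_iff by blast
    have "D (f - D u) = D f" unfolding fc.D_diff D_square[OF u] by simp
    then have "f - D u \<in> fc.Z (k - 1) (k - 1) h q" using f' ZF(2)[OF fZ] by (simp add: fc.Z_def)
    moreover have "u \<in> fc.Z (k + 1 - 1) k (h - 1) q" using u Du by (simp add: fc.Z_def)
    moreover have "f = (f - D u) + D u" by simp
    ultimately show "f \<in> fc.B 1 k h q" unfolding fc.B_def by blast
  next
    fix g assume "g \<in> fst (flat_MKh P cs L k h q)"
    then have g: "g \<in> GV P (level k) h q" "gd g \<in> GL P (level k) (h + 1) q" by (simp_all add: fst_flat)
    define f where "f = of_gr k g"
    have f: "f \<in> F k h q" unfolding f_def by (rule of_gr_F[OF g(1)])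
    have tf: "to_gr k f = diag P g" unfolding f_def by (rule to_gr_of_gr[OF g(1)])
    have "to_gr k (D f) = 0"
      unfolding to_gr_D[OF f] tf diag_gd_diag[OF g(1) order_refl] by (rule diag_GL[OF g(2)])
    then have "D f \<in> F (k - 1) (h + 1) q" using to_gr_eq_0_iff[OF D_F[OF f]] by simp
    then have "f \<in> fc.Z k (k - 1) h q" using f by (simp add: fc.Z_def)
    moreover have "g - to_gr k f \<in> snd (flat_MKh P cs L k h q)"
      unfolding tf by (rule GL_snd_flat[OF diff_diag_GL[OF g(1)]])
    ultimately show "\<exists>x\<in>fc.Z k (k - 1) h q. g - to_gr k x \<in> snd (flat_MKh P cs L k h q)" by blast
  qed (rule to_gr_linear)
qed

end

theorem theorem1p6:
  fixes P P' :: "complex set" and L :: link and cs :: "complex list"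
  assumes "finite P" and "P \<subseteq> ball 0 1" and "P' \<subseteq> P"
    and "is_link P L" and "generic_projection L"
    and "distinct cs" and "set cs = crossings L"
  shows "\<exists>(E :: ((complex \<Rightarrow> int) \<times> enhanced_state) pages) d.
      spectral_sequence E d
    \<and> (\<forall>k h q. E 1 k h q \<cong>\<^sub>q flat_MKh P cs L k h q)
    \<and> E_infinity_iso E d (gr_MKh P P' cs L)"
proof -
  interpret khovanov P L P' cs by unfold_locales (use assms in auto)
  show ?thesis using fc.spectral_sequence_page E1_iso E_infinity by blast
qed

end
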